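(* Let $X=(X_t)_{t\in[0,T]}$ be a real càdlàg process of finite quadratic variation and let $F:[0,T]\times\mathbb{R}\to\mathbb{R}$ be a function of class $C^{1,2}$. Then the forward integral $\int_0^{\cdot}\partial_xF(s,X_s)\,d^-X_s$ exists and, for $t\in[0,T]$, $$\begin{aligned}F(t,X_t)=\;&F(0,X_0)+\int_0^t\partial_sF(s,X_s)\,ds+\int_0^t\partial_xF(s,X_s)\,d^-X_s+\frac12\int_0^t\partial^2_{xx}F(s,X_{s-})\,d[X,X]^c_s\\&+\sum_{s\le t}\big[F(s,X_s)-F(s,X_{s-})-\partial_xF(s,X_{s-})\,\Delta X_s\big].\end{aligned}$$
   Context: Fix $T>0$ and a probability space $(\Omega,\mathcal F,\mathbb P)$ with a filtration $(\mathcal F_t)_{t\in[0,T]}$ satisfying the usual conditions. Every càdlàg process on $[0,T]$ is extended to $\mathbb R_+$ by continuity (constant after $T$). "u.c.p." means uniform (in $t\in[0,T]$) convergence in probability. $\Delta X_s=X_s-X_{s-}$, and sums over $s\le t$ run over $s\in]0,t]$. $C^{1,2}$ is the space of functions $u:[0,T]\times\mathbb R\to\mathbb R$ that are continuous together with $\partial_tu,\partial_xu,\partial_{xx}^2u$. Forward integral: for a càdlàg process $X$ and a process $Y$ with paths in $L^1([0,T])$ a.s., put $$I^{-ucp}(\varepsilon,t,Y,dX)=\int_{]0,t]}Y_s\,\frac{X_{(s+\varepsilon)\wedge t}-X_s}{\varepsilon}\,ds.$$ If this converges u.c.p. as $\varepsilon\to0$ to a process $I(t)$, the forward integral $\int_0^tY_s\,d^-X_s=\int_{]0,t]}Y_s\,d^-X_s:=I(t)$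 is said to exist. Covariation: for càdlàg $X,Y$ put $$[X,Y]^{ucp}_\varepsilon(t)=\int_{]0,t]}\frac{(X_{(s+\varepsilon)\wedge t}-X_s)(Y_{(s+\varepsilon)\wedge t}-Y_s)}{\varepsilon}\,ds.$$ If this converges u.c.p. as $\varepsilon\to0$, the limit is the covariation $[X,Y]$ (and $[X,Y]$ is said to exist). $X$ is of finite quadratic variation if $[X,X]$ exists; $[X,X]$ is then increasing and càdlàg, and $[X,X]^c$ denotes its continuous part. *)

theory Defs
  imports "HOL-Probability.Probability"
begin

text \<open>Processes are indexed by all of \<open>real\<close>, but only their values at times in \<open>{0..T}\<close> are ever
  used or constrained.\<close>

definition usual_conditions :: "'a measure \<Rightarrow> real \<Rightarrow> (real \<Rightarrow> 'a measure) \<Rightarrow> bool" where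
  "usual_conditions M T \<F> \<longleftrightarrow>
     (\<forall>t\<in>{0..T}. subalgebra M (\<F> t)) \<and>
     (\<forall>s\<in>{0..T}. \<forall>t\<in>{0..T}. s \<le> t \<longrightarrow> sets (\<F> s) \<subseteq> sets (\<F> t)) \<and>
     (\<forall>t\<in>{0..<T}. sets (\<F> t) = (\<Inter>u\<in>{t<..T}. sets (\<F> u))) \<and>
     complete_measure M \<and> null_sets M \<subseteq> sets (\<F> 0)"

definition process :: "'a measure \<Rightarrow> real \<Rightarrow> (real \<Rightarrow> 'a \<Rightarrow> real) \<Rightarrow> bool" where
  "process M T X \<longleftrightarrow> (\<forall>t\<in>{0..T}. X t \<in> borel_measurable M)"

definition cadlag_path :: "real \<Rightarrow> (real \<Rightarrow> real) \<Rightarrow> bool" where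
  "cadlag_path T f \<longleftrightarrow>
     (\<forall>t\<in>{0..<T}. (f \<longlongrightarrow> f t) (at_right t)) \<and>
     (\<forall>t\<in>{0<..T}. \<exists>l. (f \<longlongrightarrow> l) (at_left t))"

definition cadlag_process :: "'a measure \<Rightarrow> real \<Rightarrow> (real \<Rightarrow> 'a \<Rightarrow> real) \<Rightarrow> bool" where
  "cadlag_process M T X \<longleftrightarrow> process M T X \<and> (AE \<omega> in M. cadlag_path T (\<lambda>t. X t \<omega>))"

definition left_lim :: "(real \<Rightarrow> real) \<Rightarrow> real \<Rightarrow> real" where
  "left_lim f s = Lim (at_left s) f"

definition jump :: "(real \<Rightarrow> real) \<Rightarrow> real \<Rightarrow> real" where
  "jump f s = f s - left_lim f s"

text \<open>The event below is the one that the supremum over \<open>t \<in> {0..T}\<close> of the distance exceeds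
  \<open>\<delta>\<close>. It need not be measurable for arbitrary processes, and \<open>measure M\<close> would then be \<open>0\<close>; hence
  the outer measure, which is the probability whenever the event is measurable.\<close>

definition ucp_limit ::
  "'a measure \<Rightarrow> real \<Rightarrow> (real \<Rightarrow> real \<Rightarrow> 'a \<Rightarrow> real) \<Rightarrow> (real \<Rightarrow> 'a \<Rightarrow> real) \<Rightarrow> bool" where
  "ucp_limit M T Z Z0 \<longleftrightarrow>
     (\<forall>\<delta>>0. ((\<lambda>\<epsilon>. outer_measure_of M {\<omega> \<in> space M. \<exists>t\<in>{0..T}. \<bar>Z \<epsilon> t \<omega> - Z0 t \<omega>\<bar> > \<delta>})
        \<longlongrightarrow> 0) (at_right 0))"

text \<open>Since \<open>min (s + \<epsilon>) t \<le> T\<close>, the constant extension of the processes beyond \<open>T\<close> is never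
  evaluated.\<close>

definition forward_approx ::
  "real \<Rightarrow> (real \<Rightarrow> 'a \<Rightarrow> real) \<Rightarrow> (real \<Rightarrow> 'a \<Rightarrow> real) \<Rightarrow> real \<Rightarrow> 'a \<Rightarrow> real" where
  "forward_approx \<epsilon> Y X t \<omega> =
     (LINT s:{0<..t}|lborel. Y s \<omega> * ((X (min (s + \<epsilon>) t) \<omega> - X s \<omega>) / \<epsilon>))"

definition covariation_approx ::
  "real \<Rightarrow> (real \<Rightarrow> 'a \<Rightarrow> real) \<Rightarrow> (real \<Rightarrow> 'a \<Rightarrow> real) \<Rightarrow> real \<Rightarrow> 'a \<Rightarrow> real" where
  "covariation_approx \<epsilon> X Y t \<omega> =
     (LINT s:{0<..t}|lborel.
        (X (min (s + \<epsilon>) t) \<omega> - X s \<omega>) * (Y (min (s + \<epsilon>) t) \<omega> - Y s \<omega>) / \<epsilon>)"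

text \<open>The forward integral and the covariation are determined only up to indistinguishability, so
  they are relations between the integrand and integrator (resp. the two processes) and a version
  of the limit, which is the last argument.\<close>

definition is_forward_integral ::
  "'a measure \<Rightarrow> real \<Rightarrow> (real \<Rightarrow> 'a \<Rightarrow> real) \<Rightarrow> (real \<Rightarrow> 'a \<Rightarrow> real) \<Rightarrow> (real \<Rightarrow> 'a \<Rightarrow> real) \<Rightarrow> bool" where
  "is_forward_integral M T Y X I \<longleftrightarrow>
     cadlag_process M T X \<and>
     process M T Y \<and> (AE \<omega> in M. set_integrable lborel {0..T} (\<lambda>s. Y s \<omega>)) \<and>
     process M T I \<and> ucp_limit M T (\<lambda>\<epsilon>. forward_approx \<epsilon> Y X) I"

definition is_covariation ::
  "'a measure \<Rightarrow> real \<Rightarrow> (real \<Rightarrow> 'a \<Rightarrow> real) \<Rightarrow> (real \<Rightarrow> 'a \<Rightarrow> real) \<Rightarrow> (real \<Rightarrow> 'a \<Rightarrow> real) \<Rightarrow> bool" where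
  "is_covariation M T X Y Q \<longleftrightarrow>
     cadlag_process M T X \<and> cadlag_process M T Y \<and>
     process M T Q \<and> ucp_limit M T (\<lambda>\<epsilon>. covariation_approx \<epsilon> X Y) Q"

definition finite_quadratic_variation :: "'a measure \<Rightarrow> real \<Rightarrow> (real \<Rightarrow> 'a \<Rightarrow> real) \<Rightarrow> bool" where
  "finite_quadratic_variation M T X \<longleftrightarrow> (\<exists>Q. is_covariation M T X X Q)"

definition continuous_part :: "(real \<Rightarrow> real) \<Rightarrow> real \<Rightarrow> real" where
  "continuous_part A t = A t - (\<Sum>\<^sub>\<infinity>s\<in>{0<..t}. jump A s)"

text \<open>The Lebesgue-Stieltjes measure of an increasing right-continuous function on \<open>{0..T}\<close>.
  \<open>interval_measure\<close> needs such a function on the whole line, hence the constant extension on both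
  sides, which adds no mass outside \<open>{0<..T}\<close>.\<close>

definition stieltjes_measure :: "real \<Rightarrow> (real \<Rightarrow> real) \<Rightarrow> real measure" where
  "stieltjes_measure T A = interval_measure (\<lambda>s. A (max 0 (min T s)))"

text \<open>At the endpoints \<open>0\<close> and \<open>T\<close> the time derivative is one-sided.\<close>

definition dt :: "real \<Rightarrow> (real \<Rightarrow> real \<Rightarrow> real) \<Rightarrow> real \<Rightarrow> real \<Rightarrow> real" where
  "dt T F t x = vector_derivative (\<lambda>s. F s x) (at t within {0..T})"

definition dx :: "(real \<Rightarrow> real \<Rightarrow> real) \<Rightarrow> real \<Rightarrow> real \<Rightarrow> real" where
  "dx F t x = deriv (F t) x"

definition dxx :: "(real \<Rightarrow> real \<Rightarrow> real) \<Rightarrow> real \<Rightarrow> real \<Rightarrow> real" where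
  "dxx F = dx (dx F)"

definition C12 :: "real \<Rightarrow> (real \<Rightarrow> real \<Rightarrow> real) \<Rightarrow> bool" where
  "C12 T F \<longleftrightarrow>
     (\<forall>t\<in>{0..T}. \<forall>x. (\<lambda>s. F s x) differentiable (at t within {0..T}) \<and>
        F t differentiable (at x) \<and> dx F t differentiable (at x)) \<and>
     continuous_on ({0..T} \<times> UNIV) (\<lambda>(t, x). F t x) \<and>
     continuous_on ({0..T} \<times> UNIV) (\<lambda>(t, x). dt T F t x) \<and>
     continuous_on ({0..T} \<times> UNIV) (\<lambda>(t, x). dx F t x) \<and>
     continuous_on ({0..T} \<times> UNIV) (\<lambda>(t, x). dxx F t x)"

end

theory Submission
  imports Defs
begin

text \<open>The proof is pathwise. Along any sequence of regularisation parameters tending to \<open>0\<close>, a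
  subsequence makes the regularised quadratic variations converge uniformly in time on almost every
  path (\<open>ucp_limit_subsequence\<close>), and on such a path everything else is deterministic analysis.

  Write \<open>r = min (s + \<epsilon>) t\<close> and split the increment of \<open>F\<close> along the path,
  \<open>F r (x r) - F s (x s) = (F r (x r) - F s (x r)) + dx F s (x s) * (x r - x s) + G s (x s) (x r)\<close>,
  where \<open>G\<close> is the second-order Taylor remainder in space. Divided by \<open>\<epsilon>\<close> and integrated over \<open>s\<close>, the
  left-hand side telescopes to \<open>F t (x t) - F 0 (x 0)\<close> (\<open>total_increment_limit\<close>), the first term gives
  the integral of the time derivative (\<open>time_increment_limit\<close>), and the second is the
  approximation of the forward integral. Hence the forward integral exists along the path as soon as
  the averages of \<open>G\<close> converge, and its value is then the one that Ito's formula prescribes.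

  The averages of \<open>G\<close> are treated in \<open>quadratic_remainder_limit\<close>. By Lagrange's form of the remainder,
  \<open>G s p r = H s \<xi> * (r - p)\<^sup>2\<close> with \<open>H\<close> half the second derivative and \<open>\<xi>\<close> between \<open>p\<close> and \<open>r\<close>.
  On an interval where the path oscillates little before the right endpoint, \<open>G\<close> is therefore a constant times the squared
  increment, except for the increments across the endpoint, which see the jump there. Squared
  increments are controlled by the quadratic variation \<open>q\<close>; its jumps are the squared jumps of the
  path (\<open>jump_q\<close>), so the jump at the endpoint can be replaced by its exact contribution. The
  error is a small multiple of the increase of \<open>q\<close> over the interval. Errors of this kind add up over
  adjacent intervals, and every time has a neighbourhood on both sides of which the path oscillates
  little, so Bolzano's principle extends the estimate to the whole time interval (\<open>close_on_all\<close>).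

  Back on the probability space, the limit along one subsequence defines a measurable version of the
  forward integral. Since the value on a path does not depend on the subsequence, the
  approximations converge along a subsequence of every sequence, which gives convergence in
  probability. Right-continuity in time reduces the supremum over all times to one over countably
  many, so that the events involved are measurable.\<close>

section \<open>Cadlag paths\<close>

text \<open>Freezing a path outside \<open>{0..T}\<close>, as the Stieltjes measure does, makes it a path on the whole
  line, so that one-sided limits and measurability need no separate treatment of the endpoints.\<close>

definition clip :: "real \<Rightarrow> real \<Rightarrow> real" where
  "clip T s = max 0 (min T s)"

lemma clip_id [simp]: "0 \<le> s \<Longrightarrow> s \<le> T \<Longrightarrow> clip T s = s"
  by (simp add: clip_def)

lemma clip_mem [simp]: "0 \<le> T \<Longrightarrow> clip T s \<in> {0..T}"
  by (simp add: clip_def)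

lemma clip_bounds [simp]: "0 \<le> clip T s" "0 \<le> T \<Longrightarrow> clip T s \<le> T"
  by (simp_all add: clip_def)

lemma continuous_on_clip [continuous_intros]:
  "continuous_on A f \<Longrightarrow> continuous_on A (\<lambda>s. clip T (f s))"
  unfolding clip_def by (intro continuous_intros)

definition cadlag :: "(real \<Rightarrow> real) \<Rightarrow> bool" where
  "cadlag x \<longleftrightarrow> (\<forall>t. (x \<longlongrightarrow> x t) (at_right t) \<and> (\<exists>l. (x \<longlongrightarrow> l) (at_left t)))"

lemma cadlag_at_right: "cadlag x \<Longrightarrow> (x \<longlongrightarrow> x t) (at_right t)"
  by (simp add: cadlag_def)

lemma left_lim_eqI: "(f \<longlongrightarrow> l) (at_left s) \<Longrightarrow> left_lim f s = l"
  unfolding left_lim_def by (rule tendsto_Lim) (auto simp: trivial_limit_at_left_real)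

lemma cadlag_at_left: "cadlag x \<Longrightarrow> (x \<longlongrightarrow> left_lim x t) (at_left t)"
  using left_lim_eqI[of x _ t] by (auto simp: cadlag_def)

lemma left_lim_cong:
  assumes "\<And>r. a < r \<Longrightarrow> r < s \<Longrightarrow> f r = g r" and "a < s"
  shows "left_lim f s = left_lim g s"
proof -
  have "eventually (\<lambda>r. f r = g r) (at_left s)"
    using assms by (auto simp: eventually_at_left_field)
  then have "(f \<longlongrightarrow> l) (at_left s) = (g \<longlongrightarrow> l) (at_left s)" for l
    by (rule tendsto_cong)
  then show ?thesis
    unfolding left_lim_def Topological_Spaces.Lim_def by simp
qed

lemma cadlag_clip:
  assumes "cadlag_path T f" "0 < T"
  shows "cadlag (\<lambda>s. f (clip T s))"
  unfolding cadlag_def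
proof (intro allI conjI)
  fix t :: real
  show "((\<lambda>s. f (clip T s)) \<longlongrightarrow> f (clip T t)) (at_right t)"
  proof -
    consider "t < 0" | "0 \<le> t \<and> t < T" | "T \<le> t" by linarith
    then show ?thesis
    proof cases
      case 1
      have "eventually (\<lambda>s. f (clip T s) = f (clip T t)) (at_right t)"
        using 1 \<open>0 < T\<close> by (auto simp: eventually_at_right_field clip_def intro!: exI[of _ 0])
      then show ?thesis
        by (rule tendsto_eventually)
    next
      case 2
      have "eventually (\<lambda>s. f s = f (clip T s)) (at_right t)"
        using 2 by (auto simp: eventually_at_right_field intro!: exI[of _ T])
      moreover have "(f \<longlongrightarrow> f t) (at_right t)"
        using assms 2 by (auto simp: cadlag_path_def)
      ultimately show ?thesis
        using 2 by (simp add: tendsto_cong)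
    next
      case 3
      have "eventually (\<lambda>s. f (clip T s) = f (clip T t)) (at_right t)"
        using 3 \<open>0 < T\<close> by (auto simp: eventually_at_right_field clip_def intro!: exI[of _ "t + 1"])
      then show ?thesis
        by (rule tendsto_eventually)
    qed
  qed
  show "\<exists>l. ((\<lambda>s. f (clip T s)) \<longlongrightarrow> l) (at_left t)"
  proof -
    consider "t \<le> 0" | "0 < t \<and> t \<le> T" | "T < t" by linarith
    then show ?thesis
    proof cases
      case 1
      have "eventually (\<lambda>s. f (clip T s) = f 0) (at_left t)"
        using 1 \<open>0 < T\<close> by (auto simp: eventually_at_left_field clip_def intro!: exI[of _ "t - 1"])
      then show ?thesis
        by (blast intro: tendsto_eventually)
    next
      case 2
      have "eventually (\<lambda>s. f s = f (clip T s)) (at_left t)"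
        using 2 by (auto simp: eventually_at_left_field intro!: exI[of _ 0])
      moreover obtain l where "(f \<longlongrightarrow> l) (at_left t)"
        using assms 2 by (force simp: cadlag_path_def)
      ultimately show ?thesis
        by (blast intro: Lim_transform_eventually)
    next
      case 3
      have "eventually (\<lambda>s. f (clip T s) = f T) (at_left t)"
        using 3 \<open>0 < T\<close> by (auto simp: eventually_at_left_field clip_def intro!: exI[of _ T])
      then show ?thesis
        by (blast intro: tendsto_eventually)
    qed
  qed
qed

text \<open>Near each time the two one-sided limits bound the path, and bounds on adjacent intervals
  combine to one on their union.\<close>

lemma cadlag_bounded:
  assumes x: "cadlag x" and "a \<le> b"
  shows "\<exists>B. \<forall>s\<in>{a..b}. \<bar>x s\<bar> \<le> B"
  using \<open>a \<le> b\<close>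
proof (induction rule: Bolzano)
  case (trans a b c)
  then obtain B C where "\<forall>s\<in>{a..b}. \<bar>x s\<bar> \<le> B" "\<forall>s\<in>{b..c}. \<bar>x s\<bar> \<le> C" by blast
  then have "\<forall>s\<in>{a..c}. \<bar>x s\<bar> \<le> max B C"
    by (metis atLeastAtMost_iff le_max_iff_disj nle_le)
  then show ?case by blast
next
  case (local u)
  let ?l = "left_lim x u"
  have "eventually (\<lambda>s. \<bar>x s - ?l\<bar> < 1) (at_left u)"
    using tendstoD[OF cadlag_at_left[OF x, of u], of 1] by (simp add: dist_real_def)
  then obtain c where c: "c < u" "\<And>s. c < s \<Longrightarrow> s < u \<Longrightarrow> \<bar>x s - ?l\<bar> < 1"
    by (auto simp: eventually_at_left_field)
  have "eventually (\<lambda>s. \<bar>x s - x u\<bar> < 1) (at_right u)"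
    using tendstoD[OF cadlag_at_right[OF x, of u], of 1] by (simp add: dist_real_def)
  then obtain d where d: "u < d" "\<And>s. u < s \<Longrightarrow> s < d \<Longrightarrow> \<bar>x s - x u\<bar> < 1"
    by (auto simp: eventually_at_right_field)
  show ?case
  proof (rule exI[of _ "min (u - c) (d - u)"], intro conjI allI impI)
    show "0 < min (u - c) (d - u)" using c d by simp
  next
    fix a b assume ab: "a \<le> u \<and> u \<le> b \<and> b - a < min (u - c) (d - u)"
    have "\<bar>x s\<bar> \<le> \<bar>?l\<bar> + \<bar>x u\<bar> + 1" if "s \<in> {a..b}" for s
    proof -
      have "c < s" "s < d"
        using that ab by auto
      moreover have "s < u \<or> s = u \<or> u < s"
        by linarith
      ultimately show ?thesis
        using c(2)[of s] d(2)[of s] by (elim disjE) auto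
    qed
    then show "\<exists>B. \<forall>s\<in>{a..b}. \<bar>x s\<bar> \<le> B" by blast
  qed
qed

text \<open>The grid points approach each time strictly from the right, so that right-continuity
  transfers measurability from countably many time points to the whole path.\<close>

lemma grid_above:
  fixes s :: real
  shows "((\<lambda>n. (of_int \<lfloor>real (Suc n) * s\<rfloor> + 1) / real (Suc n)) \<longlongrightarrow> s) sequentially"
    and "s < (of_int \<lfloor>real (Suc n) * s\<rfloor> + 1) / real (Suc n)"
proof -
  have lower: "s < (of_int \<lfloor>real (Suc n) * s\<rfloor> + 1) / real (Suc n)" for n
  proof -
    have "real (Suc n) * s < of_int \<lfloor>real (Suc n) * s\<rfloor> + 1" by linarith
    then show ?thesis by (simp add: field_simps)
  qed
  then show "s < (of_int \<lfloor>real (Suc n) * s\<rfloor> + 1) / real (Suc n)" .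
  have upper: "(of_int \<lfloor>real (Suc n) * s\<rfloor> + 1) / real (Suc n) \<le> s + inverse (real (Suc n))" for n
  proof -
    have "of_int \<lfloor>real (Suc n) * s\<rfloor> + 1 \<le> real (Suc n) * s + 1" by linarith
    then have "(of_int \<lfloor>real (Suc n) * s\<rfloor> + 1) / real (Suc n)
        \<le> (real (Suc n) * s + 1) / real (Suc n)"
      by (intro divide_right_mono) auto
    also have "\<dots> = s + inverse (real (Suc n))" by (simp add: add_divide_distrib inverse_eq_divide del: of_nat_Suc)
    finally show ?thesis .
  qed
  show "((\<lambda>n. (of_int \<lfloor>real (Suc n) * s\<rfloor> + 1) / real (Suc n)) \<longlongrightarrow> s) sequentially"
  proof (rule tendsto_sandwich)
    show "\<forall>\<^sub>F n in sequentially. s \<le> (of_int \<lfloor>real (Suc n) * s\<rfloor> + 1) / real (Suc n)"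
      using lower by (auto intro!: always_eventually less_imp_le)
    show "\<forall>\<^sub>F n in sequentially.
        (of_int \<lfloor>real (Suc n) * s\<rfloor> + 1) / real (Suc n) \<le> s + inverse (real (Suc n))"
      using upper by (auto intro!: always_eventually)
    have "(\<lambda>n. s + inverse (real (Suc n))) \<longlonglongrightarrow> s + 0"
      by (intro tendsto_intros LIMSEQ_inverse_real_of_nat)
    then show "(\<lambda>n. s + inverse (real (Suc n))) \<longlonglongrightarrow> s" by simp
  qed auto
qed

lemma tendsto_at_right_compose:
  fixes f :: "real \<Rightarrow> real"
  assumes "(f \<longlongrightarrow> l) (at_right s)" "r \<longlonglongrightarrow> s" "\<And>n. s < r n"
  shows "(\<lambda>n. f (r n)) \<longlonglongrightarrow> l"
proof -
  have "filterlim r (at_right s) sequentially"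
    unfolding filterlim_at using assms(2,3) by (simp add: less_imp_neq[THEN not_sym])
  then show ?thesis
    using assms(1) by (rule filterlim_compose[rotated])
qed

lemma tendsto_at_left_compose:
  fixes f :: "real \<Rightarrow> real"
  assumes "(f \<longlongrightarrow> l) (at_left s)" "r \<longlonglongrightarrow> s" "\<And>n. r n < s"
  shows "(\<lambda>n. f (r n)) \<longlonglongrightarrow> l"
proof -
  have "filterlim r (at_left s) sequentially"
    unfolding filterlim_at using assms(2,3) by (simp add: less_imp_neq)
  then show ?thesis
    using assms(1) by (rule filterlim_compose[rotated])
qed

lemma jointly_measurable_cadlag:
  assumes meas: "\<And>t. X t \<in> borel_measurable M"
    and cad: "\<And>\<omega>. \<omega> \<in> space M \<Longrightarrow> cadlag (\<lambda>t. X t \<omega>)"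
  shows "(\<lambda>(\<omega>, s). X s \<omega>) \<in> borel_measurable (M \<Otimes>\<^sub>M borel)"
proof (rule borel_measurable_LIMSEQ_real)
  fix p assume p: "p \<in> space (M \<Otimes>\<^sub>M (borel :: real measure))"
  obtain \<omega> s where ps: "p = (\<omega>, s)" "\<omega> \<in> space M"
    using p by (cases p) (auto simp: space_pair_measure)
  have "(\<lambda>n. X ((of_int \<lfloor>real (Suc n) * s\<rfloor> + 1) / real (Suc n)) \<omega>) \<longlonglongrightarrow> X s \<omega>"
    by (rule tendsto_at_right_compose[where f = "\<lambda>t. X t \<omega>" and s = s,
        OF cadlag_at_right[OF cad[OF ps(2)]]])
      (fact grid_above)+
  then show "(\<lambda>n. X ((of_int \<lfloor>real (Suc n) * snd p\<rfloor> + 1) / real (Suc n)) (fst p))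
      \<longlonglongrightarrow> (case p of (\<omega>, s) \<Rightarrow> X s \<omega>)"
    by (simp add: ps)
next
  fix n
  note meas[measurable]
  have "(\<lambda>p. (\<lambda>k p. X ((of_int k + 1) / real (Suc n)) (fst p)) \<lfloor>real (Suc n) * snd p\<rfloor> p)
      \<in> borel_measurable (M \<Otimes>\<^sub>M borel)"
    by (rule measurable_compose_countable) measurable
  then show "(\<lambda>p. X ((of_int \<lfloor>real (Suc n) * snd p\<rfloor> + 1) / real (Suc n)) (fst p))
      \<in> borel_measurable (M \<Otimes>\<^sub>M borel)"
    by simp
qed

lemma cadlag_measurable:
  assumes "cadlag x"
  shows "x \<in> borel_measurable borel"
proof -
  have "(\<lambda>(\<omega> :: real, s). x s) \<in> borel_measurable (borel \<Otimes>\<^sub>M (borel :: real measure))"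
    by (rule jointly_measurable_cadlag[where X = "\<lambda>s (\<omega> :: real). x s" and M = borel]) (auto simp: assms)
  then have "(\<lambda>s. (\<lambda>(\<omega>, s). x s) (0 :: real, s)) \<in> borel_measurable borel"
    by (rule measurable_compose[rotated]) simp
  then show ?thesis by simp
qed

lemma left_lim_measurable:
  assumes "cadlag x"
  shows "left_lim x \<in> borel_measurable borel"
proof (rule borel_measurable_LIMSEQ_real)
  note cadlag_measurable[OF assms, measurable]
  show "(\<lambda>s. x (s - inverse (real (Suc n)))) \<in> borel_measurable borel" for n
    by measurable
  fix s
  have "(\<lambda>n. s - inverse (real (Suc n))) \<longlonglongrightarrow> s - 0"
    by (intro tendsto_intros LIMSEQ_inverse_real_of_nat)
  then show "(\<lambda>n. x (s - inverse (real (Suc n)))) \<longlonglongrightarrow> left_lim x s"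
    by (intro tendsto_at_left_compose[OF cadlag_at_left[OF assms]]) auto
qed

lemma left_lim_bounded:
  assumes "cadlag x" "\<And>s. a < s \<Longrightarrow> s < b \<Longrightarrow> \<bar>x s - c\<bar> \<le> B" "a < s" "s \<le> b"
  shows "\<bar>left_lim x s - c\<bar> \<le> B"
proof (rule tendsto_upperbound)
  show "((\<lambda>r. \<bar>x r - c\<bar>) \<longlongrightarrow> \<bar>left_lim x s - c\<bar>) (at_left s)"
    by (intro tendsto_intros cadlag_at_left assms)
  show "\<forall>\<^sub>F r in at_left s. \<bar>x r - c\<bar> \<le> B"
    using assms by (auto simp: eventually_at_left_field)
qed (auto simp: trivial_limit_at_left_real)

section \<open>Averages over increments of a path\<close>

lemma set_integrable_bounded_Ioc:
  fixes f :: "real \<Rightarrow> real"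
  assumes "f \<in> borel_measurable borel" "\<And>s. a < s \<Longrightarrow> s \<le> b \<Longrightarrow> \<bar>f s\<bar> \<le> C"
  shows "set_integrable lborel {a<..b} f"
  unfolding set_integrable_def
proof (rule integrableI_bounded_set_indicator[where B = C])
  show "emeasure lborel {a<..b} < \<infinity>"
    by (cases "a \<le> b") auto
qed (use assms in auto)

text \<open>All boundary effects of the regularisation live on a final window \<open>{b - \<epsilon>..b}\<close>, where increments are
  cut off at the end of the interval. As the window has length \<open>\<epsilon>\<close>, an error \<open>\<kappa>\<close> on it contributes
  at most \<open>\<kappa>\<close> after division by \<open>\<epsilon>\<close>.\<close>

lemma set_integral_tail_bound:
  fixes f h :: "real \<Rightarrow> real"
  assumes "0 < \<epsilon>" "0 \<le> \<kappa>"
    and f: "set_integrable lborel {a<..b} f" and h: "set_integrable lborel {a<..b} h"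
    and bound: "\<And>s. a < s \<Longrightarrow> s < b \<Longrightarrow> \<bar>f s\<bar> \<le> h s + (if b - \<epsilon> \<le> s then \<kappa> else 0)"
  shows "\<bar>LINT s:{a<..b}|lborel. f s / \<epsilon>\<bar> \<le> (LINT s:{a<..b}|lborel. h s / \<epsilon>) + \<kappa>"
proof -
  let ?A = "{a<..b}" and ?k = "\<lambda>s. indicator {b - \<epsilon>..b} s * \<kappa> :: real"
  have k: "set_integrable lborel ?A ?k"
    using \<open>0 \<le> \<kappa>\<close> by (intro set_integrable_bounded_Ioc[where C = \<kappa>]) (auto split: split_indicator)
  have "(LINT s:?A|lborel. ?k s) = (LINT s|lborel. indicator (?A \<inter> {b - \<epsilon>..b}) s * \<kappa>)"
    unfolding set_lebesgue_integral_def
    by (intro Bochner_Integration.integral_cong) (auto split: split_indicator)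
  also have "\<dots> = measure lborel (?A \<inter> {b - \<epsilon>..b}) * \<kappa>"
    by simp
  also have "\<dots> \<le> measure lborel {b - \<epsilon>..b} * \<kappa>"
    using \<open>0 \<le> \<kappa>\<close> \<open>0 < \<epsilon>\<close> by (intro mult_right_mono measure_mono_fmeasurable)
      (auto simp: fmeasurable_def)
  finally have k_le: "(LINT s:?A|lborel. ?k s) \<le> \<epsilon> * \<kappa>"
    using \<open>0 < \<epsilon>\<close> by simp
  have "\<bar>LINT s:?A|lborel. f s\<bar> \<le> (LINT s:?A|lborel. \<bar>f s\<bar>)"
    using integral_norm_bound[of lborel "\<lambda>s. indicator ?A s *\<^sub>R f s"]
    by (simp add: set_lebesgue_integral_def abs_mult)
  also have "\<dots> \<le> (LINT s:?A|lborel. h s + ?k s)"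
  proof (rule set_integral_mono_AE)
    show "AE s\<in>?A in lborel. \<bar>f s\<bar> \<le> h s + ?k s"
      using AE_lborel_singleton[of b]
    proof eventually_elim
      case (elim s)
      then show ?case
        using bound[of s] by (auto split: split_indicator if_splits)
    qed
  qed (use f h k in \<open>auto intro: set_integrable_abs\<close>)
  also have "\<dots> = (LINT s:?A|lborel. h s) + (LINT s:?A|lborel. ?k s)"
    using h k by (rule set_integral_add)
  finally have "\<bar>LINT s:?A|lborel. f s\<bar> \<le> (LINT s:?A|lborel. h s) + \<epsilon> * \<kappa>"
    using k_le by linarith
  then have "\<bar>LINT s:?A|lborel. f s\<bar> / \<epsilon> \<le> ((LINT s:?A|lborel. h s) + \<epsilon> * \<kappa>) / \<epsilon>"
    using \<open>0 < \<epsilon>\<close> by (intro divide_right_mono) auto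
  then show ?thesis
    using \<open>0 < \<epsilon>\<close> by (simp add: add_divide_distrib)
qed

text \<open>If the integrand is nearly a constant \<open>J\<close> on the final window, the window contributes \<open>J\<close>. This is
  how a jump at \<open>b\<close> appears: all increments that start in the window end beyond the jump.\<close>

lemma set_integral_tail_limit_bound:
  fixes f h :: "real \<Rightarrow> real"
  assumes "0 < \<epsilon>" "0 \<le> \<kappa>"
    and f: "set_integrable lborel {a<..b} f" and h: "set_integrable lborel {a<..b} h"
    and J: "J \<noteq> 0 \<Longrightarrow> \<epsilon> \<le> b - a"
    and bound: "\<And>s. a < s \<Longrightarrow> s < b \<Longrightarrow>
      \<bar>f s - (if b - \<epsilon> \<le> s then J else 0)\<bar> \<le> h s + (if b - \<epsilon> \<le> s then \<kappa> else 0)"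
  shows "\<bar>(LINT s:{a<..b}|lborel. f s / \<epsilon>) - J\<bar> \<le> (LINT s:{a<..b}|lborel. h s / \<epsilon>) + \<kappa>"
proof -
  let ?A = "{a<..b}" and ?k = "\<lambda>s. if b - \<epsilon> \<le> s then J else 0"
  have k: "set_integrable lborel ?A ?k"
    by (intro set_integrable_bounded_Ioc[where C = "\<bar>J\<bar>"]) auto
  have "(LINT s:?A|lborel. ?k s) = (LINT s|lborel. indicator (?A \<inter> {b - \<epsilon>..b}) s * J)"
    unfolding set_lebesgue_integral_def
    by (intro Bochner_Integration.integral_cong) (auto split: split_indicator)
  also have "\<dots> = measure lborel (?A \<inter> {b - \<epsilon>..b}) * J"
    by simp
  also have "\<dots> = \<epsilon> * J"
  proof (cases "J = 0")
    case False
    then consider "\<epsilon> < b - a" | "\<epsilon> = b - a" using J by linarith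
    then show ?thesis
    proof cases
      case 1
      then have "?A \<inter> {b - \<epsilon>..b} = {b - \<epsilon>..b}" by auto
      then show ?thesis using \<open>0 < \<epsilon>\<close> by simp
    next
      case 2
      then have "?A \<inter> {b - \<epsilon>..b} = {a<..b}" by auto
      then show ?thesis using \<open>0 < \<epsilon>\<close> 2 by simp
    qed
  qed simp
  finally have "(LINT s:?A|lborel. ?k s / \<epsilon>) = J"
    using \<open>0 < \<epsilon>\<close> by (simp del: if_split)
  moreover have "(LINT s:?A|lborel. (f s - ?k s) / \<epsilon>)
      = (LINT s:?A|lborel. f s / \<epsilon>) - (LINT s:?A|lborel. ?k s / \<epsilon>)"
    using set_integral_diff(2)[OF set_integrable_divide[OF f, of \<epsilon>] set_integrable_divide[OF k, of \<epsilon>]]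
    by (simp only: diff_divide_distrib)
  moreover have "\<bar>LINT s:?A|lborel. (f s - ?k s) / \<epsilon>\<bar> \<le> (LINT s:?A|lborel. h s / \<epsilon>) + \<kappa>"
    by (rule set_integral_tail_bound[OF assms(1,2) set_integral_diff(1)[OF f k] h bound])
  ultimately show ?thesis by simp
qed

text \<open>The integrands below are functions of a time and of the values of the path before and after an
  increment.\<close>

definition continuous3 :: "real \<Rightarrow> (real \<Rightarrow> real \<Rightarrow> real \<Rightarrow> real) \<Rightarrow> bool" where
  "continuous3 T G \<longleftrightarrow> continuous_on ({0..T} \<times> UNIV \<times> UNIV) (\<lambda>(s, p, r). G s p r)"

lemma continuous3_bounded:
  assumes "continuous3 T G"
  shows "\<exists>C. \<forall>s\<in>{0..T}. \<forall>p\<in>{- B..B}. \<forall>r\<in>{- B..B}. \<bar>G s p r\<bar> \<le> C"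
proof -
  have "compact ((\<lambda>(s, p, r). G s p r) ` ({0..T} \<times> {- B..B} \<times> {- B..B}))"
    using assms unfolding continuous3_def
    by (intro compact_continuous_image compact_Times compact_Icc)
       (auto elim: continuous_on_subset)
  then have "bounded ((\<lambda>(s, p, r). G s p r) ` ({0..T} \<times> {- B..B} \<times> {- B..B}))"
    by (rule compact_imp_bounded)
  then obtain C where "\<forall>v \<in> (\<lambda>(s, p, r). G s p r) ` ({0..T} \<times> {- B..B} \<times> {- B..B}). \<bar>v\<bar> \<le> C"
    by (auto simp: bounded_iff)
  then show ?thesis
    by (intro exI[of _ C]) fastforce
qed

lemma continuous3_measurable:
  assumes "continuous3 T G" "0 \<le> T"
    and [measurable]: "f \<in> borel_measurable M" "y \<in> borel_measurable M" "z \<in> borel_measurable M"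
  shows "(\<lambda>s. G (clip T (f s)) (y s) (z s)) \<in> borel_measurable M"
proof -
  have "continuous_on UNIV (\<lambda>w. (\<lambda>(s, p, r). G s p r) (clip T (fst w), snd w))"
    using assms(1) unfolding continuous3_def
    by (rule continuous_on_compose2) (use \<open>0 \<le> T\<close> in \<open>auto intro!: continuous_intros\<close>)
  then have m: "(\<lambda>w. (\<lambda>(s, p, r). G s p r) (clip T (fst w), snd w)) \<in> borel_measurable borel"
    by (rule borel_measurable_continuous_onI)
  have p: "(\<lambda>s. (f s, y s, z s)) \<in> borel_measurable M"
    by measurable
  show ?thesis
    using measurable_compose[OF p m] by simp
qed

lemma continuous3_tendsto:
  assumes "continuous3 T G" "s \<in> {0..T}" "(y \<longlongrightarrow> p) Fl" "(z \<longlongrightarrow> r) Fl"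
  shows "((\<lambda>n. G s (y n) (z n)) \<longlongrightarrow> G s p r) Fl"
proof -
  have "continuous_on UNIV (\<lambda>w. (\<lambda>(s, p, r). G s p r) (s, w))"
    using assms(1) unfolding continuous3_def
    by (rule continuous_on_compose2) (use \<open>s \<in> {0..T}\<close> in \<open>auto intro!: continuous_intros\<close>)
  then have "isCont (\<lambda>w. (\<lambda>(s, p, r). G s p r) (s, w)) (p, r)"
    by (simp add: continuous_on_eq_continuous_at)
  then have "((\<lambda>n. (\<lambda>w. (\<lambda>(s, p, r). G s p r) (s, w)) (y n, z n)) \<longlongrightarrow>
      (\<lambda>(s, p, r). G s p r) (s, p, r)) Fl"
    by (rule isCont_tendsto_compose) (intro tendsto_intros assms)
  then show ?thesis by simp
qed

lemma set_integrable_continuous3: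
  assumes "continuous3 T G" "0 < T" "0 \<le> a" "b \<le> T"
    and "y \<in> borel_measurable borel" "z \<in> borel_measurable borel"
    and "\<And>s. a < s \<Longrightarrow> s \<le> b \<Longrightarrow> \<bar>y s\<bar> \<le> B" "\<And>s. a < s \<Longrightarrow> s \<le> b \<Longrightarrow> \<bar>z s\<bar> \<le> B"
  shows "set_integrable lborel {a<..b} (\<lambda>s. G s (y s) (z s))"
proof -
  obtain C where C: "\<And>s p r. s \<in> {0..T} \<Longrightarrow> p \<in> {- B..B} \<Longrightarrow> r \<in> {- B..B} \<Longrightarrow> \<bar>G s p r\<bar> \<le> C"
    using continuous3_bounded[OF assms(1)] by blast
  have "set_integrable lborel {a<..b} (\<lambda>s. G (clip T s) (y s) (z s))"
  proof (rule set_integrable_bounded_Ioc)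
    show "(\<lambda>s. G (clip T s) (y s) (z s)) \<in> borel_measurable borel"
      using assms(2,5,6) by (intro continuous3_measurable[OF assms(1)]) auto
    show "\<bar>G (clip T s) (y s) (z s)\<bar> \<le> C" if "a < s" "s \<le> b" for s
      using assms(7,8)[OF that] \<open>0 < T\<close> by (intro C clip_mem) auto
  qed
  moreover have "set_integrable lborel {a<..b} (\<lambda>s. G (clip T s) (y s) (z s))
      = set_integrable lborel {a<..b} (\<lambda>s. G s (y s) (z s))"
    using assms(3,4) by (intro set_integrable_cong) auto
  ultimately show ?thesis by blast
qed

text \<open>The covariation, the forward integral and the Taylor remainder are all limits of such averages. The
  bounds \<open>a\<close> and \<open>b\<close> restrict the time at which an increment starts, whereas the increment itself is
  cut off at \<open>t\<close> only; so averages over adjacent intervals add up.\<close>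

definition incr_avg ::
  "real \<Rightarrow> (real \<Rightarrow> real) \<Rightarrow> (real \<Rightarrow> real \<Rightarrow> real \<Rightarrow> real) \<Rightarrow> real \<Rightarrow> real \<Rightarrow> real \<Rightarrow> real" where
  "incr_avg \<epsilon> x G a b t =
     (LINT s:{a<..min b t}|lborel. G s (x s) (x (min (s + \<epsilon>) t)) / \<epsilon>)"

locale bounded_cadlag =
  fixes T :: real and x :: "real \<Rightarrow> real" and B :: real
  assumes T_pos: "0 < T" and cadlag: "cadlag x"
    and bounded: "\<And>s. 0 \<le> s \<Longrightarrow> s \<le> T \<Longrightarrow> \<bar>x s\<bar> \<le> B"
begin

lemma x_measurable [measurable]: "x \<in> borel_measurable borel"
  by (rule cadlag_measurable[OF cadlag])

lemma left_lim_x_measurable [measurable]: "left_lim x \<in> borel_measurable borel"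
  by (rule left_lim_measurable[OF cadlag])

lemma left_lim_x_bounded: "0 < s \<Longrightarrow> s \<le> T \<Longrightarrow> \<bar>left_lim x s\<bar> \<le> B"
  using left_lim_bounded[OF cadlag, of 0 T 0 B s] bounded by auto

lemma incr_integrable:
  assumes "continuous3 T G" "0 \<le> \<epsilon>" "0 \<le> a" "b \<le> t" "t \<le> T"
  shows "set_integrable lborel {a<..b} (\<lambda>s. G s (x s) (x (min (s + \<epsilon>) t)))"
proof (rule set_integrable_continuous3[OF assms(1) T_pos, where B = B])
  show "(\<lambda>s. x (min (s + \<epsilon>) t)) \<in> borel_measurable borel"
    by measurable
  show "\<bar>x s\<bar> \<le> B" "\<bar>x (min (s + \<epsilon>) t)\<bar> \<le> B" if "a < s" "s \<le> b" for s
    using that assms by (auto intro!: bounded)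
qed (use assms in auto)

text \<open>As \<open>t\<close> decreases to \<open>u\<close>, an increment that would pass \<open>u\<close> is cut off at \<open>t\<close>, and its end value tends
  to \<open>x u\<close> by right-continuity. Dominated convergence does the rest.\<close>

lemma incr_avg_at_right:
  assumes G: "continuous3 T G" and "0 < \<epsilon>" "0 \<le> u" "u < T"
  shows "((\<lambda>t. incr_avg \<epsilon> x G 0 T t) \<longlongrightarrow> incr_avg \<epsilon> x G 0 T u) (at_right u)"
proof (rule tendsto_at_right_sequentially[OF \<open>u < T\<close>])
  fix S :: "nat \<Rightarrow> real"
  assume S: "\<And>n. u < S n" "\<And>n. S n < T" "S \<longlonglongrightarrow> u"
  obtain C where C: "\<And>s p r. s \<in> {0..T} \<Longrightarrow> p \<in> {- B..B} \<Longrightarrow> r \<in> {- B..B} \<Longrightarrow> \<bar>G s p r\<bar> \<le> C"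
    using continuous3_bounded[OF G] by blast
  show "(\<lambda>n. incr_avg \<epsilon> x G 0 T (S n)) \<longlonglongrightarrow> incr_avg \<epsilon> x G 0 T u"
    unfolding incr_avg_def set_lebesgue_integral_def
  proof (rule integral_dominated_convergence[where w = "\<lambda>s. indicator {0<..T} s * (C / \<epsilon>)"])
    show "(\<lambda>s. indicator {0<..min T u} s *\<^sub>R (G s (x s) (x (min (s + \<epsilon>) u)) / \<epsilon>))
        \<in> borel_measurable lborel"
      using set_integrable_divide[OF incr_integrable[OF G, where \<epsilon> = \<epsilon> and a = 0 and b = u and t = u]] assms
      by (auto simp: set_integrable_def min_absorb2 dest: borel_measurable_integrable)
    show "(\<lambda>s. indicator {0<..min T (S n)} s *\<^sub>R (G s (x s) (x (min (s + \<epsilon>) (S n))) / \<epsilon>))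
        \<in> borel_measurable lborel" for n
      using set_integrable_divide[OF incr_integrable[OF G, where \<epsilon> = \<epsilon> and a = 0 and b = "S n" and t = "S n"]] assms S(1,2)[of n]
      by (auto simp: set_integrable_def min_absorb2 dest: borel_measurable_integrable)
    show "integrable lborel (\<lambda>s. indicator {0<..T} s * (C / \<epsilon>))"
      using set_integrable_bounded_Ioc[of "\<lambda>_. C / \<epsilon>" 0 T "\<bar>C / \<epsilon>\<bar>"] by (simp add: set_integrable_def)
    show "AE s in lborel. norm (indicator {0<..min T (S n)} s *\<^sub>R
        (G s (x s) (x (min (s + \<epsilon>) (S n))) / \<epsilon>)) \<le> indicator {0<..T} s * (C / \<epsilon>)" for n
    proof (intro AE_I2)
      fix s
      have "\<bar>G s (x s) (x (min (s + \<epsilon>) (S n)))\<bar> \<le> C" if "0 < s" "s \<le> S n"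
      proof -
        have "\<bar>x s\<bar> \<le> B" "\<bar>x (min (s + \<epsilon>) (S n))\<bar> \<le> B"
          using that S(1,2)[of n] assms by (auto intro!: bounded)
        then show ?thesis
          using that S(1,2)[of n] assms by (intro C) auto
      qed
      moreover have "0 \<le> C" using order_trans[OF abs_ge_zero C[of 0 "x 0" "x 0"]] T_pos bounded[of 0] by (force simp: abs_le_iff)
      ultimately show "norm (indicator {0<..min T (S n)} s *\<^sub>R
        (G s (x s) (x (min (s + \<epsilon>) (S n))) / \<epsilon>)) \<le> indicator {0<..T} s * (C / \<epsilon>)"
        using S(1,2)[of n] \<open>0 < \<epsilon>\<close> by (auto split: split_indicator simp: divide_right_mono)
    qed
    show "AE s in lborel.
      (\<lambda>n. indicator {0<..min T (S n)} s *\<^sub>R (G s (x s) (x (min (s + \<epsilon>) (S n))) / \<epsilon>)) \<longlonglongrightarrow>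
      indicator {0<..min T u} s *\<^sub>R (G s (x s) (x (min (s + \<epsilon>) u)) / \<epsilon>)"
    proof (intro AE_I2)
      fix s :: real
      consider "s \<le> 0" | "u < s" | "0 < s" "s \<le> u" by linarith
      then show "(\<lambda>n. indicator {0<..min T (S n)} s *\<^sub>R (G s (x s) (x (min (s + \<epsilon>) (S n))) / \<epsilon>))
          \<longlonglongrightarrow> indicator {0<..min T u} s *\<^sub>R (G s (x s) (x (min (s + \<epsilon>) u)) / \<epsilon>)"
      proof cases
        case 1
        then show ?thesis by (simp add: indicator_def)
      next
        case 2
        have "\<forall>\<^sub>F n in sequentially. S n < s"
          using order_tendstoD(2)[OF S(3) 2] .
        then have "\<forall>\<^sub>F n in sequentially.
            indicator {0<..min T (S n)} s *\<^sub>R (G s (x s) (x (min (s + \<epsilon>) (S n))) / \<epsilon>) = 0"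
          by eventually_elim auto
        then show ?thesis
          using 2 by (simp add: tendsto_eventually)
      next
        case 3
        have "(\<lambda>n. x (min (s + \<epsilon>) (S n))) \<longlonglongrightarrow> x (min (s + \<epsilon>) u)"
        proof (cases "s + \<epsilon> \<le> u")
          case True
          then have "min (s + \<epsilon>) (S n) = min (s + \<epsilon>) u" for n
            using S(1)[of n] by auto
          then show ?thesis by simp
        next
          case False
          have "\<forall>\<^sub>F n in sequentially. S n < s + \<epsilon>"
            using order_tendstoD(2)[OF S(3)] False by auto
          then have "\<forall>\<^sub>F n in sequentially. x (S n) = x (min (s + \<epsilon>) (S n))"
            by eventually_elim auto
          moreover have "(\<lambda>n. x (S n)) \<longlonglongrightarrow> x u"
            by (rule tendsto_at_right_compose[OF cadlag_at_right[OF cadlag] S(3,1)])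
          ultimately show ?thesis
            using False by (auto intro: Lim_transform_eventually)
        qed
        then have "(\<lambda>n. G s (x s) (x (min (s + \<epsilon>) (S n))) / \<epsilon>) \<longlonglongrightarrow> G s (x s) (x (min (s + \<epsilon>) u)) / \<epsilon>"
          using 3 assms by (intro tendsto_intros continuous3_tendsto[OF G]) auto
        moreover have "s \<le> S n" "s \<le> T" "S n \<le> T" for n
          using 3 S(1,2)[of n] by auto
        ultimately show ?thesis
          using 3 assms by (simp add: indicator_def)
      qed
    qed
  qed
qed

text \<open>As \<open>t\<close> increases to \<open>u\<close>, an increment that would reach \<open>u\<close> is cut off just before \<open>u\<close>, and its end
  value tends to the left limit instead of \<open>x u\<close>.\<close>

lemma incr_avg_at_left:
  assumes G: "continuous3 T G" and "0 < \<epsilon>" "0 < u" "u \<le> T"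
  shows "((\<lambda>t. incr_avg \<epsilon> x G 0 T t) \<longlongrightarrow>
    (LINT s:{0<..u}|lborel. G s (x s) (if s + \<epsilon> < u then x (s + \<epsilon>) else left_lim x u) / \<epsilon>)) (at_left u)"
proof (rule tendsto_at_left_sequentially[OF \<open>0 < u\<close>])
  fix S :: "nat \<Rightarrow> real"
  assume S: "\<And>n. S n < u" "\<And>n. 0 < S n" "S \<longlonglongrightarrow> u"
  obtain C where C: "\<And>s p r. s \<in> {0..T} \<Longrightarrow> p \<in> {- B..B} \<Longrightarrow> r \<in> {- B..B} \<Longrightarrow> \<bar>G s p r\<bar> \<le> C"
    using continuous3_bounded[OF G] by blast
  let ?z = "\<lambda>s. if s + \<epsilon> < u then x (s + \<epsilon>) else left_lim x u"
  show "(\<lambda>n. incr_avg \<epsilon> x G 0 T (S n)) \<longlonglongrightarrow> (LINT s:{0<..u}|lborel. G s (x s) (?z s) / \<epsilon>)"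
    unfolding incr_avg_def set_lebesgue_integral_def
  proof (rule integral_dominated_convergence[where w = "\<lambda>s. indicator {0<..T} s * (C / \<epsilon>)"])
    have "set_integrable lborel {0<..u} (\<lambda>s. G s (x s) (?z s))"
    proof (rule set_integrable_continuous3[OF assms(1) T_pos, where B = B])
      show "?z \<in> borel_measurable borel"
        by measurable
      show "\<bar>x s\<bar> \<le> B" "\<bar>?z s\<bar> \<le> B" if "0 < s" "s \<le> u" for s
        using that assms by (auto intro!: bounded left_lim_x_bounded)
    qed (use assms in auto)
    then show "(\<lambda>s. indicator {0<..u} s *\<^sub>R (G s (x s) (?z s) / \<epsilon>)) \<in> borel_measurable lborel"
      using set_integrable_divide[of \<epsilon> lborel "{0<..u}" "\<lambda>s. G s (x s) (?z s)"]
      unfolding set_integrable_def by (blast intro: borel_measurable_integrable)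
    show "(\<lambda>s. indicator {0<..min T (S n)} s *\<^sub>R (G s (x s) (x (min (s + \<epsilon>) (S n))) / \<epsilon>))
        \<in> borel_measurable lborel" for n
      using set_integrable_divide[OF incr_integrable[OF G, where \<epsilon> = \<epsilon> and a = 0 and b = "S n" and t = "S n"]] assms S(1,2)[of n]
      by (auto simp: set_integrable_def min_absorb2 dest: borel_measurable_integrable)
    show "integrable lborel (\<lambda>s. indicator {0<..T} s * (C / \<epsilon>))"
      using set_integrable_bounded_Ioc[of "\<lambda>_. C / \<epsilon>" 0 T "\<bar>C / \<epsilon>\<bar>"] by (simp add: set_integrable_def)
    show "AE s in lborel. norm (indicator {0<..min T (S n)} s *\<^sub>R
        (G s (x s) (x (min (s + \<epsilon>) (S n))) / \<epsilon>)) \<le> indicator {0<..T} s * (C / \<epsilon>)" for n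
    proof (intro AE_I2)
      fix s
      have "\<bar>G s (x s) (x (min (s + \<epsilon>) (S n)))\<bar> \<le> C" if "0 < s" "s \<le> S n"
      proof -
        have "\<bar>x s\<bar> \<le> B" "\<bar>x (min (s + \<epsilon>) (S n))\<bar> \<le> B"
          using that S(1,2)[of n] assms by (auto intro!: bounded)
        then show ?thesis
          using that S(1,2)[of n] assms by (intro C) auto
      qed
      moreover have "0 \<le> C" using order_trans[OF abs_ge_zero C[of 0 "x 0" "x 0"]] T_pos bounded[of 0] by (force simp: abs_le_iff)
      ultimately show "norm (indicator {0<..min T (S n)} s *\<^sub>R
        (G s (x s) (x (min (s + \<epsilon>) (S n))) / \<epsilon>)) \<le> indicator {0<..T} s * (C / \<epsilon>)"
        using S(1,2)[of n] \<open>0 < \<epsilon>\<close> by (auto split: split_indicator simp: divide_right_mono)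
    qed
    show "AE s in lborel.
      (\<lambda>n. indicator {0<..min T (S n)} s *\<^sub>R (G s (x s) (x (min (s + \<epsilon>) (S n))) / \<epsilon>)) \<longlonglongrightarrow>
      indicator {0<..u} s *\<^sub>R (G s (x s) (?z s) / \<epsilon>)"
      using AE_lborel_singleton[of u]
    proof eventually_elim
      case (elim s)
      then consider "s \<le> 0" | "u < s" | "0 < s" "s < u" by linarith
      then show ?case
      proof cases
        case 1
        then show ?thesis by (simp add: indicator_def)
      next
        case 2
        then have "\<not> s \<le> S n" for n using S(1)[of n] by auto
        then show ?thesis using 2 by (simp add: indicator_def)
      next
        case 3
        have "(\<lambda>n. x (min (s + \<epsilon>) (S n))) \<longlonglongrightarrow> ?z s"
        proof (cases "s + \<epsilon> < u")
          case True
          have "\<forall>\<^sub>F n in sequentially. s + \<epsilon> < S n"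
            using order_tendstoD(1)[OF S(3)] True by auto
          then have "\<forall>\<^sub>F n in sequentially. x (min (s + \<epsilon>) (S n)) = x (s + \<epsilon>)"
            by eventually_elim auto
          then show ?thesis using True by (simp add: tendsto_eventually)
        next
          case False
          then have "min (s + \<epsilon>) (S n) = S n" for n
            using S(1)[of n] by auto
          moreover have "(\<lambda>n. x (S n)) \<longlonglongrightarrow> left_lim x u"
            by (rule tendsto_at_left_compose[OF cadlag_at_left[OF cadlag] S(3,1)])
          ultimately show ?thesis
            using False by simp
        qed
        then have lim: "(\<lambda>n. G s (x s) (x (min (s + \<epsilon>) (S n))) / \<epsilon>) \<longlonglongrightarrow> G s (x s) (?z s) / \<epsilon>"
          using 3 assms by (intro tendsto_intros continuous3_tendsto[OF G]) auto
        have "\<forall>\<^sub>F n in sequentially. s < S n"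
          using order_tendstoD(1)[OF S(3)] 3 by auto
        then have "\<forall>\<^sub>F n in sequentially. G s (x s) (x (min (s + \<epsilon>) (S n))) / \<epsilon> =
           indicator {0<..min T (S n)} s *\<^sub>R (G s (x s) (x (min (s + \<epsilon>) (S n))) / \<epsilon>)"
          by eventually_elim (use 3 assms in auto)
        then show ?thesis
          using 3 Lim_transform_eventually[OF lim] by simp
      qed
    qed
  qed
qed

lemma incr_avg_integrable:
  assumes "continuous3 T G" "0 < \<epsilon>" "0 \<le> a" "t \<le> T"
  shows "set_integrable lborel {a<..min b t} (\<lambda>s. G s (x s) (x (min (s + \<epsilon>) t)) / \<epsilon>)"
  using assms by (intro set_integrable_divide incr_integrable) auto

lemma incr_avg_split:
  assumes "continuous3 T G" "0 < \<epsilon>" "0 \<le> a" "a \<le> b" "b \<le> c" "t \<le> T"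
  shows "incr_avg \<epsilon> x G a c t = incr_avg \<epsilon> x G a b t + incr_avg \<epsilon> x G b c t"
proof -
  have un: "{a<..min c t} = {a<..min b t} \<union> {b<..min c t}"
    and disjoint: "{a<..min b t} \<inter> {b<..min c t} = {}"
    using assms by auto
  show ?thesis
    unfolding incr_avg_def un
    by (rule set_integral_Un[OF disjoint]; rule incr_avg_integrable) (use assms in auto)
qed

end

section \<open>Paths with quadratic variation\<close>

abbreviation sq :: "real \<Rightarrow> real \<Rightarrow> real \<Rightarrow> real" where
  "sq s p r \<equiv> (r - p)\<^sup>2"

lemma continuous3_sq: "continuous3 T sq"
  unfolding continuous3_def case_prod_beta by (intro continuous_intros)

text \<open>One path, and one sequence of parameters along which its regularised quadratic variations
  converge uniformly.\<close>

locale quadratic_variation_path = bounded_cadlag +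
  fixes e :: "nat \<Rightarrow> real" and q :: "real \<Rightarrow> real"
  assumes e_pos: "\<And>n. 0 < e n" and e_lim: "e \<longlonglongrightarrow> 0"
    and conv: "uniform_limit {0..T} (\<lambda>n t. incr_avg (e n) x sq 0 T t) q sequentially"
begin

lemma eventually_e_less: "0 < d \<Longrightarrow> \<forall>\<^sub>F n in sequentially. e n < d"
  using order_tendstoD(2)[OF e_lim] .

lemma near_right:
  assumes "0 < \<kappa>"
  obtains d where "0 < d" "\<And>s. u \<le> s \<Longrightarrow> s < u + d \<Longrightarrow> \<bar>x s - x u\<bar> < \<kappa>"
proof -
  have "eventually (\<lambda>s. \<bar>x s - x u\<bar> < \<kappa>) (at_right u)"
    using tendstoD[OF cadlag_at_right[OF cadlag, of u] assms] by (simp add: dist_real_def)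
  then obtain c where c: "u < c" "\<And>s. u < s \<Longrightarrow> s < c \<Longrightarrow> \<bar>x s - x u\<bar> < \<kappa>"
    by (auto simp: eventually_at_right_field)
  have "\<bar>x s - x u\<bar> < \<kappa>" if "u \<le> s" "s < u + (c - u)" for s
    using that c(2)[of s] assms by (cases "s = u") auto
  then show ?thesis
    using that[of "c - u"] c(1) by simp
qed

lemma near_left:
  assumes "0 < \<kappa>"
  obtains d where "0 < d" "\<And>s. u - d < s \<Longrightarrow> s < u \<Longrightarrow> \<bar>x s - left_lim x u\<bar> < \<kappa>"
proof -
  have "eventually (\<lambda>s. \<bar>x s - left_lim x u\<bar> < \<kappa>) (at_left u)"
    using tendstoD[OF cadlag_at_left[OF cadlag, of u] assms] by (simp add: dist_real_def)
  then obtain c where "c < u" "\<And>s. c < s \<Longrightarrow> s < u \<Longrightarrow> \<bar>x s - left_lim x u\<bar> < \<kappa>"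
    by (auto simp: eventually_at_left_field)
  then show ?thesis
    using that[of "u - c"] by simp
qed

text \<open>Restricting the start of the increments to times up to \<open>u\<close> has the same limit as cutting the
  increments off at \<open>u\<close>: only increments across \<open>u\<close> differ, and what they gain after \<open>u\<close> is small by
  right-continuity.\<close>

lemma avg_sq_until:
  assumes u: "0 \<le> u" "u \<le> T"
  shows "uniform_limit {0..T} (\<lambda>n t. incr_avg (e n) x sq 0 u t) (\<lambda>t. q (min u t)) sequentially"
proof (rule uniform_limitI)
  fix \<kappa> :: real assume "0 < \<kappa>"
  have B: "0 \<le> B" using bounded[of 0] T_pos by auto
  \<comment> \<open>The difference of two squares is the product of \<open>x r - x u\<close> with a factor bounded by \<open>4 * B\<close>;
    B + 1 keeps the denominator positive.\<close>
  define \<kappa>' where "\<kappa>' = \<kappa> / (8 * (B + 1))"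
  have \<kappa>': "0 < \<kappa>'" "\<kappa>' * (4 * B) \<le> \<kappa> / 2"
    using \<open>0 < \<kappa>\<close> B by (auto simp: \<kappa>'_def field_simps)
  obtain d where d: "0 < d" "\<And>s. u \<le> s \<Longrightarrow> s < u + d \<Longrightarrow> \<bar>x s - x u\<bar> < \<kappa>'"
    using near_right[OF \<kappa>'(1)] by blast
  have "0 < \<kappa> / 2" using \<open>0 < \<kappa>\<close> by simp
  from uniform_limitD[OF conv this] eventually_e_less[OF d(1)]
  show "\<forall>\<^sub>F n in sequentially. \<forall>t\<in>{0..T}. dist (incr_avg (e n) x sq 0 u t) (q (min u t)) < \<kappa>"
  proof eventually_elim
    case (elim n)
    show ?case
    proof
      fix t assume t: "t \<in> {0..T}"
      show "dist (incr_avg (e n) x sq 0 u t) (q (min u t)) < \<kappa>"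
      proof (cases "t \<le> u")
        case True
        then have "incr_avg (e n) x sq 0 u t = incr_avg (e n) x sq 0 T t"
          using t u by (simp add: incr_avg_def)
        then show ?thesis
          using elim(1) t True \<open>0 < \<kappa>\<close> by (fastforce simp: min_absorb2)
      next
        case False
        let ?f = "\<lambda>s. sq s (x s) (x (min (s + e n) t)) - sq s (x s) (x (min (s + e n) u))"
        have int: "set_integrable lborel {0<..u} (\<lambda>s. sq s (x s) (x (min (s + e n) t)))"
          "set_integrable lborel {0<..u} (\<lambda>s. sq s (x s) (x (min (s + e n) u)))"
          using t u False e_pos[of n] by (auto intro!: incr_integrable[OF continuous3_sq])
        have "\<bar>(LINT s:{0<..u}|lborel. ?f s / e n) - 0\<bar> \<le> (LINT s:{0<..u}|lborel. 0 / e n) + \<kappa> / 2"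
        proof (rule set_integral_tail_limit_bound)
          fix s assume s: "0 < s" "s < u"
          show "\<bar>?f s - (if u - e n \<le> s then 0 else 0)\<bar> \<le> 0 + (if u - e n \<le> s then \<kappa> / 2 else 0)"
          proof (cases "u - e n \<le> s")
            case True
            let ?r = "min (s + e n) t"
            have r: "u \<le> ?r" "?r < u + d" "?r \<le> T" and mu: "min (s + e n) u = u"
              using True s t False elim by auto
            have "?f s = (x ?r - x u) * (x ?r + x u - 2 * x s)"
              unfolding mu by (simp add: power2_eq_square algebra_simps)
            also have "\<bar>\<dots>\<bar> \<le> \<kappa>' * (4 * B)"
              unfolding abs_mult
            proof (rule mult_mono)
              show "\<bar>x ?r - x u\<bar> \<le> \<kappa>'" using d(2)[OF r(1,2)] by simp
              have "\<bar>x ?r\<bar> \<le> B" "\<bar>x u\<bar> \<le> B" "\<bar>x s\<bar> \<le> B"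
                using r u s by (auto intro!: bounded)
              then show "\<bar>x ?r + x u - 2 * x s\<bar> \<le> 4 * B" by linarith
            qed (use \<kappa>' in auto)
            finally show ?thesis using True \<kappa>'(2) by simp
          next
            case far: False
            then have "min (s + e n) t = min (s + e n) u" using False s by auto
            then show ?thesis using far by simp
          qed
        qed (use e_pos \<open>0 < \<kappa>\<close> int in \<open>auto simp: set_integrable_bounded_Ioc[of "\<lambda>_. 0", where C = 0]\<close>)
        moreover have "(LINT s:{0<..u}|lborel. ?f s / e n)
            = incr_avg (e n) x sq 0 u t - incr_avg (e n) x sq 0 T u"
          using int u False
            set_integral_diff(2)[OF set_integrable_divide[OF int(1), of "e n"]
              set_integrable_divide[OF int(2), of "e n"]]
          by (simp add: incr_avg_def diff_divide_distrib min_absorb1 min_absorb2 del: set_integral_divide_zero)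
        moreover have "\<bar>incr_avg (e n) x sq 0 T u - q u\<bar> < \<kappa> / 2"
          using elim(1) u by (simp add: dist_real_def)
        ultimately have "\<bar>incr_avg (e n) x sq 0 u t - incr_avg (e n) x sq 0 T u\<bar> \<le> \<kappa> / 2"
          "\<bar>incr_avg (e n) x sq 0 T u - q u\<bar> < \<kappa> / 2"
          by (simp_all del: set_integral_divide_zero)
        then have "\<bar>incr_avg (e n) x sq 0 u t - q u\<bar> < \<kappa>"
          by linarith
        then show ?thesis
          using False by (simp add: dist_real_def min_absorb1)
      qed
    qed
  qed
qed

lemma avg_sq_between:
  assumes "0 \<le> a" "a \<le> b" "b \<le> T"
  shows "uniform_limit {0..T} (\<lambda>n t. incr_avg (e n) x sq a b t)
    (\<lambda>t. q (min b t) - q (min a t)) sequentially"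
proof -
  have "uniform_limit {0..T} (\<lambda>n t. incr_avg (e n) x sq 0 b t - incr_avg (e n) x sq 0 a t)
      (\<lambda>t. q (min b t) - q (min a t)) sequentially"
    using assms by (intro uniform_limit_intros avg_sq_until) auto
  moreover have "incr_avg (e n) x sq 0 b t - incr_avg (e n) x sq 0 a t = incr_avg (e n) x sq a b t"
    if "t \<in> {0..T}" for n t
    using incr_avg_split[OF continuous3_sq e_pos, of 0 a b t n] assms that by simp
  ultimately show ?thesis
    by (subst (asm) uniform_limit_cong'[where g = "\<lambda>n t. incr_avg (e n) x sq a b t"
          and i = "\<lambda>t. q (min b t) - q (min a t)"]) auto
qed

lemma incr_avg_sq_nonneg: "0 \<le> incr_avg (e n) x sq a b t"
  unfolding incr_avg_def set_lebesgue_integral_def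
  using e_pos[of n] by (intro integral_nonneg_AE) (auto simp: zero_le_divide_iff less_imp_le)

text \<open>The increase of \<open>q\<close> is a limit of averages of squares.\<close>

lemma q_mono:
  assumes "0 \<le> a" "a \<le> b" "b \<le> T"
  shows "q a \<le> q b"
proof -
  have "(\<lambda>n. incr_avg (e n) x sq a b b) \<longlonglongrightarrow> q (min b b) - q (min a b)"
    using assms by (intro tendsto_uniform_limitI[OF avg_sq_between]) auto
  then have "0 \<le> q (min b b) - q (min a b)"
    by (rule LIMSEQ_le_const) (auto intro: incr_avg_sq_nonneg)
  then show ?thesis using assms by simp
qed

lemma q_at_right:
  assumes "0 \<le> u" "u < T"
  shows "(q \<longlongrightarrow> q u) (at_right u)"
proof (rule swap_uniform_limit'[OF _ _ conv])
  show "\<forall>\<^sub>F n in sequentially.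
      (incr_avg (e n) x sq 0 T \<longlongrightarrow> incr_avg (e n) x sq 0 T u) (at_right u)"
    using assms e_pos by (intro always_eventually allI incr_avg_at_right[OF continuous3_sq]) auto
  show "(\<lambda>n. incr_avg (e n) x sq 0 T u) \<longlonglongrightarrow> q u"
    using assms by (intro tendsto_uniform_limitI[OF conv]) auto
  show "\<forall>\<^sub>F t in at_right u. t \<in> {0..T}"
    using assms by (auto simp: eventually_at_right_field intro!: exI[of _ T])
qed auto

text \<open>Uniform convergence allows the limit \<open>t \<rightarrow> u\<close> to be taken first, for a fixed parameter. It changes only
  increments that start in the last window before \<open>u\<close>, where \<open>x s\<close> is close to the left limit: their
  squares drop from \<open>(jump x u)\<^sup>2\<close> to \<open>0\<close>.\<close>

lemma q_at_left:
  assumes "0 < u" "u \<le> T"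
  shows "(q \<longlongrightarrow> q u - (jump x u)\<^sup>2) (at_left u)"
proof (rule swap_uniform_limit'[OF _ _ conv])
  let ?l = "left_lim x u"
  let ?z = "\<lambda>n s. if s + e n < u then x (s + e n) else ?l"
  let ?g = "\<lambda>n. LINT s:{0<..u}|lborel. (?z n s - x s)\<^sup>2 / e n"
  show "\<forall>\<^sub>F n in sequentially. (incr_avg (e n) x sq 0 T \<longlongrightarrow> ?g n) (at_left u)"
    using assms e_pos by (intro always_eventually allI incr_avg_at_left[OF continuous3_sq]) auto
  have "(\<lambda>n. incr_avg (e n) x sq 0 T u - ?g n) \<longlonglongrightarrow> (jump x u)\<^sup>2"
  proof (rule LIMSEQ_I)
    fix \<kappa> :: real assume "0 < \<kappa>"
    have B: "0 \<le> B" using bounded[of 0] T_pos by auto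
    have "((\<lambda>s. ((x u - x s)\<^sup>2 - (?l - x s)\<^sup>2)) \<longlongrightarrow> (x u - ?l)\<^sup>2 - (?l - ?l)\<^sup>2) (at_left u)"
      by (intro tendsto_intros cadlag_at_left cadlag)
    then have "((\<lambda>s. ((x u - x s)\<^sup>2 - (?l - x s)\<^sup>2)) \<longlongrightarrow> (jump x u)\<^sup>2) (at_left u)"
      by (simp add: jump_def)
    from tendstoD[OF this, of "\<kappa> / 2"] \<open>0 < \<kappa>\<close> obtain c where c: "c < u"
      "\<And>s. c < s \<Longrightarrow> s < u \<Longrightarrow> \<bar>(x u - x s)\<^sup>2 - (?l - x s)\<^sup>2 - (jump x u)\<^sup>2\<bar> < \<kappa> / 2"
      by (auto simp: eventually_at_left_field dist_real_def)
    have "0 < min u (u - c)" using c assms by simp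
    from eventually_e_less[OF this]
    have "\<forall>\<^sub>F n in sequentially. norm (incr_avg (e n) x sq 0 T u - ?g n - (jump x u)\<^sup>2) < \<kappa>"
    proof eventually_elim
      case (elim n)
      let ?f = "\<lambda>s. (x (min (s + e n) u) - x s)\<^sup>2 - (?z n s - x s)\<^sup>2"
      have int: "set_integrable lborel {0<..u} (\<lambda>s. (x (min (s + e n) u) - x s)\<^sup>2)"
        using assms e_pos[of n] by (auto intro!: incr_integrable[OF continuous3_sq])
      have int2: "set_integrable lborel {0<..u} (\<lambda>s. (?z n s - x s)\<^sup>2)"
      proof (rule set_integrable_continuous3[OF continuous3_sq T_pos, where B = B])
        show "?z n \<in> borel_measurable borel" by measurable
        show "\<bar>x s\<bar> \<le> B" "\<bar>?z n s\<bar> \<le> B" if "0 < s" "s \<le> u" for s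
          using that assms e_pos[of n] by (auto intro!: bounded left_lim_x_bounded)
      qed (use assms in auto)
      have "\<bar>(LINT s:{0<..u}|lborel. ?f s / e n) - (jump x u)\<^sup>2\<bar>
          \<le> (LINT s:{0<..u}|lborel. 0 / e n) + \<kappa> / 2"
      proof (rule set_integral_tail_limit_bound)
        fix s assume s: "0 < s" "s < u"
        show "\<bar>?f s - (if u - e n \<le> s then (jump x u)\<^sup>2 else 0)\<bar>
            \<le> 0 + (if u - e n \<le> s then \<kappa> / 2 else 0)"
        proof (cases "u - e n \<le> s")
          case True
          then have "min (s + e n) u = u" "\<not> s + e n < u" "c < s" using elim by auto
          then show ?thesis using c(2)[of s] s True by simp
        next
          case False
          then show ?thesis by simp
        qed
      qed (use e_pos \<open>0 < \<kappa>\<close> int int2 elim in \<open>auto intro!: set_integral_diff(1) set_integrable_bounded_Ioc[of "\<lambda>_. 0", where C = 0]\<close>)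
      moreover have "(LINT s:{0<..u}|lborel. ?f s / e n) = incr_avg (e n) x sq 0 T u - ?g n"
        using assms set_integral_diff(2)[OF set_integrable_divide[OF int, of "e n"]
            set_integrable_divide[OF int2, of "e n"]]
        by (simp add: incr_avg_def diff_divide_distrib min_absorb1 min_absorb2
            del: set_integral_divide_zero)
      ultimately show ?case
        using \<open>0 < \<kappa>\<close> by simp
    qed
    then show "\<exists>no. \<forall>n\<ge>no. norm (incr_avg (e n) x sq 0 T u - ?g n - (jump x u)\<^sup>2) < \<kappa>"
      by (simp add: eventually_sequentially)
  qed
  moreover have "(\<lambda>n. incr_avg (e n) x sq 0 T u) \<longlonglongrightarrow> q u"
    using assms by (intro tendsto_uniform_limitI[OF conv]) auto
  ultimately have "(\<lambda>n. incr_avg (e n) x sq 0 T u - (incr_avg (e n) x sq 0 T u - ?g n))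
      \<longlonglongrightarrow> q u - (jump x u)\<^sup>2"
    by (intro tendsto_intros)
  then show "?g \<longlonglongrightarrow> q u - (jump x u)\<^sup>2"
    by simp
  show "\<forall>\<^sub>F t in at_left u. t \<in> {0..T}"
    using assms by (auto simp: eventually_at_left_field intro!: exI[of _ 0])
qed auto

lemma jump_q: "0 < u \<Longrightarrow> u \<le> T \<Longrightarrow> jump q u = (jump x u)\<^sup>2"
  using left_lim_eqI[OF q_at_left] by (simp add: jump_def[of q])

lemma jump_q_le:
  assumes "0 \<le> c" "c < u" "u \<le> T"
  shows "(jump x u)\<^sup>2 \<le> q u - q c"
proof -
  have "\<forall>\<^sub>F t in at_left u. q c \<le> q t"
    using assms by (auto simp: eventually_at_left_field intro!: exI[of _ c] q_mono)
  then have "q c \<le> q u - (jump x u)\<^sup>2"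
    using assms by (intro tendsto_lowerbound[OF q_at_left]) (auto simp: trivial_limit_at_left_real)
  then show ?thesis by simp
qed

text \<open>Taking the largest jump time \<open>m\<close> off and bounding the rest up to some \<open>c < m\<close>, the two parts use
  disjoint pieces of the increase of \<open>q\<close>.\<close>

lemma sum_jumps_le:
  assumes "finite A"
  shows "0 \<le> a \<Longrightarrow> a \<le> b \<Longrightarrow> b \<le> T \<Longrightarrow> A \<subseteq> {a<..b} \<Longrightarrow> (\<Sum>s\<in>A. (jump x s)\<^sup>2) \<le> q b - q a"
  using assms
proof (induction arbitrary: b rule: finite_linorder_max_induct)
  case empty
  then show ?case using q_mono[of a b] by simp
next
  case (insert m A)
  obtain c where c: "a \<le> c" "c < m" "A \<subseteq> {a<..c}"
  proof (cases "A = {}")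
    case True
    then show ?thesis using that[of a] insert.prems by auto
  next
    case False
    have "Max A \<in> A" using insert.hyps(1) False by (rule Max_in)
    then show ?thesis
      using that[of "Max A"] insert.prems insert.hyps by fastforce
  qed
  have "(\<Sum>s\<in>insert m A. (jump x s)\<^sup>2) = (jump x m)\<^sup>2 + (\<Sum>s\<in>A. (jump x s)\<^sup>2)"
    using insert.hyps by (subst sum.insert) auto
  also have "\<dots> \<le> (q m - q c) + (q c - q a)"
    using insert.prems c by (intro add_mono jump_q_le insert.IH) auto
  also have "\<dots> \<le> q b - q a"
    using q_mono[of m b] insert.prems by auto
  finally show ?case .
qed

lemma jumps_summable:
  assumes "0 \<le> a" "b \<le> T"
  shows "(\<lambda>s. (jump x s)\<^sup>2) summable_on {a<..b}"
proof (cases "a \<le> b")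
  case True
  then show ?thesis
    using assms by (intro nonneg_bdd_above_summable_on bdd_aboveI2[where M = "q b - q a"])
      (auto intro!: sum_jumps_le)
qed simp

lemma infsum_jumps_le:
  assumes "0 \<le> a" "a \<le> b" "b \<le> T"
  shows "(\<Sum>\<^sub>\<infinity>s\<in>{a<..b}. (jump x s)\<^sup>2) \<le> q b - q a"
  using assms by (intro infsum_le_finite_sums jumps_summable sum_jumps_le) auto

lemma continuous_part_diff:
  assumes "0 \<le> a" "a \<le> b" "b \<le> T"
  shows "continuous_part q b - continuous_part q a
    = q b - q a - (\<Sum>\<^sub>\<infinity>s\<in>{a<..b}. (jump x s)\<^sup>2)"
proof -
  have eq: "continuous_part q t = q t - (\<Sum>\<^sub>\<infinity>s\<in>{0<..t}. (jump x s)\<^sup>2)" if "t \<le> T" for t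
    unfolding continuous_part_def using that by (auto intro!: infsum_cong simp: jump_q)
  have "{0<..b} = {0<..a} \<union> {a<..b}" using assms by auto
  then have "(\<Sum>\<^sub>\<infinity>s\<in>{0<..b}. (jump x s)\<^sup>2)
      = (\<Sum>\<^sub>\<infinity>s\<in>{0<..a}. (jump x s)\<^sup>2) + (\<Sum>\<^sub>\<infinity>s\<in>{a<..b}. (jump x s)\<^sup>2)"
    using assms by (simp add: infsum_Un_disjoint jumps_summable)
  then show ?thesis using assms by (simp add: eq)
qed

lemma continuous_part_mono:
  "0 \<le> a \<Longrightarrow> a \<le> b \<Longrightarrow> b \<le> T \<Longrightarrow> continuous_part q a \<le> continuous_part q b"
  using continuous_part_diff[of a b] infsum_jumps_le[of a b] by simp

text \<open>The continuous part increases by at most as much as \<open>q\<close> does.\<close>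

lemma continuous_part_at_right:
  assumes "0 \<le> u" "u < T"
  shows "(continuous_part q \<longlongrightarrow> continuous_part q u) (at_right u)"
proof (rule tendsto_sandwich)
  show "\<forall>\<^sub>F t in at_right u. continuous_part q u \<le> continuous_part q t"
    using assms by (auto simp: eventually_at_right_field intro!: exI[of _ T] continuous_part_mono)
  have "continuous_part q t \<le> continuous_part q u + (q t - q u)" if "u \<le> t" "t \<le> T" for t
    using continuous_part_diff[of u t] that assms
    by (smt (verit) infsum_nonneg zero_le_power2)
  then show "\<forall>\<^sub>F t in at_right u. continuous_part q t \<le> continuous_part q u + (q t - q u)"
    using assms by (auto simp: eventually_at_right_field intro!: exI[of _ T])
  have "((\<lambda>t. continuous_part q u + (q t - q u)) \<longlongrightarrow> continuous_part q u + (q u - q u)) (at_right u)"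
    by (intro tendsto_intros q_at_right assms)
  then show "((\<lambda>t. continuous_part q u + (q t - q u)) \<longlongrightarrow> continuous_part q u) (at_right u)"
    by simp
qed auto

abbreviation \<mu> :: "real measure" where
  "\<mu> \<equiv> stieltjes_measure T (continuous_part q)"

lemma sets_stieltjes [simp, measurable_cong]: "sets \<mu> = sets borel"
  by (simp add: stieltjes_measure_def)

lemma emeasure_stieltjes:
  assumes "0 \<le> a" "a \<le> b" "b \<le> T"
  shows "emeasure \<mu> {a<..b} = continuous_part q b - continuous_part q a"
proof -
  let ?Q = "\<lambda>s. continuous_part q (max 0 (min T s))"
  have "emeasure (interval_measure ?Q) {a<..b} = ?Q b - ?Q a"
  proof (rule emeasure_interval_measure_Ioc[OF \<open>a \<le> b\<close>])
    show "?Q s \<le> ?Q t" if "s \<le> t" for s t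
      using that T_pos by (intro continuous_part_mono) auto
    show "continuous (at_right s) ?Q" for s
    proof -
      have "\<forall>\<^sub>F t in at_right s. ?Q t = ?Q s" if "s < 0 \<or> T \<le> s"
        unfolding eventually_at_right_field
        by (rule exI[of _ "if s < 0 then 0 else s + 1"]) (use that T_pos in \<open>auto split: if_splits\<close>)
      moreover have "(?Q \<longlongrightarrow> ?Q s) (at_right s)" if "0 \<le> s" "s < T"
      proof -
        have "\<forall>\<^sub>F t in at_right s. continuous_part q t = ?Q t"
          unfolding eventually_at_right_field by (rule exI[of _ T]) (use that in auto)
        moreover have "(continuous_part q \<longlongrightarrow> ?Q s) (at_right s)"
          using continuous_part_at_right[of s] that by simp
        ultimately show ?thesis
          by (blast intro: Lim_transform_eventually)
      qed
      ultimately show ?thesis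
        unfolding continuous_within using tendsto_eventually
        by (cases "0 \<le> s \<and> s < T") force+
    qed
  qed
  then show ?thesis
    using assms by (simp add: stieltjes_measure_def)
qed

end

section \<open>Averages of second-order increment functions\<close>

lemma continuous3_near:
  assumes "continuous3 T G" "u \<in> {0..T}" "0 < \<kappa>"
  obtains d where "0 < d" "\<And>s p r. s \<in> {0..T} \<Longrightarrow> \<bar>s - u\<bar> < d \<Longrightarrow> \<bar>p - p0\<bar> < d \<Longrightarrow> \<bar>r - r0\<bar> < d \<Longrightarrow>
    \<bar>G s p r - G u p0 r0\<bar> < \<kappa>"
proof -
  have "\<exists>d>0. \<forall>w\<in>{0..T} \<times> UNIV \<times> UNIV. dist w (u, p0, r0) < d \<longrightarrow>
      dist ((\<lambda>(s, p, r). G s p r) w) ((\<lambda>(s, p, r). G s p r) (u, p0, r0)) < \<kappa>"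
    using assms(1)[unfolded continuous3_def continuous_on_iff, rule_format, of "(u, p0, r0)" \<kappa>] assms(2,3)
    by auto
  then obtain d where d: "0 < d" "\<And>s p r. s \<in> {0..T} \<Longrightarrow> dist (s, p, r) (u, p0, r0) < d \<Longrightarrow>
      \<bar>G s p r - G u p0 r0\<bar> < \<kappa>"
    by (auto simp: dist_real_def)
  have dist_le: "dist (s, p, r) (u, p0, r0) \<le> \<bar>s - u\<bar> + (\<bar>p - p0\<bar> + \<bar>r - r0\<bar>)" for s p r
  proof -
    have "dist (s, p, r) (u, p0, r0) \<le> \<bar>s - u\<bar> + dist (p, r) (p0, r0)"
      using sqrt_sum_squares_le_sum_abs[of "dist s u" "dist (p, r) (p0, r0)"]
      by (simp add: dist_Pair_Pair dist_real_def)
    also have "dist (p, r) (p0, r0) \<le> \<bar>p - p0\<bar> + \<bar>r - r0\<bar>"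
      using sqrt_sum_squares_le_sum_abs[of "dist p p0" "dist r r0"]
      by (simp add: dist_Pair_Pair dist_real_def)
    finally show ?thesis by simp
  qed
  have "\<bar>G s p r - G u p0 r0\<bar> < \<kappa>"
    if "s \<in> {0..T}" "\<bar>s - u\<bar> < d / 3" "\<bar>p - p0\<bar> < d / 3" "\<bar>r - r0\<bar> < d / 3" for s p r
  proof (rule d(2))
    show "dist (s, p, r) (u, p0, r0) < d"
      using dist_le[of s p r] that by linarith
  qed fact
  then show ?thesis
    using that[of "d / 3"] d(1) by simp
qed

text \<open>Functions of an increment that are of second order. For the Taylor remainder of a twice
  differentiable function, \<open>H\<close> is half the second derivative.\<close>

locale quadratic_remainder = quadratic_variation_path +
  fixes G :: "real \<Rightarrow> real \<Rightarrow> real \<Rightarrow> real" and H :: "real \<Rightarrow> real \<Rightarrow> real"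
  assumes G_continuous: "continuous3 T G"
    and H_continuous: "continuous_on ({0..T} \<times> UNIV) (\<lambda>(s, p). H s p)"
    and lagrange: "\<And>s p r. 0 \<le> s \<Longrightarrow> s \<le> T \<Longrightarrow> \<exists>\<xi>\<in>closed_segment p r. G s p r = H s \<xi> * (r - p)\<^sup>2"
begin

abbreviation jump_term :: "real \<Rightarrow> real" where
  "jump_term s \<equiv> G s (left_lim x s) (x s)"

text \<open>The limit to be identified, restricted to the times in \<open>{a<..b}\<close>. It is an integral against \<open>q\<close> in which
  the continuous part and the jumps of \<open>q\<close> carry different integrands: with \<open>G s p r = (r - p)\<^sup>2\<close> and
  \<open>H = 1\<close> it would be the increase of \<open>q\<close>.\<close>

definition limit_functional :: "real \<Rightarrow> real \<Rightarrow> real \<Rightarrow> real" where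
  "limit_functional a b t =
     (LINT s:{a<..min b t}|\<mu>. H s (left_lim x s)) + (\<Sum>\<^sub>\<infinity>s\<in>{a<..min b t}. jump_term s)"

lemma continuous3_H: "continuous3 T (\<lambda>s p r. H s p)"
proof -
  have "continuous_on ({0..T} \<times> UNIV \<times> UNIV) (\<lambda>w. (\<lambda>(s, p). H s p) (fst w, fst (snd w)))"
    by (rule continuous_on_compose2[OF H_continuous]) (auto intro!: continuous_intros)
  then show ?thesis
    by (simp add: continuous3_def case_prod_beta)
qed

lemma jump_term_bounded:
  obtains C where "0 \<le> C" "\<And>s. 0 < s \<Longrightarrow> s \<le> T \<Longrightarrow> \<bar>H s (left_lim x s)\<bar> \<le> C"
    "\<And>s. 0 < s \<Longrightarrow> s \<le> T \<Longrightarrow> \<bar>jump_term s\<bar> \<le> C * (jump x s)\<^sup>2"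
proof -
  obtain C where C: "\<forall>s\<in>{0..T}. \<forall>p\<in>{- B..B}. \<forall>r\<in>{- B..B}. \<bar>H s p\<bar> \<le> C"
    using continuous3_bounded[OF continuous3_H] by blast
  then have C': "\<bar>H s p\<bar> \<le> C" if "0 \<le> s" "s \<le> T" "\<bar>p\<bar> \<le> B" for s p
    using that by (auto simp: abs_le_iff)
  show ?thesis
  proof (rule that)
    show "0 \<le> C"
      using order_trans[OF abs_ge_zero C'[of 0 "x 0"]] bounded[of 0] T_pos by simp
    fix s assume s: "0 < s" "s \<le> T"
    have b: "\<bar>x s\<bar> \<le> B" "\<bar>left_lim x s\<bar> \<le> B"
      using s by (auto intro: bounded left_lim_x_bounded)
    show "\<bar>H s (left_lim x s)\<bar> \<le> C"
      using s b by (intro C') auto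
    obtain \<xi> where \<xi>: "\<xi> \<in> closed_segment (left_lim x s) (x s)"
      "jump_term s = H s \<xi> * (x s - left_lim x s)\<^sup>2"
      using lagrange s by (metis less_imp_le)
    have "\<bar>\<xi>\<bar> \<le> B"
      using \<xi>(1) b by (auto simp: closed_segment_eq_real_ivl abs_le_iff split: if_splits)
    then have "\<bar>H s \<xi>\<bar> \<le> C"
      using s by (intro C') auto
    then show "\<bar>jump_term s\<bar> \<le> C * (jump x s)\<^sup>2"
      unfolding \<xi>(2) by (simp add: abs_mult jump_def mult_right_mono)
  qed
qed

lemma jump_term_summable:
  assumes "0 \<le> a" "b \<le> T"
  shows "jump_term summable_on {a<..b}"
proof -
  obtain C where C: "\<And>s. 0 < s \<Longrightarrow> s \<le> T \<Longrightarrow> \<bar>jump_term s\<bar> \<le> C * (jump x s)\<^sup>2"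
    by (rule jump_term_bounded) blast
  have "(\<lambda>s. norm (jump_term s)) summable_on {a<..b}"
  proof (rule Infinite_Sum.abs_summable_on_comparison_test')
    show "(\<lambda>s. C * (jump x s)\<^sup>2) summable_on {a<..b}"
      by (rule summable_on_cmult_right[OF jumps_summable[OF assms]])
    show "norm (jump_term s) \<le> C * (jump x s)\<^sup>2" if "s \<in> {a<..b}" for s
      using C[of s] that assms by simp
  qed
  then show ?thesis by (rule abs_summable_summable)
qed

lemma H_integrable:
  assumes "0 \<le> a" "b \<le> T"
  shows "set_integrable \<mu> {a<..b} (\<lambda>s. H s (left_lim x s))"
proof -
  obtain C where C: "\<And>s. 0 < s \<Longrightarrow> s \<le> T \<Longrightarrow> \<bar>H s (left_lim x s)\<bar> \<le> C"
    by (rule jump_term_bounded) blast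
  have "(\<lambda>s. H (clip T s) (left_lim x s)) \<in> borel_measurable borel"
    using T_pos by (intro continuous3_measurable[OF continuous3_H, where z = "\<lambda>_. 0"]) auto
  then have "set_integrable \<mu> {a<..b} (\<lambda>s. H (clip T s) (left_lim x s))"
    unfolding set_integrable_def
  proof (intro integrableI_bounded_set_indicator[where B = C])
    show "emeasure \<mu> {a<..b} < \<infinity>"
      using emeasure_stieltjes[of a b] assms by (cases "a \<le> b") auto
    show "AE s in \<mu>. s \<in> {a<..b} \<longrightarrow> norm (H (clip T s) (left_lim x s)) \<le> C"
      using C assms by auto
  qed auto
  moreover have "set_integrable \<mu> {a<..b} (\<lambda>s. H (clip T s) (left_lim x s))
      = set_integrable \<mu> {a<..b} (\<lambda>s. H s (left_lim x s))"
    using assms by (intro set_integrable_cong) auto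
  ultimately show ?thesis by blast
qed

lemma limit_functional_split:
  assumes "0 \<le> a" "a \<le> b" "b \<le> c" "c \<le> T"
  shows "limit_functional a c t = limit_functional a b t + limit_functional b c t"
proof -
  have un: "{a<..min c t} = {a<..min b t} \<union> {b<..min c t}"
    and disjoint: "{a<..min b t} \<inter> {b<..min c t} = {}"
    using assms by auto
  have "(LINT s:{a<..min c t}|\<mu>. H s (left_lim x s))
      = (LINT s:{a<..min b t}|\<mu>. H s (left_lim x s)) + (LINT s:{b<..min c t}|\<mu>. H s (left_lim x s))"
    unfolding un
    by (rule set_integral_Un[OF disjoint]; rule H_integrable) (use assms in auto)
  moreover have "(\<Sum>\<^sub>\<infinity>s\<in>{a<..min c t}. jump_term s)
      = (\<Sum>\<^sub>\<infinity>s\<in>{a<..min b t}. jump_term s) + (\<Sum>\<^sub>\<infinity>s\<in>{b<..min c t}. jump_term s)"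
    unfolding un
    by (rule infsum_Un_disjoint[OF _ _ disjoint]; rule jump_term_summable) (use assms in auto)
  ultimately show ?thesis by (simp add: limit_functional_def)
qed

lemma stieltjes_integral_approx:
  assumes "0 \<le> a" "a \<le> b" "b \<le> T"
    and h: "\<And>s. a < s \<Longrightarrow> s \<le> b \<Longrightarrow> \<bar>H s (left_lim x s) - h\<bar> \<le> \<eta>"
  shows "\<bar>(LINT s:{a<..b}|\<mu>. H s (left_lim x s)) - h * (continuous_part q b - continuous_part q a)\<bar>
    \<le> \<eta> * (continuous_part q b - continuous_part q a)"
proof -
  let ?A = "{a<..b}" and ?D = "continuous_part q b - continuous_part q a"
  have D: "0 \<le> ?D" using continuous_part_mono[of a b] assms by simp
  have fin: "emeasure \<mu> ?A < \<infinity>" and meas: "measure \<mu> ?A = ?D"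
    using emeasure_stieltjes[of a b] assms D by (auto simp: measure_def)
  have const: "set_integrable \<mu> ?A (\<lambda>_. c)" "(LINT s:?A|\<mu>. c) = c * ?D" for c :: real
    using fin meas by (auto simp: set_integrable_def set_lebesgue_integral_def)
  note Hint = H_integrable[OF assms(1,3)]
  have "(LINT s:?A|\<mu>. H s (left_lim x s)) \<le> (LINT s:?A|\<mu>. h + \<eta>)"
    using Hint const(1) h by (intro set_integral_mono) force+
  moreover have "(LINT s:?A|\<mu>. h - \<eta>) \<le> (LINT s:?A|\<mu>. H s (left_lim x s))"
    using Hint const(1) h by (intro set_integral_mono) force+
  ultimately show ?thesis
    unfolding const(2) by (simp add: abs_le_iff algebra_simps)
qed

text \<open>If \<open>H\<close> is close to \<open>h\<close>, and \<open>G\<close> to \<open>h\<close> times the squared increment, for the values of the path before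
  \<open>b\<close>, then both parts of the limit are close to \<open>h\<close> times the corresponding part of \<open>q\<close>. Only the jump at \<open>b\<close> may be large; it
  is kept exactly.\<close>

lemma limit_functional_approx:
  assumes "0 \<le> a" "a < b" "b \<le> T" "a < t" "t \<le> T"
    and near: "\<And>s p r. a < s \<Longrightarrow> s \<le> b \<Longrightarrow> \<bar>p - c\<bar> \<le> \<delta> \<Longrightarrow> \<bar>r - c\<bar> \<le> \<delta> \<Longrightarrow>
      \<bar>H s p - h\<bar> \<le> \<eta> \<and> \<bar>G s p r - h * (r - p)\<^sup>2\<bar> \<le> \<eta> * (r - p)\<^sup>2"
    and osc: "\<And>s. a < s \<Longrightarrow> s < b \<Longrightarrow> \<bar>x s - c\<bar> \<le> \<delta>"
    and "0 \<le> \<eta>"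
  shows "\<bar>limit_functional a b t - h * (q (min b t) - q a)
      - (if b \<le> t then jump_term b - h * (jump x b)\<^sup>2 else 0)\<bar> \<le> \<eta> * (q (min b t) - q a)"
proof -
  let ?m = "min b t"
  have m: "a < ?m" "?m \<le> T" "?m \<le> b" using assms by auto
  have left: "\<bar>left_lim x s - c\<bar> \<le> \<delta>" if "a < s" "s \<le> b" for s
    using left_lim_bounded[OF cadlag, of a b c \<delta> s] osc that by blast
  define S where "S = (\<Sum>\<^sub>\<infinity>s\<in>{a<..?m}. (jump x s)\<^sup>2)"
  define D where "D = continuous_part q ?m - continuous_part q a"
  have qD: "q ?m - q a = D + S"
    using continuous_part_diff[of a ?m] assms(1) m by (simp add: S_def D_def)
  let ?r = "\<lambda>s. jump_term s - h * (jump x s)\<^sup>2"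
  have r_eq: "?r = (\<lambda>s. jump_term s + (- h) * (jump x s)\<^sup>2)"
    by auto
  have sm: "jump_term summable_on {a<..?m}" "(\<lambda>s. (jump x s)\<^sup>2) summable_on {a<..?m}"
    using assms(1) m by (auto intro: jump_term_summable jumps_summable)
  have sm': "(\<lambda>s. (- h) * (jump x s)\<^sup>2) summable_on {a<..?m}"
    by (rule summable_on_cmult_right[OF sm(2)])
  have r_summable: "?r summable_on {a<..?m}"
    unfolding r_eq by (rule summable_on_add[OF sm(1) sm'])
  have r_infsum: "(\<Sum>\<^sub>\<infinity>s\<in>{a<..?m}. ?r s) = (\<Sum>\<^sub>\<infinity>s\<in>{a<..?m}. jump_term s) - h * S"
    unfolding r_eq S_def infsum_add[OF sm(1) sm'] infsum_cmult_right[OF sm(2)] by simp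
  let ?A = "{a<..?m} - {b}"
  have A_summable: "?r summable_on ?A" "(\<lambda>s. (jump x s)\<^sup>2) summable_on ?A"
    using r_summable jumps_summable[of a ?m] assms(1) m by (auto intro: summable_on_subset_banach)
  have A_infsum: "(\<Sum>\<^sub>\<infinity>s\<in>{a<..?m}. ?r s) = (\<Sum>\<^sub>\<infinity>s\<in>?A. ?r s) + (if b \<le> t then ?r b else 0)"
  proof (cases "b \<le> t")
    case True
    then have "{a<..?m} = ?A \<union> {b}" using assms by auto
    then have "(\<Sum>\<^sub>\<infinity>s\<in>{a<..?m}. ?r s) = (\<Sum>\<^sub>\<infinity>s\<in>?A. ?r s) + (\<Sum>\<^sub>\<infinity>s\<in>{b}. ?r s)"
      using infsum_Un_disjoint[OF A_summable(1), of "{b}"] by simp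
    then show ?thesis using True by simp
  next
    case False
    then have "?A = {a<..?m}" by auto
    then show ?thesis using False by simp
  qed
  have "\<bar>\<Sum>\<^sub>\<infinity>s\<in>?A. ?r s\<bar> \<le> (\<Sum>\<^sub>\<infinity>s\<in>?A. \<eta> * (jump x s)\<^sup>2)"
  proof -
    have "\<bar>?r s\<bar> \<le> \<eta> * (jump x s)\<^sup>2" if "s \<in> ?A" for s
      using near[of s "left_lim x s" "x s"] left[of s] osc[of s] that m by (auto simp: jump_def)
    moreover have "((\<lambda>s. \<eta> * (jump x s)\<^sup>2) has_sum (\<Sum>\<^sub>\<infinity>s\<in>?A. \<eta> * (jump x s)\<^sup>2)) ?A"
      using A_summable(2) by (intro has_sum_infsum summable_on_cmult_right)
    ultimately show ?thesis
      using norm_infsum_le[OF has_sum_infsum[OF A_summable(1)]] by simp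
  qed
  also have "\<dots> = \<eta> * (\<Sum>\<^sub>\<infinity>s\<in>?A. (jump x s)\<^sup>2)"
    by (rule infsum_cmult_right) (use A_summable in auto)
  also have "\<dots> \<le> \<eta> * S"
    unfolding S_def using \<open>0 \<le> \<eta>\<close> A_summable assms(1) m
    by (intro mult_left_mono infsum_mono2 jumps_summable) auto
  finally have jumps: "\<bar>\<Sum>\<^sub>\<infinity>s\<in>?A. ?r s\<bar> \<le> \<eta> * S" .
  have cont: "\<bar>(LINT s:{a<..?m}|\<mu>. H s (left_lim x s)) - h * D\<bar> \<le> \<eta> * D"
    unfolding D_def
  proof (rule stieltjes_integral_approx)
    show "\<bar>H s (left_lim x s) - h\<bar> \<le> \<eta>" if "a < s" "s \<le> ?m" for s
      using near[of s "left_lim x s" "left_lim x s"] left[of s] that m by auto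
  qed (use assms m in auto)
  have "limit_functional a b t - h * (q ?m - q a) - (if b \<le> t then ?r b else 0)
      = ((LINT s:{a<..?m}|\<mu>. H s (left_lim x s)) - h * D) + (\<Sum>\<^sub>\<infinity>s\<in>?A. ?r s)"
    using r_infsum A_infsum by (simp add: limit_functional_def qD algebra_simps)
  also have "\<bar>\<dots>\<bar> \<le> \<eta> * D + \<eta> * S"
    using jumps cont by linarith
  also have "\<dots> = \<eta> * (q ?m - q a)"
    by (simp add: qD algebra_simps)
  finally show ?thesis .
qed

text \<open>The counterpart for the averages. Increments that end before \<open>b\<close> are within the range where \<open>G\<close> is close to \<open>h\<close> times
  the squared increment; those across \<open>b\<close> start near the left limit and end near \<open>x b\<close>, so that they
  contribute the jump term at \<open>b\<close>.\<close>

lemma incr_avg_approx: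
  assumes "0 \<le> a" "a < b" "b \<le> T"
    and near: "\<And>s p r. a < s \<Longrightarrow> s \<le> b \<Longrightarrow> \<bar>p - c\<bar> \<le> \<delta> \<Longrightarrow> \<bar>r - c\<bar> \<le> \<delta> \<Longrightarrow>
      \<bar>H s p - h\<bar> \<le> \<eta> \<and> \<bar>G s p r - h * (r - p)\<^sup>2\<bar> \<le> \<eta> * (r - p)\<^sup>2"
    and osc: "\<And>s. a < s \<Longrightarrow> s < b \<Longrightarrow> \<bar>x s - c\<bar> \<le> \<delta>"
    and "0 \<le> \<eta>" "0 < \<kappa>"
  shows "\<forall>\<^sub>F n in sequentially. \<forall>t. a < t \<longrightarrow> t \<le> T \<longrightarrow>
    \<bar>incr_avg (e n) x G a b t - h * incr_avg (e n) x sq a b t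
      - (if b \<le> t then jump_term b - h * (jump x b)\<^sup>2 else 0)\<bar> \<le> \<eta> * incr_avg (e n) x sq a b t + \<kappa>"
proof -
  let ?D = "\<lambda>s p r. G s p r - h * (r - p)\<^sup>2"
  have D_cont: "continuous3 T ?D"
    using G_continuous unfolding continuous3_def case_prod_beta by (intro continuous_intros)
  obtain d where d: "0 < d" "\<And>s p r. s \<in> {0..T} \<Longrightarrow> \<bar>s - b\<bar> < d \<Longrightarrow> \<bar>p - left_lim x b\<bar> < d \<Longrightarrow>
      \<bar>r - x b\<bar> < d \<Longrightarrow> \<bar>?D s p r - ?D b (left_lim x b) (x b)\<bar> < \<kappa>"
    using continuous3_near[OF D_cont _ \<open>0 < \<kappa>\<close>, of b] assms(1-3) by auto
  obtain d1 where d1: "0 < d1" "\<And>s. b - d1 < s \<Longrightarrow> s < b \<Longrightarrow> \<bar>x s - left_lim x b\<bar> < d"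
    using near_left[OF d(1)] by blast
  obtain d2 where d2: "0 < d2" "\<And>s. b \<le> s \<Longrightarrow> s < b + d2 \<Longrightarrow> \<bar>x s - x b\<bar> < d"
    using near_right[OF d(1)] by blast
  have "0 < min (min d d1) (min d2 (b - a))"
    using d(1) d1(1) d2(1) assms by simp
  from eventually_e_less[OF this] show ?thesis
  proof eventually_elim
    case (elim n)
    let ?\<epsilon> = "e n"
    have e: "0 < ?\<epsilon>" "?\<epsilon> < d" "?\<epsilon> < d1" "?\<epsilon> < d2" "?\<epsilon> < b - a"
      using elim e_pos[of n] by auto
    show ?case
    proof (intro allI impI)
      fix t assume t: "a < t" "t \<le> T"
      let ?m = "min b t" and ?J = "if b \<le> t then jump_term b - h * (jump x b)\<^sup>2 else 0"
      let ?G = "\<lambda>s. G s (x s) (x (min (s + ?\<epsilon>) t))" and ?S = "\<lambda>s. sq s (x s) (x (min (s + ?\<epsilon>) t))"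
      have int: "set_integrable lborel {a<..?m} ?G" "set_integrable lborel {a<..?m} ?S"
        using assms t e(1) by (auto intro!: incr_integrable G_continuous continuous3_sq)
      have "\<bar>(LINT s:{a<..?m}|lborel. (?G s - h * ?S s) / ?\<epsilon>) - ?J\<bar>
          \<le> (LINT s:{a<..?m}|lborel. \<eta> * ?S s / ?\<epsilon>) + \<kappa>"
      proof (rule set_integral_tail_limit_bound)
        fix s assume s: "a < s" "s < ?m"
        let ?r = "min (s + ?\<epsilon>) t"
        have S0: "0 \<le> \<eta> * ?S s" using \<open>0 \<le> \<eta>\<close> by simp
        show "\<bar>?G s - h * ?S s - (if ?m - ?\<epsilon> \<le> s then ?J else 0)\<bar>
            \<le> \<eta> * ?S s + (if ?m - ?\<epsilon> \<le> s then \<kappa> else 0)"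
        proof (cases "?r < b")
          case True
          have "\<bar>?G s - h * ?S s\<bar> \<le> \<eta> * ?S s"
            using near[of s "x s" "x ?r"] osc[of s] osc[of ?r] s True e(1) by auto
          moreover have "(if ?m - ?\<epsilon> \<le> s then ?J else 0) = 0"
            using True by auto
          ultimately show ?thesis using \<open>0 < \<kappa>\<close> by auto
        next
          case False
          then have bt: "b \<le> t" and "b - ?\<epsilon> \<le> s" by auto
          moreover have "\<bar>?D s (x s) (x ?r) - ?D b (left_lim x b) (x b)\<bar> < \<kappa>"
          proof (rule d(2))
            show "\<bar>x s - left_lim x b\<bar> < d"
              using s e \<open>b - ?\<epsilon> \<le> s\<close> by (intro d1(2)) auto
            show "\<bar>x ?r - x b\<bar> < d"
              using s e False by (intro d2(2)) auto
            show "s \<in> {0..T}" "\<bar>s - b\<bar> < d"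
              using s e assms \<open>b - ?\<epsilon> \<le> s\<close> by auto
          qed
          ultimately show ?thesis
            using S0 by (simp add: min_absorb1 jump_def)
        qed
      next
        show "?J \<noteq> 0 \<Longrightarrow> ?\<epsilon> \<le> ?m - a"
          using e by (auto split: if_splits)
        show "set_integrable lborel {a<..?m} (\<lambda>s. ?G s - h * ?S s)"
          using int by (intro set_integral_diff(1)) auto
      qed (use e int \<open>0 < \<kappa>\<close> in auto)
      moreover have "(LINT s:{a<..?m}|lborel. (?G s - h * ?S s) / ?\<epsilon>)
          = incr_avg ?\<epsilon> x G a b t - h * incr_avg ?\<epsilon> x sq a b t"
        using int by (simp add: incr_avg_def set_integral_diff(2) diff_divide_distrib)
      moreover have "(LINT s:{a<..?m}|lborel. \<eta> * ?S s / ?\<epsilon>) = \<eta> * incr_avg ?\<epsilon> x sq a b t"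
        by (simp add: incr_avg_def)
      ultimately show "\<bar>incr_avg ?\<epsilon> x G a b t - h * incr_avg ?\<epsilon> x sq a b t - ?J\<bar>
          \<le> \<eta> * incr_avg ?\<epsilon> x sq a b t + \<kappa>"
        by simp
    qed
  qed
qed

text \<open>The averages approach the limit up to an error proportional to the increase of the quadratic
  variation. An error of this form is additive over adjacent intervals.\<close>

definition close_on :: "real \<Rightarrow> real \<Rightarrow> real \<Rightarrow> bool" where
  "close_on \<eta> a b \<longleftrightarrow> (\<forall>\<kappa>>0. \<forall>\<^sub>F n in sequentially. \<forall>t\<in>{0..T}.
     \<bar>incr_avg (e n) x G a b t - limit_functional a b t\<bar> \<le> 2 * \<eta> * (q b - q a) + \<kappa>)"

text \<open>The averages and the limit are compared with the same expression: \<open>h\<close> times the squared increments,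
  respectively \<open>h\<close> times the increase of \<open>q\<close>, corrected at \<open>b\<close> to give
  the exact jump term. Each comparison costs \<open>\<eta>\<close> times the increase of \<open>q\<close>, hence the factor \<open>2\<close>.\<close>

lemma close_on_small_oscillation:
  assumes "0 \<le> a" "a < b" "b \<le> T"
    and near: "\<And>s p r. a < s \<Longrightarrow> s \<le> b \<Longrightarrow> \<bar>p - c\<bar> \<le> \<delta> \<Longrightarrow> \<bar>r - c\<bar> \<le> \<delta> \<Longrightarrow>
      \<bar>H s p - h\<bar> \<le> \<eta> \<and> \<bar>G s p r - h * (r - p)\<^sup>2\<bar> \<le> \<eta> * (r - p)\<^sup>2"
    and osc: "\<And>s. a < s \<Longrightarrow> s < b \<Longrightarrow> \<bar>x s - c\<bar> \<le> \<delta>"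
    and "0 \<le> \<eta>"
  shows "close_on \<eta> a b"
  unfolding close_on_def
proof (intro allI impI)
  fix \<kappa> :: real assume "0 < \<kappa>"
  \<comment> \<open>The tolerance for the squared increments enters multiplied by \<open>\<bar>h\<bar>\<close> and by \<open>\<eta>\<close>.\<close>
  define \<kappa>' where "\<kappa>' = \<kappa> / (2 * (\<eta> + \<bar>h\<bar> + 1))"
  have \<kappa>': "0 < \<kappa>'" "(\<eta> + \<bar>h\<bar>) * \<kappa>' \<le> \<kappa> / 2"
    using \<open>0 < \<kappa>\<close> \<open>0 \<le> \<eta>\<close> by (auto simp: \<kappa>'_def field_simps add_pos_nonneg)
  have "0 < \<kappa> / 2" using \<open>0 < \<kappa>\<close> by simp
  have "\<forall>\<^sub>F n in sequentially. \<forall>t. a < t \<longrightarrow> t \<le> T \<longrightarrow>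
    \<bar>incr_avg (e n) x G a b t - h * incr_avg (e n) x sq a b t
      - (if b \<le> t then jump_term b - h * (jump x b)\<^sup>2 else 0)\<bar> \<le> \<eta> * incr_avg (e n) x sq a b t + \<kappa> / 2"
    by (rule incr_avg_approx[where c = c and \<delta> = \<delta>]) (fact assms \<open>0 < \<kappa> / 2\<close>)+
  from this uniform_limitD[OF avg_sq_between[OF assms(1) less_imp_le[OF assms(2)] assms(3)] \<kappa>'(1)]
  show "\<forall>\<^sub>F n in sequentially. \<forall>t\<in>{0..T}.
      \<bar>incr_avg (e n) x G a b t - limit_functional a b t\<bar> \<le> 2 * \<eta> * (q b - q a) + \<kappa>"
  proof eventually_elim
    case (elim n)
    show ?case
    proof
      fix t assume t: "t \<in> {0..T}"
      have q: "q a \<le> q b" using q_mono[of a b] assms(1-3) by simp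
      show "\<bar>incr_avg (e n) x G a b t - limit_functional a b t\<bar> \<le> 2 * \<eta> * (q b - q a) + \<kappa>"
      proof (cases "a < t")
        case False
        then have "incr_avg (e n) x G a b t = 0" "limit_functional a b t = 0"
          by (auto simp: incr_avg_def limit_functional_def set_lebesgue_integral_def)
        then show ?thesis using \<open>0 < \<kappa>\<close> \<open>0 \<le> \<eta>\<close> q by simp
      next
        case True
        let ?M = "incr_avg (e n) x sq a b t" and ?Q = "q (min b t) - q a"
        let ?J = "if b \<le> t then jump_term b - h * (jump x b)\<^sup>2 else 0"
        have A: "\<bar>incr_avg (e n) x G a b t - h * ?M - ?J\<bar> \<le> \<eta> * ?M + \<kappa> / 2"
          using elim(1) True t by simp
        have C: "\<bar>limit_functional a b t - h * ?Q - ?J\<bar> \<le> \<eta> * ?Q"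
        proof (rule limit_functional_approx[where c = c and \<delta> = \<delta>])
          show "t \<le> T" using t by simp
        qed (fact assms True)+
        have M: "\<bar>?M - ?Q\<bar> \<le> \<kappa>'"
          using elim(2) t True by (fastforce simp: dist_real_def min_absorb1)
        have "h * ?M - h * ?Q \<le> \<bar>h\<bar> * \<kappa>'" "h * ?Q - h * ?M \<le> \<bar>h\<bar> * \<kappa>'"
          using mult_left_mono[OF M, of "\<bar>h\<bar>"] unfolding abs_mult[symmetric]
          by (simp_all add: abs_le_iff algebra_simps)
        moreover have "\<eta> * ?M \<le> \<eta> * ?Q + \<eta> * \<kappa>'"
          using mult_left_mono[of ?M "?Q + \<kappa>'" \<eta>] M \<open>0 \<le> \<eta>\<close> by (simp add: algebra_simps abs_le_iff)
        ultimately have "\<bar>incr_avg (e n) x G a b t - limit_functional a b t\<bar>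
            \<le> 2 * (\<eta> * ?Q) + (\<eta> + \<bar>h\<bar>) * \<kappa>' + \<kappa> / 2"
          using A C by (simp add: abs_le_iff distrib_right)
        also have "\<dots> \<le> 2 * (\<eta> * (q b - q a)) + \<kappa>"
          using \<kappa>'(2) q_mono[of "min b t" b] assms(1-3) True \<open>0 \<le> \<eta>\<close> mult_left_mono[of ?Q "q b - q a" \<eta>]
          by simp
        finally show ?thesis by simp
      qed
    qed
  qed
qed

lemma close_on_refl: "close_on \<eta> a a"
  unfolding close_on_def incr_avg_def limit_functional_def
  by (auto simp: set_lebesgue_integral_def)

lemma close_on_trans:
  assumes "0 \<le> a" "a \<le> b" "b \<le> c" "c \<le> T" and ab: "close_on \<eta> a b" and bc: "close_on \<eta> b c"
  shows "close_on \<eta> a c"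
  unfolding close_on_def
proof (intro allI impI)
  fix \<kappa> :: real assume "0 < \<kappa>"
  then have "0 < \<kappa> / 2" by simp
  then have "\<forall>\<^sub>F n in sequentially. \<forall>t\<in>{0..T}.
     \<bar>incr_avg (e n) x G a b t - limit_functional a b t\<bar> \<le> 2 * \<eta> * (q b - q a) + \<kappa> / 2"
    "\<forall>\<^sub>F n in sequentially. \<forall>t\<in>{0..T}.
     \<bar>incr_avg (e n) x G b c t - limit_functional b c t\<bar> \<le> 2 * \<eta> * (q c - q b) + \<kappa> / 2"
    using ab bc unfolding close_on_def by blast+
  then show "\<forall>\<^sub>F n in sequentially. \<forall>t\<in>{0..T}.
     \<bar>incr_avg (e n) x G a c t - limit_functional a c t\<bar> \<le> 2 * \<eta> * (q c - q a) + \<kappa>"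
  proof eventually_elim
    case (elim n)
    show ?case
    proof
      fix t assume t: "t \<in> {0..T}"
      have "incr_avg (e n) x G a c t = incr_avg (e n) x G a b t + incr_avg (e n) x G b c t"
        using assms t by (intro incr_avg_split[OF G_continuous e_pos]) auto
      moreover have "limit_functional a c t = limit_functional a b t + limit_functional b c t"
        using assms by (intro limit_functional_split) auto
      ultimately show "\<bar>incr_avg (e n) x G a c t - limit_functional a c t\<bar> \<le> 2 * \<eta> * (q c - q a) + \<kappa>"
        using bspec[OF elim(1) t] bspec[OF elim(2) t] by (simp add: algebra_simps)
    qed
  qed
qed

lemma near_diagonal:
  assumes "0 \<le> u" "u \<le> T" "0 < \<eta>"
  obtains \<delta> where "0 < \<delta>" "\<And>s p r. 0 \<le> s \<Longrightarrow> s \<le> T \<Longrightarrow> \<bar>s - u\<bar> \<le> \<delta> \<Longrightarrow> \<bar>p - c\<bar> \<le> \<delta> \<Longrightarrow> \<bar>r - c\<bar> \<le> \<delta> \<Longrightarrow>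
    \<bar>H s p - H u c\<bar> \<le> \<eta> \<and> \<bar>G s p r - H u c * (r - p)\<^sup>2\<bar> \<le> \<eta> * (r - p)\<^sup>2"
proof -
  obtain d where d: "0 < d" "\<And>s p r. s \<in> {0..T} \<Longrightarrow> \<bar>s - u\<bar> < d \<Longrightarrow> \<bar>p - c\<bar> < d \<Longrightarrow> \<bar>r - c\<bar> < d \<Longrightarrow>
      \<bar>H s p - H u c\<bar> < \<eta>"
    using continuous3_near[OF continuous3_H _ \<open>0 < \<eta>\<close>, of u c c] assms by auto
  show ?thesis
  proof (rule that)
    show "0 < d / 2" using d(1) by simp
    fix s p r assume *: "0 \<le> s" "s \<le> T" "\<bar>s - u\<bar> \<le> d / 2" "\<bar>p - c\<bar> \<le> d / 2" "\<bar>r - c\<bar> \<le> d / 2"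
    have H: "\<bar>H s \<xi> - H u c\<bar> \<le> \<eta>" if "\<bar>\<xi> - c\<bar> \<le> d / 2" for \<xi>
      using d(2)[of s \<xi> c] d(1) * that by simp
    obtain \<xi> where \<xi>: "\<xi> \<in> closed_segment p r" "G s p r = H s \<xi> * (r - p)\<^sup>2"
      using lagrange[OF *(1,2)] by blast
    have "\<bar>\<xi> - c\<bar> \<le> d / 2"
    proof -
      have "(p \<le> \<xi> \<and> \<xi> \<le> r) \<or> (r \<le> \<xi> \<and> \<xi> \<le> p)"
        using \<xi>(1) by (auto simp: closed_segment_eq_real_ivl split: if_splits)
      then show ?thesis using *(4,5) by linarith
    qed
    have "\<bar>G s p r - H u c * (r - p)\<^sup>2\<bar> = \<bar>H s \<xi> - H u c\<bar> * (r - p)\<^sup>2"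
      by (simp add: \<xi>(2) left_diff_distrib[symmetric] abs_mult)
    also have "\<dots> \<le> \<eta> * (r - p)\<^sup>2"
      using H[OF \<open>\<bar>\<xi> - c\<bar> \<le> d / 2\<close>] by (intro mult_right_mono) auto
    finally show "\<bar>H s p - H u c\<bar> \<le> \<eta> \<and> \<bar>G s p r - H u c * (r - p)\<^sup>2\<bar> \<le> \<eta> * (r - p)\<^sup>2"
      using H[of p] * by simp
  qed
qed

text \<open>Around a time \<open>u\<close> the path is close to its left limit before \<open>u\<close> and close to \<open>x u\<close> from \<open>u\<close> on, so
  the estimate for small oscillation applies to both sides of \<open>u\<close>, with different constants \<open>h\<close>.\<close>

lemma close_on_all:
  assumes "0 < \<eta>"
  shows "close_on \<eta> 0 T"
proof -
  have "0 \<le> T" using T_pos by simp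
  define P where "P a b \<longleftrightarrow> (0 \<le> a \<longrightarrow> b \<le> T \<longrightarrow> close_on \<eta> a b)" for a b
  from \<open>0 \<le> T\<close> have "P 0 T"
  proof (induction rule: Bolzano)
    case (trans a b c)
    then show ?case using close_on_trans[of a b c \<eta>] by (auto simp: P_def)
  next
    case (local u)
    obtain \<delta>1 where \<delta>1: "0 < \<delta>1" "\<And>s p r. 0 \<le> s \<Longrightarrow> s \<le> T \<Longrightarrow> \<bar>s - u\<bar> \<le> \<delta>1 \<Longrightarrow>
        \<bar>p - left_lim x u\<bar> \<le> \<delta>1 \<Longrightarrow> \<bar>r - left_lim x u\<bar> \<le> \<delta>1 \<Longrightarrow>
        \<bar>H s p - H u (left_lim x u)\<bar> \<le> \<eta> \<and> \<bar>G s p r - H u (left_lim x u) * (r - p)\<^sup>2\<bar> \<le> \<eta> * (r - p)\<^sup>2"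
      using near_diagonal[OF local assms] by blast
    obtain d1 where d1: "0 < d1" "\<And>s. u - d1 < s \<Longrightarrow> s < u \<Longrightarrow> \<bar>x s - left_lim x u\<bar> < \<delta>1"
      using near_left[OF \<delta>1(1)] by blast
    obtain \<delta>2 where \<delta>2: "0 < \<delta>2" "\<And>s p r. 0 \<le> s \<Longrightarrow> s \<le> T \<Longrightarrow> \<bar>s - u\<bar> \<le> \<delta>2 \<Longrightarrow>
        \<bar>p - x u\<bar> \<le> \<delta>2 \<Longrightarrow> \<bar>r - x u\<bar> \<le> \<delta>2 \<Longrightarrow>
        \<bar>H s p - H u (x u)\<bar> \<le> \<eta> \<and> \<bar>G s p r - H u (x u) * (r - p)\<^sup>2\<bar> \<le> \<eta> * (r - p)\<^sup>2"
      using near_diagonal[OF local assms] by blast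
    obtain d2 where d2: "0 < d2" "\<And>s. u \<le> s \<Longrightarrow> s < u + d2 \<Longrightarrow> \<bar>x s - x u\<bar> < \<delta>2"
      using near_right[OF \<delta>2(1)] by blast
    let ?d = "min (min d1 \<delta>1) (min d2 \<delta>2)"
    show ?case
      unfolding P_def
    proof (rule exI[of _ ?d], intro conjI allI impI)
      show "0 < ?d" using \<delta>1 \<delta>2 d1 d2 by simp
      fix a b assume "a \<le> u \<and> u \<le> b \<and> b - a < ?d" and ab: "0 \<le> a" "b \<le> T"
      then have u: "a \<le> u" "u \<le> b" "u - a < d1" "u - a < \<delta>1" "b - u < d2" "b - u < \<delta>2" by auto
      have "close_on \<eta> a u"
      proof (cases "a = u")
        case False
        show ?thesis
        proof (rule close_on_small_oscillation[where c = "left_lim x u" and \<delta> = \<delta>1])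
          show "\<bar>H s p - H u (left_lim x u)\<bar> \<le> \<eta> \<and>
              \<bar>G s p r - H u (left_lim x u) * (r - p)\<^sup>2\<bar> \<le> \<eta> * (r - p)\<^sup>2"
            if "a < s" "s \<le> u" "\<bar>p - left_lim x u\<bar> \<le> \<delta>1" "\<bar>r - left_lim x u\<bar> \<le> \<delta>1" for s p r
            using that u ab by (intro \<delta>1(2)) auto
          show "\<bar>x s - left_lim x u\<bar> \<le> \<delta>1" if "a < s" "s < u" for s
            using that u by (intro less_imp_le d1(2)) auto
        qed (use u ab False assms in auto)
      qed (simp add: close_on_refl)
      moreover have "close_on \<eta> u b"
      proof (cases "u = b")
        case False
        show ?thesis
        proof (rule close_on_small_oscillation[where c = "x u" and \<delta> = \<delta>2])
          show "\<bar>H s p - H u (x u)\<bar> \<le> \<eta> \<and> \<bar>G s p r - H u (x u) * (r - p)\<^sup>2\<bar> \<le> \<eta> * (r - p)\<^sup>2"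
            if "u < s" "s \<le> b" "\<bar>p - x u\<bar> \<le> \<delta>2" "\<bar>r - x u\<bar> \<le> \<delta>2" for s p r
            using that u ab by (intro \<delta>2(2)) auto
          show "\<bar>x s - x u\<bar> \<le> \<delta>2" if "u < s" "s < b" for s
            using that u by (intro less_imp_le d2(2)) auto
        qed (use u ab False assms in auto)
      qed (simp add: close_on_refl)
      ultimately show "close_on \<eta> a b"
        using close_on_trans[of a u b] u ab by simp
    qed
  qed
  then show ?thesis by (simp add: P_def)
qed

text \<open>The total error is proportional to \<open>q T - q 0\<close> with an arbitrarily small factor.\<close>

theorem quadratic_remainder_limit:
  "uniform_limit {0..T} (\<lambda>n t. incr_avg (e n) x G 0 T t)
    (\<lambda>t. (LINT s:{0<..t}|\<mu>. H s (left_lim x s)) + (\<Sum>\<^sub>\<infinity>s\<in>{0<..t}. jump_term s)) sequentially"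
proof (rule uniform_limitI)
  fix \<kappa> :: real assume "0 < \<kappa>"
  have q: "0 \<le> q T - q 0" using q_mono[of 0 T] T_pos by simp
  define \<eta> where "\<eta> = \<kappa> / (4 * (q T - q 0 + 1))"
  have \<eta>: "0 < \<eta>" "2 * \<eta> * (q T - q 0) \<le> \<kappa> / 2"
    using q \<open>0 < \<kappa>\<close> by (auto simp: \<eta>_def field_simps)
  have "0 < \<kappa> / 4" using \<open>0 < \<kappa>\<close> by simp
  then have "\<forall>\<^sub>F n in sequentially. \<forall>t\<in>{0..T}.
     \<bar>incr_avg (e n) x G 0 T t - limit_functional 0 T t\<bar> \<le> 2 * \<eta> * (q T - q 0) + \<kappa> / 4"
    using close_on_all[OF \<eta>(1)] unfolding close_on_def by blast
  then show "\<forall>\<^sub>F n in sequentially. \<forall>t\<in>{0..T}. dist (incr_avg (e n) x G 0 T t)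
      ((LINT s:{0<..t}|\<mu>. H s (left_lim x s)) + (\<Sum>\<^sub>\<infinity>s\<in>{0<..t}. jump_term s)) < \<kappa>"
  proof eventually_elim
    case (elim n)
    show ?case
    proof
      fix t assume t: "t \<in> {0..T}"
      then have "min T t = t" by simp
      then show "dist (incr_avg (e n) x G 0 T t)
          ((LINT s:{0<..t}|\<mu>. H s (left_lim x s)) + (\<Sum>\<^sub>\<infinity>s\<in>{0<..t}. jump_term s)) < \<kappa>"
        using bspec[OF elim t] \<eta>(2) \<open>0 < \<kappa>\<close> by (simp add: limit_functional_def dist_real_def)
    qed
  qed
qed

end

section \<open>The pathwise Ito formula\<close>

lemma continuous_on_clip_pair:
  assumes "continuous_on ({0..T} \<times> UNIV) (\<lambda>(s, p). f s p)" "0 \<le> T"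
  shows "continuous_on UNIV (\<lambda>w. f (clip T (fst w)) (snd w))"
proof -
  have "continuous_on UNIV (\<lambda>w. (\<lambda>(s, p). f s p) (clip T (fst w), snd w))"
    by (rule continuous_on_compose2[OF assms(1)]) (use assms(2) in \<open>auto intro!: continuous_intros\<close>)
  then show ?thesis by simp
qed

lemma continuous3_of_pair:
  assumes "continuous_on ({0..T} \<times> UNIV) (\<lambda>(s, p). f s p)"
  shows "continuous3 T (\<lambda>s p r. f s p)" "continuous3 T (\<lambda>s p r. f s r)"
proof -
  have "continuous_on ({0..T} \<times> UNIV \<times> UNIV) (\<lambda>w. (\<lambda>(s, p). f s p) (fst w, fst (snd w)))"
    "continuous_on ({0..T} \<times> UNIV \<times> UNIV) (\<lambda>w. (\<lambda>(s, p). f s p) (fst w, snd (snd w)))"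
    by (rule continuous_on_compose2[OF assms]; auto intro!: continuous_intros)+
  then show "continuous3 T (\<lambda>s p r. f s p)" "continuous3 T (\<lambda>s p r. f s r)"
    by (simp_all add: continuous3_def case_prod_beta)
qed

text \<open>The averaged increments telescope: shifting the integration variable by \<open>\<epsilon>\<close> leaves the
  average of \<open>\<phi>\<close> over the final window, where the shifted path is frozen at \<open>\<phi> t\<close>, minus the average over the
  initial window.\<close>

lemma average_increment:
  fixes \<phi> :: "real \<Rightarrow> real"
  assumes [measurable]: "\<phi> \<in> borel_measurable borel"
    and bound: "\<And>s. 0 \<le> s \<Longrightarrow> s \<le> t \<Longrightarrow> \<bar>\<phi> s\<bar> \<le> C" and "0 \<le> t" "0 < \<epsilon>"
  shows "(LINT s:{0<..t}|lborel. (\<phi> (min (s + \<epsilon>) t) - \<phi> s) / \<epsilon>)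
    = \<phi> t - (LINT s:{0<..\<epsilon>}|lborel. \<phi> (min s t) / \<epsilon>)"
proof -
  let ?\<psi> = "\<lambda>s. \<phi> (min s t)"
  have int: "set_integrable lborel {a<..b} ?\<psi>" if "0 \<le> a" for a b
    by (rule set_integrable_bounded_Ioc[where C = C]) (use that \<open>0 \<le> t\<close> in \<open>auto intro!: bound\<close>)
  have "(LINT s:{0<..t}|lborel. \<phi> (min (s + \<epsilon>) t)) = (LINT s:{\<epsilon><..t + \<epsilon>}|lborel. ?\<psi> s)"
  proof -
    have "(LINT s:{\<epsilon><..t + \<epsilon>}|lborel. ?\<psi> s)
        = (LINT s|lborel. indicator {\<epsilon><..t + \<epsilon>} (\<epsilon> + 1 * s) *\<^sub>R ?\<psi> (\<epsilon> + 1 * s))"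
      unfolding set_lebesgue_integral_def
      using lborel_integral_real_affine[of 1 "\<lambda>s. indicator {\<epsilon><..t + \<epsilon>} s *\<^sub>R ?\<psi> s" \<epsilon>] by simp
    also have "\<dots> = (LINT s:{0<..t}|lborel. \<phi> (min (s + \<epsilon>) t))"
      unfolding set_lebesgue_integral_def
      by (intro Bochner_Integration.integral_cong) (auto simp: indicator_def add.commute)
    finally show ?thesis by simp
  qed
  moreover have "(LINT s:{0<..t + \<epsilon>}|lborel. ?\<psi> s)
      = (LINT s:{0<..\<epsilon>}|lborel. ?\<psi> s) + (LINT s:{\<epsilon><..t + \<epsilon>}|lborel. ?\<psi> s)"
  proof -
    have "{0<..t + \<epsilon>} = {0<..\<epsilon>} \<union> {\<epsilon><..t + \<epsilon>}" using assms by auto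
    then show ?thesis using \<open>0 < \<epsilon>\<close> int by (simp add: set_integral_Un)
  qed
  moreover have "(LINT s:{0<..t + \<epsilon>}|lborel. ?\<psi> s)
      = (LINT s:{0<..t}|lborel. ?\<psi> s) + (LINT s:{t<..t + \<epsilon>}|lborel. ?\<psi> s)"
  proof -
    have "{0<..t + \<epsilon>} = {0<..t} \<union> {t<..t + \<epsilon>}" using assms by auto
    then show ?thesis using \<open>0 \<le> t\<close> int by (simp add: set_integral_Un)
  qed
  moreover have "(LINT s:{t<..t + \<epsilon>}|lborel. ?\<psi> s) = (LINT s:{t<..t + \<epsilon>}|lborel. \<phi> t)"
    by (intro set_lebesgue_integral_cong) (auto simp: min_absorb2)
  moreover have "\<dots> = \<epsilon> * \<phi> t"
    using \<open>0 < \<epsilon>\<close> by (simp add: set_lebesgue_integral_def)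
  moreover have "(LINT s:{0<..t}|lborel. ?\<psi> s) = (LINT s:{0<..t}|lborel. \<phi> s)"
    by (intro set_lebesgue_integral_cong) (auto simp: min_absorb1)
  moreover have "(LINT s:{0<..t}|lborel. \<phi> (min (s + \<epsilon>) t) - \<phi> s)
      = (LINT s:{0<..t}|lborel. \<phi> (min (s + \<epsilon>) t)) - (LINT s:{0<..t}|lborel. \<phi> s)"
    by (rule set_integral_diff(2); rule set_integrable_bounded_Ioc[where C = C])
       (use assms in \<open>auto intro!: bound\<close>)
  ultimately have "(LINT s:{0<..t}|lborel. \<phi> (min (s + \<epsilon>) t) - \<phi> s)
      = \<epsilon> * \<phi> t - (LINT s:{0<..\<epsilon>}|lborel. ?\<psi> s)"
    by linarith
  then show ?thesis
    unfolding set_integral_divide_zero using \<open>0 < \<epsilon>\<close> by (simp add: diff_divide_distrib)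
qed

locale ito_path = quadratic_variation_path +
  fixes F :: "real \<Rightarrow> real \<Rightarrow> real"
  assumes C12: "C12 T F"
begin

lemma F_continuous: "continuous_on ({0..T} \<times> UNIV) (\<lambda>(s, p). F s p)"
  and dt_continuous: "continuous_on ({0..T} \<times> UNIV) (\<lambda>(s, p). dt T F s p)"
  and dx_continuous: "continuous_on ({0..T} \<times> UNIV) (\<lambda>(s, p). dx F s p)"
  and dxx_continuous: "continuous_on ({0..T} \<times> UNIV) (\<lambda>(s, p). dxx F s p)"
  using C12 by (simp_all add: C12_def)

lemma has_dx: "0 \<le> s \<Longrightarrow> s \<le> T \<Longrightarrow> (F s has_real_derivative dx F s p) (at p)"
  using C12 by (simp add: C12_def dx_def DERIV_deriv_iff_real_differentiable)

lemma has_dxx: "0 \<le> s \<Longrightarrow> s \<le> T \<Longrightarrow> (dx F s has_real_derivative dxx F s p) (at p)"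
  using C12 unfolding C12_def dxx_def
  by (subst dx_def) (simp add: DERIV_deriv_iff_real_differentiable)

lemma has_dt:
  "0 \<le> s \<Longrightarrow> s \<le> T \<Longrightarrow> ((\<lambda>s. F s p) has_real_derivative dt T F s p) (at s within {0..T})"
  using C12 unfolding C12_def dt_def has_real_derivative_iff_has_vector_derivative
  by (simp add: vector_derivative_works)

lemma taylor_remainder:
  assumes "0 \<le> s" "s \<le> T"
  shows "\<exists>\<xi>\<in>closed_segment p r.
    F s r - F s p - dx F s p * (r - p) = dxx F s \<xi> / 2 * (r - p)\<^sup>2"
proof (cases "p = r")
  case False
  let ?d = "\<lambda>m :: nat. if m = 0 then F s else if m = 1 then dx F s else dxx F s"
  have "\<exists>\<xi>. (if r < p then r < \<xi> \<and> \<xi> < p else p < \<xi> \<and> \<xi> < r) \<and>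
      F s r = (\<Sum>m<2. ?d m p / fact m * (r - p) ^ m) + ?d 2 \<xi> / fact 2 * (r - p) ^ 2"
  proof (rule Taylor[where a = "min p r" and b = "max p r"])
    show "\<forall>m t. m < 2 \<and> min p r \<le> t \<and> t \<le> max p r \<longrightarrow> DERIV (?d m) t :> ?d (Suc m) t"
      using has_dx[OF assms] has_dxx[OF assms] by (auto simp: less_2_cases_iff)
  qed (use False in auto)
  then obtain \<xi> where "if r < p then r < \<xi> \<and> \<xi> < p else p < \<xi> \<and> \<xi> < r"
    "F s r = F s p + dx F s p * (r - p) + dxx F s \<xi> / 2 * (r - p)\<^sup>2"
    by (auto simp: numeral_2_eq_2)
  then show ?thesis
    by (intro bexI[of _ \<xi>]) (auto simp: closed_segment_eq_real_ivl split: if_splits)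
qed auto

sublocale quadratic_remainder T x B e q
  "\<lambda>s p r. F s r - F s p - dx F s p * (r - p)" "\<lambda>s p. dxx F s p / 2"
proof unfold_locales
  show "continuous3 T (\<lambda>s p r. F s r - F s p - dx F s p * (r - p))"
    using continuous3_of_pair[OF F_continuous] continuous3_of_pair[OF dx_continuous]
    unfolding continuous3_def case_prod_beta by (intro continuous_intros)
  show "continuous_on ({0..T} \<times> UNIV) (\<lambda>(s, p). dxx F s p / 2)"
    using dxx_continuous unfolding case_prod_beta by (intro continuous_intros) auto
qed (rule taylor_remainder)

lemma time_mean_value:
  assumes "0 \<le> s" "s < r" "r \<le> T"
  shows "\<exists>\<xi>\<in>{s<..<r}. F r p - F s p = dt T F \<xi> p * (r - s)"
proof -
  have "((\<lambda>s. F s p) has_derivative (*) (dt T F z p)) (at z within {s..r})" if "s \<le> z" "z \<le> r" for z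
    using has_dt[of z p] that assms
    by (auto simp: has_field_derivative_def intro: has_derivative_subset)
  then show ?thesis
    using mvt_simple[OF \<open>s < r\<close>, of "\<lambda>s. F s p" "\<lambda>z. (*) (dt T F z p)"] by blast
qed

lemma path_at_right:
  fixes f :: "real \<Rightarrow> real \<Rightarrow> real"
  assumes "continuous_on ({0..T} \<times> UNIV) (\<lambda>(s, p). f s p)"
  shows "((\<lambda>s. f (clip T s) (x s)) \<longlongrightarrow> f (clip T u) (x u)) (at_right u)"
proof -
  have "isCont (\<lambda>w. f (clip T (fst w)) (snd w)) (u, x u)"
    using continuous_on_clip_pair[OF assms] T_pos by (simp add: continuous_on_eq_continuous_at)
  then have "((\<lambda>s. (\<lambda>w. f (clip T (fst w)) (snd w)) (s, x s)) \<longlongrightarrow>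
      (\<lambda>w. f (clip T (fst w)) (snd w)) (u, x u)) (at_right u)"
    by (rule isCont_tendsto_compose) (intro tendsto_intros cadlag_at_right cadlag)
  then show ?thesis by simp
qed

lemma path_measurable:
  fixes f :: "real \<Rightarrow> real \<Rightarrow> real"
  assumes "continuous_on ({0..T} \<times> UNIV) (\<lambda>(s, p). f s p)"
  shows "(\<lambda>s. f (clip T s) (x s)) \<in> borel_measurable borel"
  using continuous3_measurable[OF continuous3_of_pair(1)[OF assms], of id borel x x] T_pos
  by (simp add: id_def)

lemma path_bounded:
  fixes f :: "real \<Rightarrow> real \<Rightarrow> real"
  assumes "continuous_on ({0..T} \<times> UNIV) (\<lambda>(s, p). f s p)"
  obtains C where "0 \<le> C" "\<And>s p. 0 \<le> s \<Longrightarrow> s \<le> T \<Longrightarrow> \<bar>p\<bar> \<le> B \<Longrightarrow> \<bar>f s p\<bar> \<le> C"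
proof -
  obtain C where C: "\<forall>s\<in>{0..T}. \<forall>p\<in>{- B..B}. \<forall>r\<in>{- B..B}. \<bar>f s p\<bar> \<le> C"
    using continuous3_bounded[OF continuous3_of_pair(1)[OF assms]] by blast
  then have C': "\<bar>f s p\<bar> \<le> C" if "0 \<le> s" "s \<le> T" "\<bar>p\<bar> \<le> B" for s p
    using that by (auto simp: abs_le_iff)
  moreover have "0 \<le> C"
    using order_trans[OF abs_ge_zero C'[of 0 "x 0"]] bounded[of 0] T_pos by simp
  ultimately show ?thesis using that by blast
qed

lemma path_integrable:
  fixes f :: "real \<Rightarrow> real \<Rightarrow> real"
  assumes "continuous_on ({0..T} \<times> UNIV) (\<lambda>(s, p). f s p)" "0 \<le> a" "b \<le> T"
  shows "set_integrable lborel {a<..b} (\<lambda>s. f s (x s))"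
proof (rule set_integrable_continuous3[OF continuous3_of_pair(1)[OF assms(1)] T_pos assms(2,3)
      x_measurable x_measurable])
  show "\<bar>x s\<bar> \<le> B" "\<bar>x s\<bar> \<le> B" if "a < s" "s \<le> b" for s
    using that assms(2,3) by (auto intro!: bounded)
qed

lemma total_increment_limit:
  "uniform_limit {0..T}
    (\<lambda>n t. LINT s:{0<..t}|lborel. (F (min (s + e n) t) (x (min (s + e n) t)) - F s (x s)) / e n)
    (\<lambda>t. F t (x t) - F 0 (x 0)) sequentially"
proof (rule uniform_limitI)
  fix \<kappa> :: real assume "0 < \<kappa>"
  let ?\<phi> = "\<lambda>s. F (clip T s) (x s)"
  note [measurable] = path_measurable[OF F_continuous]
  obtain C where C: "\<And>s p. 0 \<le> s \<Longrightarrow> s \<le> T \<Longrightarrow> \<bar>p\<bar> \<le> B \<Longrightarrow> \<bar>F s p\<bar> \<le> C"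
    by (rule path_bounded[OF F_continuous]) blast
  have bound: "\<bar>?\<phi> s\<bar> \<le> C" if "0 \<le> s" "s \<le> T" for s
    using that bounded[of s] by (intro C) auto
  have "\<forall>\<^sub>F s in at_right 0. dist (?\<phi> s) (?\<phi> 0) < \<kappa> / 2"
    using tendstoD[OF path_at_right[OF F_continuous, of 0], of "\<kappa> / 2"] \<open>0 < \<kappa>\<close> by simp
  then obtain d where d: "0 < d" "\<And>s. 0 < s \<Longrightarrow> s < d \<Longrightarrow> \<bar>?\<phi> s - ?\<phi> 0\<bar> < \<kappa> / 2"
    by (auto simp: eventually_at_right_field dist_real_def)
  from eventually_e_less[OF d(1)]
  show "\<forall>\<^sub>F n in sequentially. \<forall>t\<in>{0..T}. dist
      (LINT s:{0<..t}|lborel. (F (min (s + e n) t) (x (min (s + e n) t)) - F s (x s)) / e n)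
      (F t (x t) - F 0 (x 0)) < \<kappa>"
  proof eventually_elim
    case (elim n)
    show ?case
    proof
      fix t assume t: "t \<in> {0..T}"
      have "(LINT s:{0<..t}|lborel. (F (min (s + e n) t) (x (min (s + e n) t)) - F s (x s)) / e n)
          = (LINT s:{0<..t}|lborel. (?\<phi> (min (s + e n) t) - ?\<phi> s) / e n)"
        using t e_pos[of n] by (intro set_lebesgue_integral_cong) auto
      also have "\<dots> = ?\<phi> t - (LINT s:{0<..e n}|lborel. ?\<phi> (min s t) / e n)"
        by (rule average_increment[where C = C]) (use t e_pos bound in auto)
      finally have eq: "(LINT s:{0<..t}|lborel. (F (min (s + e n) t) (x (min (s + e n) t)) - F s (x s)) / e n)
          = F t (x t) - (LINT s:{0<..e n}|lborel. ?\<phi> (min s t) / e n)"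
        using t by simp
      have "\<bar>(LINT s:{0<..e n}|lborel. ?\<phi> (min s t) / e n) - F 0 (x 0)\<bar>
          \<le> (LINT s:{0<..e n}|lborel. 0 / e n) + \<kappa> / 2"
      proof (rule set_integral_tail_limit_bound)
        show "set_integrable lborel {0<..e n} (\<lambda>s. ?\<phi> (min s t))"
          by (rule set_integrable_bounded_Ioc[where C = C]) (use t in \<open>auto intro!: bound\<close>)
        show "set_integrable lborel {0<..e n} (\<lambda>s. 0 :: real)"
          by (simp add: set_integrable_def)
        fix s assume s: "0 < s" "s < e n"
        have "\<bar>?\<phi> (min s t) - ?\<phi> 0\<bar> \<le> \<kappa> / 2"
        proof (cases "t = 0")
          case False
          have "0 < min s t" "min s t < d" using False s elim t by auto
          then show ?thesis by (intro less_imp_le d(2))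
        qed (use s \<open>0 < \<kappa>\<close> in auto)
        then show "\<bar>?\<phi> (min s t) - (if e n - e n \<le> s then F 0 (x 0) else 0)\<bar>
            \<le> 0 + (if e n - e n \<le> s then \<kappa> / 2 else 0)"
          using s T_pos by simp
      qed (use e_pos \<open>0 < \<kappa>\<close> in auto)
      then have "\<bar>(LINT s:{0<..e n}|lborel. ?\<phi> (min s t) / e n) - F 0 (x 0)\<bar> < \<kappa>"
        using \<open>0 < \<kappa>\<close> by (simp del: set_integral_divide_zero)
      then show "dist (LINT s:{0<..t}|lborel. (F (min (s + e n) t) (x (min (s + e n) t)) - F s (x s)) / e n)
          (F t (x t) - F 0 (x 0)) < \<kappa>"
        unfolding eq dist_real_def by linarith
    qed
  qed
qed

lemma F_composite_integrable:
  fixes y z :: "real \<Rightarrow> real"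
  assumes "y \<in> borel_measurable borel" "z \<in> borel_measurable borel"
    "\<And>s. 0 < s \<Longrightarrow> s \<le> t \<Longrightarrow> 0 \<le> y s \<and> y s \<le> T \<and> \<bar>z s\<bar> \<le> B"
  shows "set_integrable lborel {0<..t} (\<lambda>s. F (y s) (z s))"
proof -
  obtain C where C: "\<And>s p. 0 \<le> s \<Longrightarrow> s \<le> T \<Longrightarrow> \<bar>p\<bar> \<le> B \<Longrightarrow> \<bar>F s p\<bar> \<le> C"
    by (rule path_bounded[OF F_continuous]) blast
  have "set_integrable lborel {0<..t} (\<lambda>s. F (clip T (y s)) (z s))"
  proof (rule set_integrable_bounded_Ioc)
    show "(\<lambda>s. F (clip T (y s)) (z s)) \<in> borel_measurable borel"
      using continuous3_measurable[OF continuous3_of_pair(1)[OF F_continuous] _ assms(1,2,2)] T_pos by simp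
    show "\<bar>F (clip T (y s)) (z s)\<bar> \<le> C" if "0 < s" "s \<le> t" for s
      using assms(3)[OF that] by (intro C) auto
  qed
  moreover have "set_integrable lborel {0<..t} (\<lambda>s. F (clip T (y s)) (z s))
      = set_integrable lborel {0<..t} (\<lambda>s. F (y s) (z s))"
    using assms(3) by (intro set_integrable_cong refl) simp
  ultimately show ?thesis by blast
qed

text \<open>By the mean value theorem the difference quotient in time is a value of the time derivative at a
  nearby time and at \<open>x (s + e n)\<close>, which converges for every \<open>s < T\<close> by right-continuity. To obtain
  uniformity in \<open>t\<close>, the difference \<open>D n s\<close> is formed without the cutoff at \<open>t\<close>; the cutoff matters on the
  final window only, where both quotients are bounded by the Lipschitz constant in time.\<close>

lemma time_increment_limit:
  "uniform_limit {0..T}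
    (\<lambda>n t. LINT s:{0<..t}|lborel. (F (min (s + e n) t) (x (min (s + e n) t)) - F s (x (min (s + e n) t))) / e n)
    (\<lambda>t. LINT s:{0<..t}|lborel. dt T F s (x s)) sequentially"
proof (rule uniform_limitI)
  fix \<kappa> :: real assume "0 < \<kappa>"
  obtain C where C: "0 \<le> C" "\<And>s p. 0 \<le> s \<Longrightarrow> s \<le> T \<Longrightarrow> \<bar>p\<bar> \<le> B \<Longrightarrow> \<bar>dt T F s p\<bar> \<le> C"
    by (rule path_bounded[OF dt_continuous]) blast
  have lip: "\<bar>F r p - F s p\<bar> \<le> C * (r - s)" if sr: "0 \<le> s" "s \<le> r" "r \<le> T" "\<bar>p\<bar> \<le> B" for s r p
  proof (cases "s = r")
    case False
    then obtain \<xi> where "\<xi> \<in> {s<..<r}" "F r p - F s p = dt T F \<xi> p * (r - s)"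
      using time_mean_value[of s r p] sr by auto
    then show ?thesis using C(2)[of \<xi> p] sr by (simp add: abs_mult mult_right_mono)
  qed simp
  define y where "y n s = x (min (s + e n) T)" for n s
  define D where "D n s = (F (min (s + e n) T) (y n s) - F s (y n s)) / e n - dt T F s (x s)" for n s
  have y_bound: "\<bar>y n s\<bar> \<le> B" if "0 \<le> s" for n s
    using that T_pos e_pos[of n] by (auto simp: y_def intro!: bounded)
  have y_meas [measurable]: "y n \<in> borel_measurable borel" for n
    unfolding y_def by measurable
  have D_int: "set_integrable lborel {0<..T} (D n)" for n
    unfolding D_def
    by (intro set_integral_diff(1) set_integrable_divide F_composite_integrable path_integrable dt_continuous)
       (use e_pos[of n] in \<open>auto intro!: y_bound\<close>)
  have D_bound: "\<bar>D n s\<bar> \<le> 2 * C" if "0 < s" "s \<le> T" for n s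
  proof -
    have "\<bar>F (min (s + e n) T) (y n s) - F s (y n s)\<bar> \<le> C * (min (s + e n) T - s)"
      using that e_pos[of n] by (intro lip y_bound) auto
    also have "\<dots> \<le> C * e n"
      using C(1) by (intro mult_left_mono) auto
    finally have "\<bar>(F (min (s + e n) T) (y n s) - F s (y n s)) / e n\<bar> \<le> C"
      using e_pos[of n] by (simp add: pos_divide_le_eq)
    moreover have "\<bar>dt T F s (x s)\<bar> \<le> C"
      using that bounded[of s] by (intro C) auto
    ultimately show ?thesis unfolding D_def by linarith
  qed
  have D_lim: "(\<lambda>n. D n s) \<longlonglongrightarrow> 0" if s: "0 < s" "s < T" for s
  proof (rule LIMSEQ_I)
    fix r :: real assume "0 < r"
    obtain d where d: "0 < d" "\<And>s' p. s' \<in> {0..T} \<Longrightarrow> \<bar>s' - s\<bar> < d \<Longrightarrow> \<bar>p - x s\<bar> < d \<Longrightarrow>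
        \<bar>dt T F s' p - dt T F s (x s)\<bar> < r"
      using continuous3_near[OF continuous3_of_pair(1)[OF dt_continuous] _ \<open>0 < r\<close>, of s "x s" 0] s
      by (metis atLeastAtMost_iff diff_0_right abs_zero less_imp_le)
    obtain d' where d': "0 < d'" "\<And>r. s \<le> r \<Longrightarrow> r < s + d' \<Longrightarrow> \<bar>x r - x s\<bar> < d"
      using near_right[OF d(1)] by blast
    have "0 < min (min d d') (T - s)" using d(1) d'(1) s by simp
    from eventually_e_less[OF this]
    have "\<forall>\<^sub>F n in sequentially. norm (D n s - 0) < r"
    proof eventually_elim
      case (elim n)
      have m: "min (s + e n) T = s + e n" using elim by simp
      obtain \<xi> where \<xi>: "\<xi> \<in> {s<..<s + e n}" "F (s + e n) (y n s) - F s (y n s) = dt T F \<xi> (y n s) * e n"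
        using time_mean_value[of s "s + e n" "y n s"] elim s e_pos[of n] by auto
      have "D n s = dt T F \<xi> (y n s) - dt T F s (x s)"
        using \<xi>(2) e_pos[of n] by (simp add: D_def m)
      moreover have "\<bar>dt T F \<xi> (y n s) - dt T F s (x s)\<bar> < r"
      proof (rule d(2))
        show "\<bar>y n s - x s\<bar> < d"
          unfolding y_def m using elim e_pos[of n] by (intro d'(2)) auto
      qed (use \<xi>(1) elim s in auto)
      ultimately show ?case by simp
    qed
    then show "\<exists>no. \<forall>n\<ge>no. norm (D n s - 0) < r"
      by (simp add: eventually_sequentially)
  qed
  have D_abs_int: "set_integrable lborel {0<..T} (\<lambda>s. \<bar>D n s\<bar>)" for n
    by (rule set_integrable_abs[OF D_int])
  have "(\<lambda>n. LINT s:{0<..T}|lborel. \<bar>D n s\<bar>) \<longlonglongrightarrow> integral\<^sup>L lborel (\<lambda>s :: real. 0 :: real)"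
    unfolding set_lebesgue_integral_def
  proof (rule integral_dominated_convergence[where w = "\<lambda>s. indicator {0<..T} s * (2 * C)"])
    show "(\<lambda>s. indicator {0<..T} s *\<^sub>R \<bar>D n s\<bar>) \<in> borel_measurable lborel" for n
      using D_abs_int[of n] unfolding set_integrable_def by (rule borel_measurable_integrable)
    show "integrable lborel (\<lambda>s. indicator {0<..T} s * (2 * C))"
      using T_pos by simp
    show "AE s in lborel. norm (indicator {0<..T} s *\<^sub>R \<bar>D n s\<bar>) \<le> indicator {0<..T} s * (2 * C)" for n
      using D_bound[of _ n] by (intro AE_I2) (auto simp: indicator_def)
    show "AE s in lborel. (\<lambda>n. indicator {0<..T} s *\<^sub>R \<bar>D n s\<bar>) \<longlonglongrightarrow> 0"
      using AE_lborel_singleton[of T]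
    proof eventually_elim
      case (elim s)
      show ?case
      proof (cases "0 < s \<and> s < T")
        case True
        then show ?thesis
          using tendsto_rabs[OF D_lim[of s]] by simp
      next
        case False
        then have "s \<notin> {0<..T}" using elim by auto
        then show ?thesis by simp
      qed
    qed
  qed simp
  then have "(\<lambda>n. (LINT s:{0<..T}|lborel. \<bar>D n s\<bar>) + 2 * C * e n) \<longlonglongrightarrow> 0 + 2 * C * 0"
    by (intro tendsto_intros e_lim) simp
  then have "\<forall>\<^sub>F n in sequentially. (LINT s:{0<..T}|lborel. \<bar>D n s\<bar>) + 2 * C * e n < \<kappa>"
    using \<open>0 < \<kappa>\<close> by (intro order_tendstoD(2)) auto
  then show "\<forall>\<^sub>F n in sequentially. \<forall>t\<in>{0..T}. dist
      (LINT s:{0<..t}|lborel. (F (min (s + e n) t) (x (min (s + e n) t)) - F s (x (min (s + e n) t))) / e n)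
      (LINT s:{0<..t}|lborel. dt T F s (x s)) < \<kappa>"
  proof eventually_elim
    case (elim n)
    show ?case
    proof
      fix t assume t: "t \<in> {0..T}"
      let ?f = "\<lambda>s. F (min (s + e n) t) (x (min (s + e n) t)) - F s (x (min (s + e n) t))"
      let ?d = "\<lambda>s. dt T F s (x s)"
      have f_int: "set_integrable lborel {0<..t} ?f"
        by (intro set_integral_diff(1) F_composite_integrable)
           (use e_pos[of n] t in \<open>auto intro!: bounded\<close>)
      have d_int: "set_integrable lborel {0<..t} ?d"
        using t by (intro path_integrable dt_continuous) auto
      have D_int': "set_integrable lborel {0<..t} (\<lambda>s. \<bar>D n s\<bar>)"
        using t by (intro set_integrable_subset[OF D_abs_int]) auto
      have "\<bar>LINT s:{0<..t}|lborel. (?f s - e n * ?d s) / e n\<bar>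
          \<le> (LINT s:{0<..t}|lborel. e n * \<bar>D n s\<bar> / e n) + 2 * C * e n"
      proof (rule set_integral_tail_bound)
        fix s assume s: "0 < s" "s < t"
        show "\<bar>?f s - e n * ?d s\<bar> \<le> e n * \<bar>D n s\<bar> + (if t - e n \<le> s then 2 * C * e n else 0)"
        proof (cases "t - e n \<le> s")
          case True
          have r: "s \<le> min (s + e n) t" "min (s + e n) t \<le> T" using e_pos[of n] s t by auto
          have "\<bar>?f s\<bar> \<le> C * (min (s + e n) t - s)"
            using s r by (intro lip bounded) auto
          also have "\<dots> \<le> C * e n"
            using C(1) by (intro mult_left_mono) auto
          finally have "\<bar>?f s\<bar> \<le> C * e n" .
          moreover have "\<bar>e n * ?d s\<bar> \<le> C * e n"
            using C(2)[of s "x s"] bounded[of s] s t e_pos[of n]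
            by (simp add: abs_mult mult.commute mult_right_mono)
          moreover have "0 \<le> e n * \<bar>D n s\<bar>" using e_pos[of n] by simp
          ultimately show ?thesis using True by simp
        next
          case False
          then have "min (s + e n) t = s + e n" "min (s + e n) T = s + e n" using t by auto
          then have "?f s - e n * ?d s = e n * D n s"
            using e_pos[of n] by (simp add: D_def y_def field_simps)
          then show ?thesis using False e_pos[of n] by (simp add: abs_mult)
        qed
      next
        show "set_integrable lborel {0<..t} (\<lambda>s. ?f s - e n * ?d s)"
          by (intro set_integral_diff(1) f_int set_integrable_mult_right d_int)
        show "set_integrable lborel {0<..t} (\<lambda>s. e n * \<bar>D n s\<bar>)"
          by (intro set_integrable_mult_right D_int')
      qed (use e_pos[of n] C(1) in auto)
      also have "(LINT s:{0<..t}|lborel. e n * \<bar>D n s\<bar> / e n) = (LINT s:{0<..t}|lborel. \<bar>D n s\<bar>)"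
        using e_pos[of n] by simp
      also have "\<dots> \<le> (LINT s:{0<..T}|lborel. \<bar>D n s\<bar>)"
        unfolding set_lebesgue_integral_def
        using D_abs_int[of n] D_int' t unfolding set_integrable_def
        by (intro integral_mono) (auto simp: indicator_def)
      finally have "\<bar>LINT s:{0<..t}|lborel. (?f s - e n * ?d s) / e n\<bar> < \<kappa>"
        using elim by simp
      moreover have "(LINT s:{0<..t}|lborel. (?f s - e n * ?d s) / e n)
          = (LINT s:{0<..t}|lborel. ?f s / e n) - (LINT s:{0<..t}|lborel. ?d s)"
      proof -
        have "(\<lambda>s. (?f s - e n * ?d s) / e n) = (\<lambda>s. ?f s / e n - ?d s)"
          using e_pos[of n] by (auto simp: diff_divide_distrib)
        then show ?thesis
          using set_integral_diff(2)[OF set_integrable_divide[OF f_int, of "e n"] d_int] by simp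
      qed
      ultimately show "dist (LINT s:{0<..t}|lborel. ?f s / e n) (LINT s:{0<..t}|lborel. ?d s) < \<kappa>"
        unfolding dist_real_def by (simp del: set_integral_divide_zero)
    qed
  qed
qed

lemma forward_decomposition:
  assumes "0 \<le> t" "t \<le> T"
  shows "incr_avg (e n) x (\<lambda>s p r. dx F s p * (r - p)) 0 T t
    = (LINT s:{0<..t}|lborel. (F (min (s + e n) t) (x (min (s + e n) t)) - F s (x s)) / e n)
    - (LINT s:{0<..t}|lborel. (F (min (s + e n) t) (x (min (s + e n) t)) - F s (x (min (s + e n) t))) / e n)
    - incr_avg (e n) x (\<lambda>s p r. F s r - F s p - dx F s p * (r - p)) 0 T t"
proof -
  let ?r = "\<lambda>s. min (s + e n) t"
  let ?a = "\<lambda>s. (F (?r s) (x (?r s)) - F s (x s)) / e n"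
  let ?b = "\<lambda>s. (F (?r s) (x (?r s)) - F s (x (?r s))) / e n"
  let ?g = "\<lambda>s. (F s (x (?r s)) - F s (x s) - dx F s (x s) * (x (?r s) - x s)) / e n"
  have a: "set_integrable lborel {0<..t} ?a"
    by (intro set_integrable_divide set_integral_diff(1) F_composite_integrable)
       (use e_pos[of n] assms in \<open>auto intro!: bounded\<close>)
  have b: "set_integrable lborel {0<..t} ?b"
    by (intro set_integrable_divide set_integral_diff(1) F_composite_integrable)
       (use e_pos[of n] assms in \<open>auto intro!: bounded\<close>)
  have g: "set_integrable lborel {0<..t} ?g"
    using e_pos[of n] assms
    by (intro set_integrable_divide incr_integrable[OF G_continuous]) auto
  have "(\<lambda>s. dx F s (x s) * (x (?r s) - x s) / e n) = (\<lambda>s. ?a s - ?b s - ?g s)"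
    using e_pos[of n] by (auto simp: diff_divide_distrib[symmetric])
  then show ?thesis
    using assms set_integral_diff(2)[OF set_integral_diff(1)[OF a b] g] set_integral_diff(2)[OF a b]
    by (simp add: incr_avg_def min_absorb2 del: set_integral_divide_zero)
qed

text \<open>Solving the decomposition of the increment of \<open>F\<close> for the forward average, all other terms
  converge uniformly.\<close>

theorem forward_average_limit:
  "uniform_limit {0..T} (\<lambda>n t. incr_avg (e n) x (\<lambda>s p r. dx F s p * (r - p)) 0 T t)
    (\<lambda>t. F t (x t) - F 0 (x 0) - (LINT s:{0..t}|lborel. dt T F s (x s))
       - 1 / 2 * (LINT s:{0<..t}|\<mu>. dxx F s (left_lim x s))
       - (\<Sum>\<^sub>\<infinity>s\<in>{0<..t}. F s (x s) - F s (left_lim x s) - dx F s (left_lim x s) * jump x s))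
    sequentially"
proof -
  have "uniform_limit {0..T}
    (\<lambda>n t. (LINT s:{0<..t}|lborel. (F (min (s + e n) t) (x (min (s + e n) t)) - F s (x s)) / e n)
    - (LINT s:{0<..t}|lborel. (F (min (s + e n) t) (x (min (s + e n) t)) - F s (x (min (s + e n) t))) / e n)
    - incr_avg (e n) x (\<lambda>s p r. F s r - F s p - dx F s p * (r - p)) 0 T t)
    (\<lambda>t. F t (x t) - F 0 (x 0) - (LINT s:{0<..t}|lborel. dt T F s (x s))
      - ((LINT s:{0<..t}|\<mu>. dxx F s (left_lim x s) / 2) + (\<Sum>\<^sub>\<infinity>s\<in>{0<..t}. jump_term s))) sequentially"
    by (intro uniform_limit_minus total_increment_limit time_increment_limit quadratic_remainder_limit)
  moreover have "(LINT s:{0<..t}|lborel. dt T F s (x s)) = (LINT s:{0..t}|lborel. dt T F s (x s))"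
    if "t \<in> {0..T}" for t
  proof -
    have "(LINT s:{0<..t}|lborel. dt T F s (x s)) = (LINT s:{0<..t}|lborel. dt T F (clip T s) (x s))"
      using that by (intro set_lebesgue_integral_cong) auto
    also have "\<dots> = (LINT s:{0..t}|lborel. dt T F (clip T s) (x s))"
      unfolding set_lebesgue_integral_def
    proof (rule integral_cong_AE)
      show "AE s in lborel. indicator {0<..t} s *\<^sub>R dt T F (clip T s) (x s)
          = indicator {0..t} s *\<^sub>R dt T F (clip T s) (x s)"
        using AE_lborel_singleton[of 0] by eventually_elim (auto simp: indicator_def)
    qed (use path_measurable[OF dt_continuous] in measurable)
    also have "\<dots> = (LINT s:{0..t}|lborel. dt T F s (x s))"
      using that by (intro set_lebesgue_integral_cong) auto
    finally show ?thesis .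
  qed
  ultimately show ?thesis
    by (subst (asm) uniform_limit_cong') (auto simp: forward_decomposition jump_def)
qed

end

section \<open>Reading the approximations along one path\<close>

text \<open>The value of the forward integral that Ito's formula prescribes: the formula, solved for it.\<close>

definition ito_forward ::
  "real \<Rightarrow> (real \<Rightarrow> real \<Rightarrow> real) \<Rightarrow> (real \<Rightarrow> real) \<Rightarrow> (real \<Rightarrow> real) \<Rightarrow> real \<Rightarrow> real" where
  "ito_forward T F x q t = F t (x t) - F 0 (x 0) - (LINT s:{0..t}|lborel. dt T F s (x s))
     - 1 / 2 * (LINT s:{0<..t}|stieltjes_measure T (continuous_part q). dxx F s (left_lim x s))
     - (\<Sum>\<^sub>\<infinity>s\<in>{0<..t}. F s (x s) - F s (left_lim x s) - dx F s (left_lim x s) * jump x s)"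

abbreviation forward_increment :: "(real \<Rightarrow> real \<Rightarrow> real) \<Rightarrow> real \<Rightarrow> real \<Rightarrow> real \<Rightarrow> real" where
  "forward_increment F s p r \<equiv> dx F s p * (r - p)"

lemma continuous3_forward_increment:
  assumes "C12 T F"
  shows "continuous3 T (forward_increment F)"
proof -
  have "continuous_on ({0..T} \<times> UNIV) (\<lambda>(s, p). dx F s p)"
    using assms by (simp add: C12_def)
  from continuous3_of_pair(1)[OF this] show ?thesis
    unfolding continuous3_def case_prod_beta by (intro continuous_intros)
qed

lemma covariation_approx_eq_incr_avg:
  assumes "0 \<le> t" "t \<le> T" "0 < \<epsilon>"
  shows "covariation_approx \<epsilon> X X t \<omega> = incr_avg \<epsilon> (\<lambda>s. X (clip T s) \<omega>) sq 0 T t"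
proof -
  have "min T t = t" using assms by simp
  then show ?thesis
    unfolding covariation_approx_def incr_avg_def power2_eq_square \<open>min T t = t\<close>
    using assms by (intro set_lebesgue_integral_cong) auto
qed

lemma forward_approx_eq_incr_avg:
  assumes "0 \<le> t" "t \<le> T" "0 < \<epsilon>"
  shows "forward_approx \<epsilon> (\<lambda>s \<omega>. dx F s (X s \<omega>)) X t \<omega>
    = incr_avg \<epsilon> (\<lambda>s. X (clip T s) \<omega>) (forward_increment F) 0 T t"
proof -
  have "min T t = t" using assms by simp
  then show ?thesis
    unfolding forward_approx_def incr_avg_def times_divide_eq_right \<open>min T t = t\<close>
    using assms by (intro set_lebesgue_integral_cong) auto
qed

text \<open>Here the results on paths on the whole line are read on the original path, which differs from the
  frozen one outside \<open>{0..T}\<close> only.\<close>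

lemma pathwise_ito:
  assumes "0 < T" "C12 T F" and path: "cadlag_path T (\<lambda>t. X t \<omega>)"
    and e: "\<And>n. 0 < e n" "e \<longlonglongrightarrow> 0"
    and conv: "uniform_limit {0..T} (\<lambda>n t. covariation_approx (e n) X X t \<omega>) q sequentially"
  shows "uniform_limit {0..T} (\<lambda>n t. forward_approx (e n) (\<lambda>s \<omega>. dx F s (X s \<omega>)) X t \<omega>)
      (ito_forward T F (\<lambda>s. X s \<omega>) q) sequentially" (is ?lim)
    and "\<And>t. 0 \<le> t \<Longrightarrow> t < T \<Longrightarrow>
      (ito_forward T F (\<lambda>s. X s \<omega>) q \<longlongrightarrow> ito_forward T F (\<lambda>s. X s \<omega>) q t) (at_right t)"
    and "set_integrable lborel {0..T} (\<lambda>s. dx F s (X s \<omega>))"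
    and "\<And>t. t \<in> {0..T} \<Longrightarrow> set_integrable lborel {0..t} (\<lambda>s. dt T F s (X s \<omega>))"
    and "\<And>t. t \<in> {0..T} \<Longrightarrow> set_integrable (stieltjes_measure T (continuous_part q)) {0<..t}
      (\<lambda>s. dxx F s (left_lim (\<lambda>s. X s \<omega>) s))"
    and "\<And>t. t \<in> {0..T} \<Longrightarrow> (\<lambda>s. F s (X s \<omega>) - F s (left_lim (\<lambda>s. X s \<omega>) s)
      - dx F s (left_lim (\<lambda>s. X s \<omega>) s) * jump (\<lambda>s. X s \<omega>) s) summable_on {0<..t}"
proof -
  let ?x = "\<lambda>s. X s \<omega>" and ?y = "\<lambda>s. X (clip T s) \<omega>"
  have y: "cadlag ?y" by (rule cadlag_clip[OF path \<open>0 < T\<close>])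
  obtain B where B: "\<forall>s\<in>{0..T}. \<bar>?y s\<bar> \<le> B"
    using cadlag_bounded[OF y, of 0 T] \<open>0 < T\<close> by auto
  have conv_y: "uniform_limit {0..T} (\<lambda>n t. incr_avg (e n) ?y sq 0 T t) q sequentially"
    using conv by (subst (asm) uniform_limit_cong'[where i = q])
      (auto simp: covariation_approx_eq_incr_avg e)
  interpret ito_path T ?y B e q F
    by unfold_locales (use assms y B conv_y in auto)
  have left: "left_lim ?y s = left_lim ?x s" if "0 < s" "s \<le> T" for s
    by (rule left_lim_cong[of 0]) (use that in auto)
  have jump: "jump ?y s = jump ?x s" if "0 < s" "s \<le> T" for s
    using left[OF that] that by (simp add: jump_def)
  have integrable_Icc: "set_integrable lborel {0..t} (\<lambda>s. f s (X s \<omega>))"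
    if "continuous_on ({0..T} \<times> UNIV) (\<lambda>(s, p). f s p)" "t \<in> {0..T}" for f :: "real \<Rightarrow> real \<Rightarrow> real" and t :: real
  proof -
    have "set_integrable lborel {0<..t} (\<lambda>s. f (clip T s) (?y s))
        = set_integrable lborel {0<..t} (\<lambda>s. f s (?y s))"
      using that by (intro set_integrable_cong) auto
    then have "set_integrable lborel {0<..t} (\<lambda>s. f (clip T s) (?y s))"
      using path_integrable[OF that(1), of 0 t] that by simp
    moreover have "set_integrable lborel {0<..t} (\<lambda>s. f (clip T s) (?y s))
        = set_integrable lborel {0..t} (\<lambda>s. f (clip T s) (?y s))"
      unfolding set_integrable_def
    proof (rule integrable_cong_AE)
      show "AE s in lborel. indicator {0<..t} s *\<^sub>R f (clip T s) (?y s)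
          = indicator {0..t} s *\<^sub>R f (clip T s) (?y s)"
        using AE_lborel_singleton[of 0] by eventually_elim (auto simp: indicator_def)
    qed (use path_measurable[OF that(1)] in measurable)
    moreover have "set_integrable lborel {0..t} (\<lambda>s. f (clip T s) (?y s))
        = set_integrable lborel {0..t} (\<lambda>s. f s (X s \<omega>))"
      using that by (intro set_integrable_cong) auto
    ultimately show ?thesis by simp
  qed
  show "set_integrable lborel {0..T} (\<lambda>s. dx F s (X s \<omega>))"
    using \<open>0 < T\<close> by (intro integrable_Icc dx_continuous) auto
  show "set_integrable lborel {0..t} (\<lambda>s. dt T F s (X s \<omega>))" if "t \<in> {0..T}" for t
    using that by (intro integrable_Icc dt_continuous) auto
  show "set_integrable \<mu> {0<..t} (\<lambda>s. dxx F s (left_lim ?x s))" if "t \<in> {0..T}" for t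
  proof -
    have "set_integrable \<mu> {0<..t} (\<lambda>s. 2 * (dxx F s (left_lim ?y s) / 2))"
      using that by (intro set_integrable_mult_right H_integrable) auto
    moreover have "set_integrable \<mu> {0<..t} (\<lambda>s. 2 * (dxx F s (left_lim ?y s) / 2))
        = set_integrable \<mu> {0<..t} (\<lambda>s. dxx F s (left_lim ?x s))"
      using that by (intro set_integrable_cong) (auto simp: left)
    ultimately show ?thesis by simp
  qed
  have J_eq: "F s (?y s) - F s (left_lim ?y s) - dx F s (left_lim ?y s) * jump ?y s
      = F s (?x s) - F s (left_lim ?x s) - dx F s (left_lim ?x s) * jump ?x s"
    if "0 < s" "s \<le> T" for s
    using that by (simp add: left jump)
  show "(\<lambda>s. F s (?x s) - F s (left_lim ?x s) - dx F s (left_lim ?x s) * jump ?x s) summable_on {0<..t}"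
    if "t \<in> {0..T}" for t
  proof -
    have "(\<lambda>s. F s (?y s) - F s (left_lim ?y s) - dx F s (left_lim ?y s) * jump ?y s) summable_on {0<..t}"
      using jump_term_summable[of 0 t] that by (simp add: jump_def)
    moreover have "(\<lambda>s. F s (?y s) - F s (left_lim ?y s) - dx F s (left_lim ?y s) * jump ?y s) summable_on {0<..t}
        \<longleftrightarrow> ((\<lambda>s. F s (?x s) - F s (left_lim ?x s) - dx F s (left_lim ?x s) * jump ?x s) summable_on {0<..t})"
      using that by (intro summable_on_cong J_eq) auto
    ultimately show ?thesis by simp
  qed
  have formula: "ito_forward T F ?y q t = ito_forward T F ?x q t" if "t \<in> {0..T}" for t
  proof -
    have "(LINT s:{0..t}|lborel. dt T F s (?y s)) = (LINT s:{0..t}|lborel. dt T F s (?x s))"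
      using that by (intro set_lebesgue_integral_cong) auto
    moreover have "(LINT s:{0<..t}|\<mu>. dxx F s (left_lim ?y s)) = (LINT s:{0<..t}|\<mu>. dxx F s (left_lim ?x s))"
      using that by (intro set_lebesgue_integral_cong) (auto simp: left)
    moreover have "(\<Sum>\<^sub>\<infinity>s\<in>{0<..t}. F s (?y s) - F s (left_lim ?y s) - dx F s (left_lim ?y s) * jump ?y s)
        = (\<Sum>\<^sub>\<infinity>s\<in>{0<..t}. F s (?x s) - F s (left_lim ?x s) - dx F s (left_lim ?x s) * jump ?x s)"
      using that by (intro infsum_cong J_eq) auto
    ultimately show ?thesis
      using that T_pos by (simp add: ito_forward_def)
  qed
  have "uniform_limit {0..T} (\<lambda>n t. incr_avg (e n) ?y (forward_increment F) 0 T t)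
      (ito_forward T F ?y q) sequentially"
    unfolding ito_forward_def[abs_def] by (rule forward_average_limit)
  then have lim_y: "uniform_limit {0..T} (\<lambda>n t. incr_avg (e n) ?y (forward_increment F) 0 T t)
      (ito_forward T F ?x q) sequentially"
    by (subst (asm) uniform_limit_cong'[where i = "ito_forward T F ?x q"]) (auto simp: formula)
  then show ?lim
    by (subst (asm) uniform_limit_cong'[where i = "ito_forward T F ?x q"])
      (auto simp: forward_approx_eq_incr_avg e)
  show "(ito_forward T F ?x q \<longlongrightarrow> ito_forward T F ?x q t) (at_right t)" if t: "0 \<le> t" "t < T" for t
  proof (rule swap_uniform_limit'[OF _ _ lim_y])
    show "\<forall>\<^sub>F n in sequentially. (incr_avg (e n) ?y (forward_increment F) 0 T \<longlongrightarrow>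
        incr_avg (e n) ?y (forward_increment F) 0 T t) (at_right t)"
      using t e by (intro always_eventually allI incr_avg_at_right continuous3_forward_increment assms) auto
    show "(\<lambda>n. incr_avg (e n) ?y (forward_increment F) 0 T t) \<longlonglongrightarrow> ito_forward T F ?x q t"
      using t by (intro tendsto_uniform_limitI[OF lim_y]) auto
    show "\<forall>\<^sub>F s in at_right t. s \<in> {0..T}"
      using t by (auto simp: eventually_at_right_field intro!: exI[of _ T])
  qed auto
qed

section \<open>Convergence along a sequence\<close>

text \<open>The Borel-Cantelli lemma, applied to measurable covers of the exceptional events.\<close>

lemma ucp_limit_subsequence:
  assumes ucp: "ucp_limit M T Z Z0" and e: "\<And>n. 0 < e n" "e \<longlonglongrightarrow> 0"
  shows "\<exists>r. strict_mono r \<and>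
    (AE \<omega> in M. uniform_limit {0..T} (\<lambda>n t. Z (e (r n)) t \<omega>) (\<lambda>t. Z0 t \<omega>) sequentially)"
proof -
  define A where "A \<delta> \<epsilon> = {\<omega> \<in> space M. \<exists>t\<in>{0..T}. \<bar>Z \<epsilon> t \<omega> - Z0 t \<omega>\<bar> > \<delta>}" for \<delta> \<epsilon>
  have e_right: "filterlim e (at_right 0) sequentially"
    unfolding filterlim_at using e by (simp add: less_imp_neq[THEN not_sym])
  have small: "\<forall>\<^sub>F n in sequentially. outer_measure_of M (A ((1 / 2) ^ k) (e n)) < ennreal ((1 / 2) ^ k)" for k
  proof -
    have "((\<lambda>\<epsilon>. outer_measure_of M (A ((1 / 2) ^ k) \<epsilon>)) \<longlongrightarrow> 0) (at_right 0)"
      using ucp unfolding ucp_limit_def A_def by simp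
    from filterlim_compose[OF this e_right] show ?thesis
      by (rule order_tendstoD(2)) simp
  qed
  have "\<exists>r. \<forall>k. outer_measure_of M (A ((1 / 2) ^ k) (e (r k))) < ennreal ((1 / 2) ^ k) \<and> r k < r (Suc k)"
  proof (rule dependent_nat_choice)
    show "\<exists>n. outer_measure_of M (A ((1 / 2) ^ 0) (e n)) < ennreal ((1 / 2) ^ 0)"
      using small[of 0] by (auto simp: eventually_sequentially)
    fix m k
    have "\<forall>\<^sub>F n in sequentially. outer_measure_of M (A ((1 / 2) ^ Suc k) (e n)) < ennreal ((1 / 2) ^ Suc k)
        \<and> m < n"
      using small[of "Suc k"] eventually_gt_at_top[of m] by eventually_elim simp
    then show "\<exists>n. outer_measure_of M (A ((1 / 2) ^ Suc k) (e n)) < ennreal ((1 / 2) ^ Suc k) \<and> m < n"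
      using eventually_happens by force
  qed
  then obtain r where r: "\<And>k. outer_measure_of M (A ((1 / 2) ^ k) (e (r k))) < ennreal ((1 / 2) ^ k)"
    "\<And>k. r k < r (Suc k)" by blast
  have "\<exists>E. \<forall>k. E k \<in> sets M \<and> A ((1 / 2) ^ k) (e (r k)) \<subseteq> E k \<and>
      outer_measure_of M (A ((1 / 2) ^ k) (e (r k))) = emeasure M (E k)"
    by (rule choice) (auto intro!: outer_measure_of_attain[unfolded Bex_def] simp: A_def)
  then obtain E where E: "\<And>k. E k \<in> sets M" "\<And>k. A ((1 / 2) ^ k) (e (r k)) \<subseteq> E k"
    "\<And>k. emeasure M (E k) < ennreal ((1 / 2) ^ k)"
    using r(1) by metis
  have "AE \<omega> in M. \<forall>\<^sub>F k in sequentially. \<omega> \<in> space M - E k"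
  proof (rule borel_cantelli_AE1)
    show "emeasure M (E k) < \<infinity>" for k
      using E(3)[of k] by (auto intro: less_trans)
    show "summable (\<lambda>k. measure M (E k))"
    proof (rule summable_comparison_test_ev)
      show "summable (\<lambda>k. (1 / 2 :: real) ^ k)" by (rule summable_geometric) simp
      have "measure M (E k) \<le> (1 / 2) ^ k" for k
        unfolding measure_def using E(3)[of k] by (intro enn2real_leI) auto
      then show "\<forall>\<^sub>F k in sequentially. norm (measure M (E k)) \<le> (1 / 2) ^ k" by simp
    qed
  qed (rule E(1))
  then have "AE \<omega> in M. uniform_limit {0..T} (\<lambda>n t. Z (e (r n)) t \<omega>) (\<lambda>t. Z0 t \<omega>) sequentially"
  proof eventually_elim
    case (elim \<omega>)
    show ?case
    proof (rule uniform_limitI)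
      fix \<kappa> :: real assume "0 < \<kappa>"
      have "(\<lambda>k. (1 / 2 :: real) ^ k) \<longlonglongrightarrow> 0" by (rule LIMSEQ_power_zero) simp
      from order_tendstoD(2)[OF this \<open>0 < \<kappa>\<close>] elim
      show "\<forall>\<^sub>F n in sequentially. \<forall>t\<in>{0..T}. dist (Z (e (r n)) t \<omega>) (Z0 t \<omega>) < \<kappa>"
      proof eventually_elim
        case (elim k)
        then have "\<omega> \<notin> A ((1 / 2) ^ k) (e (r k))" "\<omega> \<in> space M" using E(2)[of k] by auto
        then show ?case
          using elim(1) unfolding A_def dist_real_def by (auto simp: not_less intro: le_less_trans)
      qed
    qed
  qed
  moreover have "strict_mono r" using r(2) by (simp add: strict_mono_Suc_iff)
  ultimately show ?thesis by blast
qed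

lemma tendsto_subsequence_principle:
  assumes "\<And>r. strict_mono r \<Longrightarrow> \<exists>r'. strict_mono (r' :: nat \<Rightarrow> nat) \<and> (\<lambda>n. f (r (r' n))) \<longlonglongrightarrow> l"
  shows "f \<longlonglongrightarrow> l"
proof (rule topological_tendstoI, rule ccontr)
  fix S assume S: "open S" "l \<in> S" and "\<not> (\<forall>\<^sub>F n in sequentially. f n \<in> S)"
  then obtain r where r: "strict_mono (r :: nat \<Rightarrow> nat)" "\<And>n. f (r n) \<notin> S"
    using not_eventually_sequentiallyD by blast
  then obtain r' where "(\<lambda>n. f (r (r' n))) \<longlonglongrightarrow> l" using assms by blast
  from topological_tendstoD[OF this S] show False
    using r(2) by simp
qed

text \<open>This makes the event that a supremum over time exceeds \<open>\<delta>\<close> measurable. Without measurability, almost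
  sure convergence would not imply convergence in outer measure, as outer measure need not be continuous
  along decreasing sequences of sets.\<close>

lemma right_continuous_exceeds_at_rational:
  fixes g :: "real \<Rightarrow> real"
  assumes right: "\<And>t. 0 \<le> t \<Longrightarrow> t < T \<Longrightarrow> (g \<longlongrightarrow> g t) (at_right t)"
    and t: "t \<in> {0..T}" "\<delta> < \<bar>g t\<bar>"
  shows "\<exists>s\<in>insert T ({0..T} \<inter> \<rat>). \<delta> < \<bar>g s\<bar>"
proof (cases "t = T")
  case False
  then have "((\<lambda>s. \<bar>g s\<bar>) \<longlongrightarrow> \<bar>g t\<bar>) (at_right t)"
    using t by (intro tendsto_intros right) auto
  from order_tendstoD(1)[OF this t(2)] obtain b where b: "t < b" "\<And>s. t < s \<Longrightarrow> s < b \<Longrightarrow> \<delta> < \<bar>g s\<bar>"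
    by (auto simp: eventually_at_right_field)
  have "t < min b T" using b(1) False t by auto
  then obtain s where "s \<in> \<rat>" "t < s" "s < min b T"
    using Rats_dense_in_real by blast
  then show ?thesis using b(2)[of s] t by auto
qed (use t in auto)

lemma incr_avg_random_measurable:
  assumes G: "continuous3 T G" and "0 \<le> t" "t \<le> T" "0 < \<epsilon>"
    and X: "(\<lambda>(\<omega>, s). X s \<omega>) \<in> borel_measurable (M \<Otimes>\<^sub>M borel)"
  shows "(\<lambda>\<omega>. incr_avg \<epsilon> (\<lambda>s. X s \<omega>) G 0 T t) \<in> borel_measurable M"
proof -
  have [measurable]: "(\<lambda>p. X (f p) (g p)) \<in> borel_measurable N"
    if "f \<in> borel_measurable N" "g \<in> measurable N M" for f g and N :: "'b measure"
    using measurable_compose[OF measurable_Pair[OF that(2,1)] X] by simp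
  have "(\<lambda>p. G (clip T (snd p)) (X (snd p) (fst p)) (X (min (snd p + \<epsilon>) t) (fst p)))
      \<in> borel_measurable (M \<Otimes>\<^sub>M lborel)"
    using assms by (intro continuous3_measurable[OF G]) auto
  then have "(\<lambda>(\<omega>, s). indicator {0<..t} s *\<^sub>R (G (clip T s) (X s \<omega>) (X (min (s + \<epsilon>) t) \<omega>) / \<epsilon>))
      \<in> borel_measurable (M \<Otimes>\<^sub>M lborel)"
    unfolding case_prod_beta by measurable
  then have "(\<lambda>\<omega>. LINT s:{0<..t}|lborel. G (clip T s) (X s \<omega>) (X (min (s + \<epsilon>) t) \<omega>) / \<epsilon>) \<in> borel_measurable M"
    unfolding set_lebesgue_integral_def by (rule lborel.borel_measurable_lebesgue_integral)
  moreover have "incr_avg \<epsilon> (\<lambda>s. X s \<omega>) G 0 T t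
      = (LINT s:{0<..t}|lborel. G (clip T s) (X s \<omega>) (X (min (s + \<epsilon>) t) \<omega>) / \<epsilon>)" for \<omega>
  proof -
    have "min T t = t" using assms by simp
    then show ?thesis
      unfolding incr_avg_def \<open>min T t = t\<close> using assms by (intro set_lebesgue_integral_cong) auto
  qed
  ultimately show ?thesis by simp
qed

section \<open>Ito's formula for processes of finite quadratic variation\<close>

lemma emeasure_tendsto_zero:
  assumes "prob_space M" and D: "\<And>n. D n \<in> sets M"
    and ev: "AE \<omega> in M. \<forall>\<^sub>F n in sequentially. \<omega> \<notin> D n"
  shows "(\<lambda>n. emeasure M (D n)) \<longlonglongrightarrow> 0"
proof -
  interpret prob_space M by fact
  have "(\<lambda>n. integral\<^sup>L M (indicator (D n) :: _ \<Rightarrow> real)) \<longlonglongrightarrow> integral\<^sup>L M (\<lambda>_. 0 :: real)"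
  proof (rule integral_dominated_convergence[where w = "\<lambda>_. 1"])
    show "AE \<omega> in M. (\<lambda>n. indicator (D n) \<omega> :: real) \<longlonglongrightarrow> 0"
      using ev
    proof eventually_elim
      case (elim \<omega>)
      then have "\<forall>\<^sub>F n in sequentially. indicator (D n) \<omega> = (0 :: real)"
        by eventually_elim simp
      then show ?case by (rule tendsto_eventually)
    qed
  qed (use D in \<open>auto simp: indicator_def\<close>)
  then have "(\<lambda>n. measure M (D n)) \<longlonglongrightarrow> 0"
    using D by simp
  then have "(\<lambda>n. ennreal (measure M (D n))) \<longlonglongrightarrow> ennreal 0"
    by (rule tendsto_ennrealI)
  then show ?thesis
    by (simp add: emeasure_eq_measure)
qed

text \<open>The process \<open>I\<close> is the limit along one subsequence. On almost every path it equals the value prescribed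
  by Ito's formula, and the approximations converge to that same value along a subsequence of any
  other sequence.\<close>

lemma forward_integral_exists:
  fixes X :: "real \<Rightarrow> 'a \<Rightarrow> real"
  assumes "0 < T" and prob: "prob_space M" and X: "cadlag_process M T X" and C12: "C12 T F"
    and Q: "is_covariation M T X X Q"
  shows "\<exists>I. is_forward_integral M T (\<lambda>s \<omega>. dx F s (X s \<omega>)) X I"
proof -
  let ?W0 = "\<lambda>\<epsilon>. forward_approx \<epsilon> (\<lambda>s \<omega>. dx F s (X s \<omega>)) X"
  define V where "V \<omega> = ito_forward T F (\<lambda>s. X s \<omega>) (\<lambda>s. Q s \<omega>)" for \<omega>
  have ucp: "ucp_limit M T (\<lambda>\<epsilon>. covariation_approx \<epsilon> X X) Q"
    and X_meas: "\<And>t. t \<in> {0..T} \<Longrightarrow> X t \<in> borel_measurable M"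
    and X_path: "AE \<omega> in M. cadlag_path T (\<lambda>t. X t \<omega>)"
    using Q X by (auto simp: is_covariation_def cadlag_process_def process_def)
  obtain r0 where r0: "strict_mono r0"
    "AE \<omega> in M. uniform_limit {0..T} (\<lambda>n t. covariation_approx (inverse (real (Suc (r0 n)))) X X t \<omega>)
      (\<lambda>t. Q t \<omega>) sequentially"
    using ucp_limit_subsequence[OF ucp _ LIMSEQ_inverse_real_of_nat] by auto
  define e where "e n = inverse (real (Suc (r0 n)))" for n
  have e: "\<And>n. 0 < e n" "e \<longlonglongrightarrow> 0"
    using LIMSEQ_subseq_LIMSEQ[OF LIMSEQ_inverse_real_of_nat r0(1)] by (auto simp: e_def[abs_def] comp_def)
  have "AE \<omega> in M. cadlag_path T (\<lambda>t. X t \<omega>) \<and>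
      uniform_limit {0..T} (\<lambda>n t. covariation_approx (e n) X X t \<omega>) (\<lambda>t. Q t \<omega>) sequentially"
    using X_path r0(2) unfolding e_def by eventually_elim simp
  then obtain N where N: "N \<in> null_sets M" "\<And>\<omega>. \<omega> \<in> space M - N \<Longrightarrow> cadlag_path T (\<lambda>t. X t \<omega>)"
    "\<And>\<omega>. \<omega> \<in> space M - N \<Longrightarrow>
      uniform_limit {0..T} (\<lambda>n t. covariation_approx (e n) X X t \<omega>) (\<lambda>t. Q t \<omega>) sequentially"
    unfolding eventually_ae_filter by blast
  \<comment> \<open>Modifying the process on a null set makes all its paths cadlag, hence the approximations
    measurable in \<open>\<omega>\<close>.\<close>
  define X' where "X' t \<omega> = (if \<omega> \<in> space M - N then X (clip T t) \<omega> else 0)" for t \<omega>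
  have X'_meas: "X' t \<in> borel_measurable M" for t
  proof -
    have "X (clip T t) \<in> borel_measurable M" using \<open>0 < T\<close> by (intro X_meas clip_mem) simp
    then show ?thesis
      unfolding X'_def using N(1) by (intro measurable_If_set) auto
  qed
  have X'_cadlag: "cadlag (\<lambda>t. X' t \<omega>)" if "\<omega> \<in> space M" for \<omega>
  proof (cases "\<omega> \<in> N")
    case True
    then show ?thesis by (auto simp: X'_def cadlag_def)
  next
    case False
    then have "(\<lambda>t. X' t \<omega>) = (\<lambda>t. X (clip T t) \<omega>)" using that by (auto simp: X'_def)
    then show ?thesis using cadlag_clip[OF N(2) \<open>0 < T\<close>] False that by simp
  qed
  define W where "W \<epsilon> t \<omega> = incr_avg \<epsilon> (\<lambda>s. X' s \<omega>) (forward_increment F) 0 T t" for \<epsilon> t \<omega>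
  have W_meas: "W \<epsilon> t \<in> borel_measurable M" if "t \<in> {0..T}" "0 < \<epsilon>" for \<epsilon> t
    unfolding W_def using that
    by (intro incr_avg_random_measurable continuous3_forward_increment[OF C12]
        jointly_measurable_cadlag X'_meas X'_cadlag) auto
  have W_eq: "W \<epsilon> t \<omega> = ?W0 \<epsilon> t \<omega>" if "t \<in> {0..T}" "0 < \<epsilon>" "\<omega> \<in> space M - N" for \<epsilon> t \<omega>
    using that by (simp add: W_def X'_def forward_approx_eq_incr_avg[of t T])
  define I where "I t \<omega> = lim (\<lambda>n. W (e n) t \<omega>)" for t \<omega>
  have I_meas: "I t \<in> borel_measurable M" if "t \<in> {0..T}" for t
    unfolding I_def using W_meas[OF that e(1)] by (rule borel_measurable_lim_metric)
  have I_eq: "I t \<omega> = V \<omega> t" if "t \<in> {0..T}" "\<omega> \<in> space M - N" for t \<omega>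
  proof -
    have "(\<lambda>n. ?W0 (e n) t \<omega>) \<longlonglongrightarrow> V \<omega> t"
      unfolding V_def
      by (rule tendsto_uniform_limitI[OF pathwise_ito(1)[OF \<open>0 < T\<close> C12 N(2) e N(3)]]) (use that in auto)
    then have "(\<lambda>n. W (e n) t \<omega>) \<longlonglongrightarrow> V \<omega> t"
      using that e(1) by (simp add: W_eq)
    then show ?thesis unfolding I_def by (rule limI)
  qed
  have right: "((\<lambda>t. W \<epsilon> t \<omega> - I t \<omega>) \<longlongrightarrow> W \<epsilon> t \<omega> - I t \<omega>) (at_right t)"
    if "\<omega> \<in> space M - N" "0 < \<epsilon>" "0 \<le> t" "t < T" for \<omega> \<epsilon> t
  proof -
    obtain B where B: "\<forall>s\<in>{0..T}. \<bar>X' s \<omega>\<bar> \<le> B"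
      using cadlag_bounded[OF X'_cadlag, of \<omega> 0 T] \<open>\<omega> \<in> space M - N\<close> \<open>0 < T\<close> by auto
    interpret bounded_cadlag T "\<lambda>s. X' s \<omega>" B
      by unfold_locales (use that B X'_cadlag \<open>0 < T\<close> in auto)
    have "((\<lambda>t. W \<epsilon> t \<omega>) \<longlongrightarrow> W \<epsilon> t \<omega>) (at_right t)"
      unfolding W_def using that by (intro incr_avg_at_right continuous3_forward_increment[OF C12])
    moreover have "((\<lambda>t. I t \<omega>) \<longlongrightarrow> I t \<omega>) (at_right t)"
    proof -
      have "(V \<omega> \<longlongrightarrow> V \<omega> t) (at_right t)"
        unfolding V_def using that by (intro pathwise_ito(2)[OF \<open>0 < T\<close> C12 N(2) e N(3)]) auto
      moreover have "\<forall>\<^sub>F s in at_right t. V \<omega> s = I s \<omega>"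
        unfolding eventually_at_right_field using that I_eq by (intro exI[of _ T]) auto
      moreover have "V \<omega> t = I t \<omega>" using I_eq that by simp
      ultimately show ?thesis by (auto intro: Lim_transform_eventually)
    qed
    ultimately show ?thesis by (rule tendsto_diff)
  qed
  have "ucp_limit M T ?W0 I"
    unfolding ucp_limit_def
  proof (intro allI impI)
    fix \<delta> :: real assume "0 < \<delta>"
    define A where "A \<epsilon> = {\<omega> \<in> space M. \<exists>t\<in>{0..T}. \<bar>?W0 \<epsilon> t \<omega> - I t \<omega>\<bar> > \<delta>}" for \<epsilon>
    \<comment> \<open>\<open>T\<close> is added because right-continuity says nothing about the last time point.\<close>
    define D where "D \<epsilon> = {\<omega> \<in> space M. \<exists>t\<in>insert T ({0..T} \<inter> \<rat>). \<delta> < \<bar>W \<epsilon> t \<omega> - I t \<omega>\<bar>}" for \<epsilon>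
    have D_sets: "D \<epsilon> \<in> sets M" if "0 < \<epsilon>" for \<epsilon>
      unfolding D_def
    proof (rule sets.sets_Collect_countable_Ex')
      show "countable (insert T ({0..T} \<inter> \<rat>))" using countable_rat by auto
      show "{\<omega> \<in> space M. \<delta> < \<bar>W \<epsilon> t \<omega> - I t \<omega>\<bar>} \<in> sets M" if "t \<in> insert T ({0..T} \<inter> \<rat>)" for t
      proof -
        have [measurable]: "W \<epsilon> t \<in> borel_measurable M" "I t \<in> borel_measurable M"
          using that \<open>0 < T\<close> \<open>0 < \<epsilon>\<close> by (auto intro!: W_meas I_meas)
        show ?thesis by measurable
      qed
    qed
    have A_le: "outer_measure_of M (A \<epsilon>) \<le> emeasure M (D \<epsilon>)" if "0 < \<epsilon>" for \<epsilon>
    proof -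
      have "A \<epsilon> \<subseteq> D \<epsilon> \<union> N"
      proof
        fix \<omega> assume "\<omega> \<in> A \<epsilon>"
        then obtain t where \<omega>: "\<omega> \<in> space M" and t: "t \<in> {0..T}" "\<delta> < \<bar>?W0 \<epsilon> t \<omega> - I t \<omega>\<bar>"
          by (auto simp: A_def)
        show "\<omega> \<in> D \<epsilon> \<union> N"
        proof (cases "\<omega> \<in> N")
          case False
          then have "\<delta> < \<bar>W \<epsilon> t \<omega> - I t \<omega>\<bar>" using t \<omega> that by (simp add: W_eq)
          from right_continuous_exceeds_at_rational[where g = "\<lambda>t. W \<epsilon> t \<omega> - I t \<omega>", OF right t(1) this]
          have "\<exists>s\<in>insert T ({0..T} \<inter> \<rat>). \<delta> < \<bar>W \<epsilon> s \<omega> - I s \<omega>\<bar>"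
            using False \<omega> that by auto
          then show ?thesis using \<omega> by (simp add: D_def)
        qed simp
      qed
      then have "outer_measure_of M (A \<epsilon>) \<le> outer_measure_of M (D \<epsilon> \<union> N)"
        by (rule outer_measure_of_mono)
      also have "\<dots> = emeasure M (D \<epsilon> \<union> N)"
        using D_sets[OF that] N(1) by (intro outer_measure_of_eq) auto
      also have "\<dots> = emeasure M (D \<epsilon>)"
        using D_sets[OF that] N(1) by (rule emeasure_Un_null_set)
      finally show ?thesis .
    qed
    have "((\<lambda>\<epsilon>. outer_measure_of M (A \<epsilon>)) \<longlongrightarrow> 0) (at_right 0)"
    proof (rule tendsto_at_right_sequentially[of 0 1])
      fix S :: "nat \<Rightarrow> real" assume S: "\<And>n. 0 < S n" "S \<longlonglongrightarrow> 0"
      show "(\<lambda>n. outer_measure_of M (A (S n))) \<longlonglongrightarrow> 0"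
      proof (rule tendsto_subsequence_principle)
        fix r :: "nat \<Rightarrow> nat" assume r: "strict_mono r"
        have Sr: "(\<lambda>n. S (r n)) \<longlonglongrightarrow> 0"
          using LIMSEQ_subseq_LIMSEQ[OF S(2) r] by (simp add: comp_def)
        obtain r' where r': "strict_mono r'" "AE \<omega> in M. uniform_limit {0..T}
            (\<lambda>n t. covariation_approx (S (r (r' n))) X X t \<omega>) (\<lambda>t. Q t \<omega>) sequentially"
          using ucp_limit_subsequence[OF ucp S(1) Sr] by blast
        have Sr': "(\<lambda>n. S (r (r' n))) \<longlonglongrightarrow> 0"
          using LIMSEQ_subseq_LIMSEQ[OF Sr r'(1)] by (simp add: comp_def)
        have "AE \<omega> in M. \<forall>\<^sub>F n in sequentially. \<omega> \<notin> D (S (r (r' n)))"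
          using r'(2) AE_not_in[OF N(1)] AE_space
        proof eventually_elim
          case (elim \<omega>)
          then have \<omega>: "\<omega> \<in> space M - N" by simp
          have "uniform_limit {0..T} (\<lambda>n t. ?W0 (S (r (r' n))) t \<omega>) (V \<omega>) sequentially"
            unfolding V_def by (rule pathwise_ito(1)[OF \<open>0 < T\<close> C12 N(2)[OF \<omega>] S(1) Sr' elim(1)])
          from uniform_limitD[OF this \<open>0 < \<delta>\<close>] show ?case
          proof eventually_elim
            case (elim n)
            have less: "\<bar>W (S (r (r' n))) t \<omega> - I t \<omega>\<bar> < \<delta>" if "t \<in> {0..T}" for t
              using bspec[OF elim that] that \<omega> S(1) by (simp add: W_eq I_eq dist_real_def)
            show ?case
            proof
              assume "\<omega> \<in> D (S (r (r' n)))"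
              then obtain t where "t \<in> insert T ({0..T} \<inter> \<rat>)"
                "\<delta> < \<bar>W (S (r (r' n))) t \<omega> - I t \<omega>\<bar>"
                unfolding D_def by blast
              then show False using less[of t] \<open>0 < T\<close> by auto
            qed
          qed
        qed
        then have "(\<lambda>n. emeasure M (D (S (r (r' n))))) \<longlonglongrightarrow> 0"
          by (intro emeasure_tendsto_zero prob D_sets S(1))
        then have "(\<lambda>n. outer_measure_of M (A (S (r (r' n))))) \<longlonglongrightarrow> 0"
          by (rule tendsto_sandwich[OF _ _ tendsto_const, rotated 2]) (auto intro!: A_le S(1) always_eventually)
        then show "\<exists>r'. strict_mono (r' :: nat \<Rightarrow> nat) \<and> (\<lambda>n. outer_measure_of M (A (S (r (r' n))))) \<longlonglongrightarrow> 0"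
          using r'(1) by blast
      qed
    qed simp
    then show "((\<lambda>\<epsilon>. outer_measure_of M {\<omega> \<in> space M. \<exists>t\<in>{0..T}. \<bar>?W0 \<epsilon> t \<omega> - I t \<omega>\<bar> > \<delta>}) \<longlongrightarrow> 0)
        (at_right 0)"
      by (simp add: A_def)
  qed
  moreover have "process M T (\<lambda>s \<omega>. dx F s (X s \<omega>))"
    unfolding process_def
  proof
    fix t assume t: "t \<in> {0..T}"
    have "continuous_on UNIV (dx F t)"
    proof -
      have "dx F t differentiable (at p)" for p using C12 t by (simp add: C12_def)
      then show ?thesis
        by (intro continuous_at_imp_continuous_on ballI differentiable_imp_continuous_within)
    qed
    then show "(\<lambda>\<omega>. dx F t (X t \<omega>)) \<in> borel_measurable M"
      by (rule measurable_compose[OF X_meas[OF t] borel_measurable_continuous_onI])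
  qed
  moreover have "AE \<omega> in M. set_integrable lborel {0..T} (\<lambda>s. dx F s (X s \<omega>))"
    using AE_not_in[OF N(1)] AE_space
    by eventually_elim (rule pathwise_ito(3)[OF \<open>0 < T\<close> C12 N(2) e N(3)]; simp)
  moreover have "process M T I"
    using I_meas by (simp add: process_def)
  ultimately show ?thesis
    using X unfolding is_forward_integral_def by blast
qed

text \<open>Any version of the forward integral is the uniform limit of its approximations along some
  subsequence, on almost every path, and so is the value prescribed by Ito's formula.\<close>

lemma forward_integral_formula:
  fixes X :: "real \<Rightarrow> 'a \<Rightarrow> real"
  assumes "0 < T" and C12: "C12 T F"
    and I: "is_forward_integral M T (\<lambda>s \<omega>. dx F s (X s \<omega>)) X I"
    and Q: "is_covariation M T X X Q"
  shows "AE \<omega> in M.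
        let x = (\<lambda>s. X s \<omega>); x' = left_lim x;
            \<mu> = stieltjes_measure T (continuous_part (\<lambda>s. Q s \<omega>));
            J = (\<lambda>s. F s (x s) - F s (x' s) - dx F s (x' s) * jump x s)
        in \<forall>t\<in>{0..T}.
          set_integrable lborel {0..t} (\<lambda>s. dt T F s (x s)) \<and>
          set_integrable \<mu> {0<..t} (\<lambda>s. dxx F s (x' s)) \<and>
          J summable_on {0<..t} \<and>
          F t (x t) = F 0 (x 0) + (LINT s:{0..t}|lborel. dt T F s (x s)) + I t \<omega>
            + 1 / 2 * (LINT s:{0<..t}|\<mu>. dxx F s (x' s)) + (\<Sum>\<^sub>\<infinity>s\<in>{0<..t}. J s)"
proof -
  let ?W0 = "\<lambda>\<epsilon>. forward_approx \<epsilon> (\<lambda>s \<omega>. dx F s (X s \<omega>)) X"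
  have ucp: "ucp_limit M T (\<lambda>\<epsilon>. covariation_approx \<epsilon> X X) Q" "ucp_limit M T ?W0 I"
    and X_path: "AE \<omega> in M. cadlag_path T (\<lambda>t. X t \<omega>)"
    using Q I by (auto simp: is_covariation_def is_forward_integral_def cadlag_process_def)
  obtain r where r: "strict_mono r"
    "AE \<omega> in M. uniform_limit {0..T} (\<lambda>n t. covariation_approx (inverse (real (Suc (r n)))) X X t \<omega>)
      (\<lambda>t. Q t \<omega>) sequentially"
    using ucp_limit_subsequence[OF ucp(1) _ LIMSEQ_inverse_real_of_nat] by auto
  define e where "e n = inverse (real (Suc (r n)))" for n
  have e: "\<And>n. 0 < e n" "e \<longlonglongrightarrow> 0"
    using LIMSEQ_subseq_LIMSEQ[OF LIMSEQ_inverse_real_of_nat r(1)] by (auto simp: e_def[abs_def] comp_def)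
  obtain r' where r': "strict_mono r'"
    "AE \<omega> in M. uniform_limit {0..T} (\<lambda>n t. ?W0 (e (r' n)) t \<omega>) (\<lambda>t. I t \<omega>) sequentially"
    using ucp_limit_subsequence[OF ucp(2) e] by blast
  have e': "(\<lambda>n. e (r' n)) \<longlonglongrightarrow> 0"
    using LIMSEQ_subseq_LIMSEQ[OF e(2) r'(1)] by (simp add: comp_def)
  from X_path r(2)[folded e_def] r'(2) show ?thesis
  proof eventually_elim
    case (elim \<omega>)
    have conv: "uniform_limit {0..T} (\<lambda>n t. covariation_approx (e (r' n)) X X t \<omega>) (\<lambda>t. Q t \<omega>) sequentially"
      by (rule filterlim_compose[OF elim(2) filterlim_subseq[OF r'(1)]])
    note ito = pathwise_ito[OF \<open>0 < T\<close> C12 elim(1) e(1) e' conv]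
    have "I t \<omega> = ito_forward T F (\<lambda>s. X s \<omega>) (\<lambda>s. Q s \<omega>) t" if "t \<in> {0..T}" for t
      using tendsto_uniform_limitI[OF elim(3) that] tendsto_uniform_limitI[OF ito(1) that]
      by (rule LIMSEQ_unique)
    then show ?case
      unfolding Let_def using ito(4-6) by (auto simp: ito_forward_def)
  qed
qed

theorem theorem3p1:
  fixes T :: real and M :: "'a measure" and \<F> :: "real \<Rightarrow> 'a measure"
    and X :: "real \<Rightarrow> 'a \<Rightarrow> real" and F :: "real \<Rightarrow> real \<Rightarrow> real"
  assumes "0 < T" and "prob_space M" and "usual_conditions M T \<F>"
    and "cadlag_process M T X" and "finite_quadratic_variation M T X"
    and "C12 T F"
  shows "(\<exists>I. is_forward_integral M T (\<lambda>s \<omega>. dx F s (X s \<omega>)) X I) \<and>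
    (\<forall>I Q. is_forward_integral M T (\<lambda>s \<omega>. dx F s (X s \<omega>)) X I \<longrightarrow> is_covariation M T X X Q \<longrightarrow>
      (AE \<omega> in M.
        let x = (\<lambda>s. X s \<omega>); x' = left_lim x;
            \<mu> = stieltjes_measure T (continuous_part (\<lambda>s. Q s \<omega>));
            J = (\<lambda>s. F s (x s) - F s (x' s) - dx F s (x' s) * jump x s)
        in \<forall>t\<in>{0..T}.
          set_integrable lborel {0..t} (\<lambda>s. dt T F s (x s)) \<and>
          set_integrable \<mu> {0<..t} (\<lambda>s. dxx F s (x' s)) \<and>
          J summable_on {0<..t} \<and>
          F t (x t) = F 0 (x 0) + (LINT s:{0..t}|lborel. dt T F s (x s)) + I t \<omega>
            + 1 / 2 * (LINT s:{0<..t}|\<mu>. dxx F s (x' s)) + (\<Sum>\<^sub>\<infinity>s\<in>{0<..t}. J s)))"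
proof (intro conjI allI impI)
  obtain Q where "is_covariation M T X X Q"
    using assms(5) unfolding finite_quadratic_variation_def by blast
  then show "\<exists>I. is_forward_integral M T (\<lambda>s \<omega>. dx F s (X s \<omega>)) X I"
    by (rule forward_integral_exists[OF assms(1,2,4,6)])
qed (rule forward_integral_formula[OF assms(1,6)])

end
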